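(* Let $d\in\mathbb{N}$, $d\ge2$, $\beta\ge1$, $\ell$ the largest integer strictly smaller than $\beta$, $L_0,\dots,L_\ell,L_\beta>0$, $C_{\mathsf{noise}},C_{\mathsf{cvrtm}}>0$. There is a constant $C>0$ large enough, depending only on $\beta,d,L_0,\dots,L_\ell,L_\beta,C_{\mathsf{noise}},C_{\mathsf{cvrtm}}$, with the following property. Consider the snake model described in the context with parameters $n\in\mathbb{N}$, $\delta>0$, $T_{\mathsf{sum}}>0$, satisfying (Noise) and (CoverTime). Assume $$C\max\Big(\Big(\frac{T_{\mathsf{sum}}}{n}\Big)^{2\beta+d+1},\,T_{\mathsf{sum}}^{-1}\Big)\le\delta^{d-1}\le C^{-1}\min\Big(1,\frac{n}{T_{\mathsf{sum}}}\Big).$$ Then $$\forall x_0\in[0,1]^d:\ C\inf_{\hat f}\sup_{\theta^\star\in\Theta^{\mathsf{snake}}_{d,\beta}}\mathbf{E}_{\theta^\star}\big[\|\hat f(x_0)-f_{\theta^\star}(x_0)\|_2^2\big]\ge n^{-\frac{2\beta}{2(\beta+1)+d}},$$ $$C\inf_{\hat f}\sup_{\theta^\star\in\Theta^{\mathsf{snake}}_{d,\beta}}\mathbf{E}_{\theta^\star}\Big[\sup_{x\in[0,1]^d}\|\hat f(x)-f_{\theta^\star}(x)\|_2^2\Big]\ge\Big(\frac{n}{\log n}\Big)^{-\frac{2\beta}{2(\beta+1)+d}},$$ $$C\inf_{\hat f}\sup_{\theta^\star\in\Theta^{\mathsf{snake}}_{d,\beta}}\mathbf{E}_{\theta^\star}\Big[\big\|\,\|\hat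 f-f_{\theta^\star}\|_2\,\big\|_{L^2([0,1]^d)}^2\Big]\ge n^{-\frac{2\beta}{2(\beta+1)+d}},$$ where the infima range over all estimators $\hat f$ of $f_{\theta^\star}$ based on the observations $(Y_{j,i})$.
   Context: Smoothness class: $\mathcal{F}_{d,\beta}$ is the set of functions $f=(f_1,\dots,f_d):\mathbb{R}^d\to\mathbb{R}^d$ such that each component $f_j$ is $\ell$ times differentiable, $\sup_x\|D^kf_j(x)\|_{\mathsf{op}}\le L_k$ for $k=0,\dots,\ell$, and $\|D^\ell f_j(x)-D^\ell f_j(\tilde x)\|_{\mathsf{op}}\le L_\beta\|x-\tilde x\|_2^{\beta-\ell}$ for all $x,\tilde x\in\mathbb{R}^d$. Here $D^k f_j(x)$ is the $k$-th derivative as a symmetric $k$-linear form and $\|A\|_{\mathsf{op}}=\sup\{|A(v_1,\dots,v_k)|:\|v_i\|_2=1\}$; $\|\cdot\|_2$ is the Euclidean norm. Flow: for Lipschitz $f:\mathbb{R}^d\to\mathbb{R}^d$ and $x\in\mathbb{R}^d$, $t\mapsto U(f,x,t)$ is the solution of $\dot u(t)=f(u(t))$, $u(0)=x$. Tube: for continuously differentiable $u:[0,T]\to\mathbb{R}^d$ and $\delta>0$, $$\mathcal{T}(u,\delta)=\bigcup_{t\in[0,T]}\{u(t)+v:\ \dot u(t)\ne0,\ v^\top\dot u(t)=0,\ \|v\|_2\le\delta\}.$$ Tube distance: for $\theta=(f,(x_j)_{j=1}^m,(T_j)_{j=1}^m)$ with $f$ Lipschitz, $x_j\in\mathbb{R}^d$,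 $T_j>0$, let $u_j=U(f,x_j,\cdot):[0,T_j]\to\mathbb{R}^d$; for $A\subseteq\mathbb{R}^d$, $d_{\mathcal{T}}(A,\theta)=\inf\{\delta>0:\ A\subseteq\bigcup_{j=1}^m\mathcal{T}(u_j,\delta)\}$. Snake parameter class: $\Theta^{\mathsf{snake}}_{d,\beta}$ (depending on $L_0,\dots,L_\ell,L_\beta,\delta,T_{\mathsf{sum}}$) is the set of all $\theta=(f,(x_j)_{j=1}^m,(T_j)_{j=1}^m)\in\mathcal{F}_{d,\beta}\times(\mathbb{R}^d)^m\times(0,\infty)^m$ with $m\in\mathbb{N}$, $\sum_{j=1}^mT_j=T_{\mathsf{sum}}$, and $d_{\mathcal{T}}([0,1]^d,\theta)\le\delta$. Write $f_\theta=f$. Observation model: for $\theta^\star=(f^\star,(x_j)_{j=1}^m,(T_j)_{j=1}^m)\in\Theta^{\mathsf{snake}}_{d,\beta}$ one observes $$Y_{j,i}=U(f^\star,x_j,t_{j,i})+\varepsilon_{j,i},\qquad j\in\{1,\dots,m\},\ i\in\{1,\dots,n_j\},$$ where $n_1,\dots,n_m\in\mathbb{N}$ with $\sum_jn_j=n$ (so $m\le n$), the observation times satisfy $0\le t_{j,1}\le\dots\le t_{j,n_j}=T_j$, and $\varepsilon_{j,i}$ are i.i.d. centered $\mathbb{R}^d$-valued with distribution $P^\varepsilon$. The design $(n_j),(t_{j,i})$ is fixed for each $(m,(T_j)_{j=1}^m)$. The initial conditions $x_j$ and times $t_{j,i}$ are known; only $f^\star$ is unknown. $\mathbf{E}_{\theta^\star}$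 is the corresponding expectation. (Noise): for all $v_1,v_2\in\mathbb{R}^d$, $\mathrm{KL}(v_1+P^\varepsilon,v_2+P^\varepsilon)\le C_{\mathsf{noise}}\|v_1-v_2\|_2^2$, with $\mathrm{KL}$ the Kullback–Leibler divergence and $v+P$ the distribution $P$ shifted by $v$. (CoverTime): for all $j$ and all $a,b\in[0,T_j]$ with $a<b$, $\#\{i\in\{1,\dots,n_j\}:t_{j,i}\in[a,b]\}\le\max\big(1,\,C_{\mathsf{cvrtm}}(b-a)\frac{n}{T_{\mathsf{sum}}}\big)$; this holds for every design in the model with the same constant. *)

theory Defs
  imports "HOL-Probability.Probability"
begin

section \<open>Smoothness class\<close>

text \<open>
  \<open>iter_deriv g [v\<^sub>1, \<dots>, v\<^sub>k] x\<close> is \<open>D\<^sup>k g(x)(v\<^sub>1, \<dots>, v\<^sub>k)\<close>, that is, the Frechet derivative of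
  \<open>x \<mapsto> D\<^sup>k\<^sup>-\<^sup>1 g(x)(v\<^sub>2, \<dots>, v\<^sub>k)\<close> in direction \<open>v\<^sub>1\<close>.  The space of \<open>k\<close>-linear forms is
  finite-dimensional, so \<open>D\<^sup>k g\<close> is differentiable as a map into that space iff all its
  evaluations at vectors \<open>v\<^sub>1, \<dots>, v\<^sub>k\<close> are; this is what \<open>times_differentiable\<close> requires at each
  order.
\<close>

fun iter_deriv :: "('a::real_normed_vector \<Rightarrow> real) \<Rightarrow> 'a list \<Rightarrow> 'a \<Rightarrow> real" where
  "iter_deriv g [] x = g x"
| "iter_deriv g (v # vs) x = frechet_derivative (iter_deriv g vs) (at x) v"

definition times_differentiable :: "nat \<Rightarrow> ('a::real_normed_vector \<Rightarrow> real) \<Rightarrow> bool" where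
  "times_differentiable l g \<longleftrightarrow>
     (\<forall>vs x. length vs < l \<longrightarrow> iter_deriv g vs differentiable (at x))"

text \<open>Operator norm of a \<open>k\<close>-linear form, represented as a function on lists of length \<open>k\<close>.\<close>

definition form_norm :: "nat \<Rightarrow> ('a::real_normed_vector list \<Rightarrow> real) \<Rightarrow> ennreal" where
  "form_norm k A = (SUP vs\<in>{vs. length vs = k \<and> (\<forall>v\<in>set vs. norm v = 1)}. ennreal \<bar>A vs\<bar>)"

definition holder_order :: "real \<Rightarrow> nat" where
  "holder_order \<beta> = (GREATEST l. real l < \<beta>)"

definition smooth_class ::
    "real \<Rightarrow> (nat \<Rightarrow> real) \<Rightarrow> real \<Rightarrow> (real^'d \<Rightarrow> real^'d) set" where
  "smooth_class \<beta> L L\<beta> = {f. \<forall>j.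
     let g = (\<lambda>x. f x $ j); l = holder_order \<beta> in
       times_differentiable l g \<and>
       (\<forall>k\<le>l. (SUP x. form_norm k (\<lambda>vs. iter_deriv g vs x)) \<le> ennreal (L k)) \<and>
       (\<forall>x x'. form_norm l (\<lambda>vs. iter_deriv g vs x - iter_deriv g vs x')
                 \<le> ennreal (L\<beta> * norm (x - x') powr (\<beta> - real l)))}"

section \<open>Flow, tubes and snakes\<close>

text \<open>
  For Lipschitz \<open>f\<close> the solution exists and is unique on the whole real line, and its restriction
  to nonnegative times is the solution there.  Taking all real times makes \<open>THE\<close> well-defined.
\<close>

definition flow :: "('a::real_normed_vector \<Rightarrow> 'a) \<Rightarrow> 'a \<Rightarrow> real \<Rightarrow> 'a" where
  "flow f x = (THE u. u 0 = x \<and> (\<forall>t. (u has_vector_derivative f (u t)) (at t)))"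

definition tube :: "real \<Rightarrow> (real \<Rightarrow> 'a::real_inner) \<Rightarrow> real \<Rightarrow> 'a set" where
  "tube T u \<delta> = (\<Union>t\<in>{0..T}. {u t + v | v.
     vector_derivative u (at t within {0..T}) \<noteq> 0 \<and>
     v \<bullet> vector_derivative u (at t within {0..T}) = 0 \<and> norm v \<le> \<delta>})"

text \<open>
  A parameter \<open>(f, (x\<^sub>j), (T\<^sub>j))\<close> with \<open>j = 1, \<dots>, m\<close> is a triple \<open>(f, xs, Ts)\<close> with lists of equal
  length \<open>m\<close>.  Indices start at \<open>0\<close>.
\<close>

type_synonym 'd snake = "(real^'d \<Rightarrow> real^'d) \<times> (real^'d) list \<times> real list"

text \<open>The infimum is taken in the extended reals, so that it is infinite if no tube covers \<open>A\<close>.\<close>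

definition tube_dist :: "(real^'d) set \<Rightarrow> 'd snake \<Rightarrow> ennreal" where
  "tube_dist A = (\<lambda>(f, xs, Ts). Inf (ennreal ` {\<delta>. \<delta> > 0 \<and>
     A \<subseteq> (\<Union>j<length Ts. tube (Ts ! j) (flow f (xs ! j)) \<delta>)}))"

definition unit_cube :: "(real^'d) set" where
  "unit_cube = {x. \<forall>i. x $ i \<in> {0..1}}"

definition snake_class ::
    "real \<Rightarrow> (nat \<Rightarrow> real) \<Rightarrow> real \<Rightarrow> real \<Rightarrow> real \<Rightarrow> 'd::finite snake set" where
  "snake_class \<beta> L L\<beta> \<delta> Tsum = {(f, xs, Ts).
     f \<in> smooth_class \<beta> L L\<beta> \<and> Ts \<noteq> [] \<and> length xs = length Ts \<and> (\<forall>T\<in>set Ts. T > 0) \<and>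
     sum_list Ts = Tsum \<and> tube_dist unit_cube (f, xs, Ts) \<le> ennreal \<delta>}"

text \<open>
  The parameters for which an observation scheme with \<open>n\<close> observations exists: each of the \<open>m\<close>
  trajectories is observed at least once, so \<open>m \<le> n\<close>.
\<close>

definition snake_model ::
    "real \<Rightarrow> (nat \<Rightarrow> real) \<Rightarrow> real \<Rightarrow> real \<Rightarrow> real \<Rightarrow> nat \<Rightarrow> 'd::finite snake set" where
  "snake_model \<beta> L L\<beta> \<delta> Tsum n =
     {(f, xs, Ts). (f, xs, Ts) \<in> snake_class \<beta> L L\<beta> \<delta> Tsum \<and> length Ts \<le> n}"

section \<open>Observations\<close>

text \<open>
  A design assigns to each \<open>Ts = (T\<^sub>j)\<close> (hence also to each \<open>m\<close>) a list with \<open>m\<close> entries, whose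
  \<open>j\<close>-th entry is the list of the observation times \<open>t\<^sub>j\<^sub>,\<^sub>i\<close> of the \<open>j\<close>-th trajectory.
\<close>

type_synonym design = "real list \<Rightarrow> real list list"

definition valid_times :: "nat \<Rightarrow> real list \<Rightarrow> real list list \<Rightarrow> bool" where
  "valid_times n Ts tss \<longleftrightarrow>
     length tss = length Ts \<and> sum_list (map length tss) = n \<and>
     (\<forall>j<length Ts. tss ! j \<noteq> [] \<and> sorted (tss ! j) \<and> 0 \<le> hd (tss ! j) \<and> last (tss ! j) = Ts ! j)"

definition cover_time :: "real \<Rightarrow> nat \<Rightarrow> real \<Rightarrow> real list \<Rightarrow> real list list \<Rightarrow> bool" where
  "cover_time Ccvrtm n Tsum Ts tss \<longleftrightarrow>
     (\<forall>j<length Ts. \<forall>a\<in>{0..Ts ! j}. \<forall>b\<in>{0..Ts ! j}. a < b \<longrightarrow>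
        real (card {i. i < length (tss ! j) \<and> tss ! j ! i \<in> {a..b}})
          \<le> max 1 (Ccvrtm * (b - a) * (real n / Tsum)))"

definition obs_index :: "real list list \<Rightarrow> (nat \<times> nat) set" where
  "obs_index tss = (SIGMA j:{..<length tss}. {..<length (tss ! j)})"

abbreviation obs_space :: "real list list \<Rightarrow> (nat \<times> nat \<Rightarrow> real^'d) measure" where
  "obs_space tss \<equiv> (\<Pi>\<^sub>M k\<in>obs_index tss. borel)"

text \<open>Joint law of \<open>Y\<^sub>j\<^sub>,\<^sub>i = U(f, x\<^sub>j, t\<^sub>j\<^sub>,\<^sub>i) + \<epsilon>\<^sub>j\<^sub>,\<^sub>i\<close> with i.i.d. noise \<open>\<epsilon>\<^sub>j\<^sub>,\<^sub>i\<close> of law \<open>P\<close>.\<close>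

definition obs_law ::
    "(real^'d) measure \<Rightarrow> design \<Rightarrow> 'd::finite snake \<Rightarrow> (nat \<times> nat \<Rightarrow> real^'d) measure" where
  "obs_law P D = (\<lambda>(f, xs, Ts).
     distr (\<Pi>\<^sub>M k\<in>obs_index (D Ts). P) (obs_space (D Ts))
       (\<lambda>\<epsilon>. \<lambda>(j, i)\<in>obs_index (D Ts). flow f (xs ! j) (D Ts ! j ! i) + \<epsilon> (j, i)))"

text \<open>
  Kullback--Leibler divergence \<open>KL(P, Q)\<close> with natural logarithm; the library's real-valued
  \<open>KL_divergence\<close> takes the reference measure \<open>Q\<close> first and is meaningful only in the finite case.
  The negative part of the integrand is always \<open>P\<close>-integrable, so non-integrability means that
  the divergence is infinite.
\<close>

definition KL :: "'a measure \<Rightarrow> 'a measure \<Rightarrow> ereal" where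
  "KL P Q =
     (if absolutely_continuous Q P \<and> integrable P (entropy_density (exp 1) Q P)
      then ereal (KL_divergence (exp 1) Q P) else \<infinity>)"

definition shift :: "'a::real_normed_vector \<Rightarrow> 'a measure \<Rightarrow> 'a measure" where
  "shift v P = distr P borel (\<lambda>e. v + e)"

definition noise_law :: "real \<Rightarrow> (real^'d) measure \<Rightarrow> bool" where
  "noise_law Cnoise P \<longleftrightarrow>
     prob_space P \<and> sets P = sets borel \<and>
     integrable P (\<lambda>e. e) \<and> (LINT e|P. e) = 0 \<and>
     (\<forall>v1 v2. KL (shift v1 P) (shift v2 P) \<le> ereal (Cnoise * (norm (v1 - v2))\<^sup>2))"

section \<open>Estimators and minimax risk\<close>

text \<open>
  The \<open>x\<^sub>j\<close> and the \<open>t\<^sub>j\<^sub>,\<^sub>i\<close> (which are determined by the \<open>T\<^sub>j\<close>, where \<open>T\<^sub>j\<close> is the last \<open>t\<^sub>j\<^sub>,\<^sub>i\<close>)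
  are known, so an estimator may depend on them arbitrarily.  Measurability is joint in the
  observations and the evaluation point.
\<close>

type_synonym 'd estimator =
  "(real^'d) list \<Rightarrow> real list \<Rightarrow> (nat \<times> nat \<Rightarrow> real^'d) \<Rightarrow> real^'d \<Rightarrow> real^'d"

definition estimators :: "design \<Rightarrow> 'd::finite estimator set" where
  "estimators D = {fh. \<forall>xs Ts.
     (\<lambda>(y, x). fh xs Ts y x) \<in> obs_space (D Ts) \<Otimes>\<^sub>M borel \<rightarrow>\<^sub>M borel}"

text \<open>
  The loss compares the estimated and the true function.  A supremum over \<open>x\<close> of a jointly Borel
  function is universally measurable but possibly not Borel; for such integrands \<open>\<integral>\<^sup>+\<close>, a supremum
  over Borel simple functions below, is the integral with respect to the completed law.
\<close>

definition minimax_risk ::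
    "(real^'d) measure \<Rightarrow> design \<Rightarrow> 'd::finite snake set \<Rightarrow>
     ((real^'d \<Rightarrow> real^'d) \<Rightarrow> (real^'d \<Rightarrow> real^'d) \<Rightarrow> ennreal) \<Rightarrow> ennreal" where
  "minimax_risk P D \<Theta> loss =
     (INF fh\<in>estimators D. SUP (f, xs, Ts)\<in>\<Theta>. \<integral>\<^sup>+ y. loss (fh xs Ts y) f \<partial>obs_law P D (f, xs, Ts))"

end

theory Submission
  imports Defs
begin

text \<open>
  All hypotheses are fields \<open>c / (1 + \<partial>\<^sub>1 \<psi>)\<close> in one fixed direction, where \<open>\<psi>\<close> is a sum of bumps of
  width \<open>h\<close> and height of order \<open>h powr (\<beta> + 1)\<close>.  Trajectories are straight lines, traversed such that
  \<open>x\<^sub>1 + \<psi> x\<close> grows at constant speed \<open>c\<close>.  Hence tubes around a lattice of parallel lines of width of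
  order \<open>\<delta>\<close> cover the cube, whatever the bumps are, and a bump displaces a trajectory only while it
  crosses the bump, by at most the height of \<open>\<psi>\<close>.  About \<open>(h / \<delta>) ^ (d - 1)\<close> lines meet a given bump, each
  for a time of order \<open>h\<close>, so that one bump contributes at most \<open>max 1 (n * h powr (2 * \<beta> + 2 + d)) / C\<close>, up to
  a constant factor, to the Kullback--Leibler divergence in the given regime.  The first and the third bound use \<open>h\<close> with
  \<open>n * h powr (2 * \<beta> + 2 + d) = 1\<close>, with two hypotheses and with all sets of bumps, respectively; the
  supremum loss uses \<open>n * h powr (2 * \<beta> + 2 + d) = ln n\<close> and the hypotheses with a single bump.  If this
  \<open>h\<close> is below the width of the lattice, bumps of that width do better: they fit between the lines and
  are never seen.
\<close>

section \<open>Functions with bounded derivatives\<close>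

text \<open>The obstacle: a perturbed field normally betrays itself forever, since a trajectory
  slowed down by a bump stays late and every later observation shows it. Perturbing through a
  potential makes loss and gain of time cancel over each bump. Start points, durations and hence
  observation times are the same for all hypotheses of a family, so that knowing them does not help
  an estimator.

  A slope of order \<open>h powr \<beta>\<close> is what the smoothness class admits at width
  \<open>h\<close>; the potential is smaller by one factor \<open>h\<close>. A line is observed
  inside a bump at most \<open>max 1 X\<close> times, with \<open>X\<close> of order
  \<open>h * n / Tsum\<close>. If \<open>X\<close> exceeds \<open>1\<close>, the number of lines and
  \<open>C * inverse Tsum \<le> \<delta> ^ (d - 1)\<close> lead to
  \<open>n * h powr (2 * \<beta> + 2 + d) / C\<close>. Otherwise \<open>h\<close> is at most of
  order \<open>Tsum / n\<close>, and the other lower bound on \<open>\<delta> ^ (d - 1)\<close>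
  takes over. The upper and lower bounds together force \<open>C\<^sup>2 \<le> n\<close>, so that a
  large \<open>C\<close> also ensures that \<open>n\<close> is large.\<close>

fun bounded_derivs :: "nat \<Rightarrow> real \<Rightarrow> ('a::real_normed_vector \<Rightarrow> real) \<Rightarrow> bool" where
  "bounded_derivs 0 M g \<longleftrightarrow> (\<forall>x. \<bar>g x\<bar> \<le> M)"
| "bounded_derivs (Suc k) M g \<longleftrightarrow> (\<forall>x. \<bar>g x\<bar> \<le> M) \<and> (\<forall>x. g differentiable (at x)) \<and>
     (\<forall>v. bounded_derivs k (M * norm v) (\<lambda>x. frechet_derivative g (at x) v))"

lemma bounded_derivs_bound: "bounded_derivs k M g \<Longrightarrow> \<bar>g x\<bar> \<le> M"
  by (cases k) auto

lemma bounded_derivs_nonneg: "bounded_derivs k M g \<Longrightarrow> 0 \<le> M"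
  using bounded_derivs_bound[of k M g undefined] by linarith

lemma bounded_derivs_SucI:
  assumes "\<And>x. \<bar>g x\<bar> \<le> M" "\<And>x. (g has_derivative g' x) (at x)"
    and "\<And>v. bounded_derivs k (M * norm v) (\<lambda>x. g' x v)"
  shows "bounded_derivs (Suc k) M g"
proof -
  have "frechet_derivative g (at x) = g' x" for x
    using frechet_derivative_at[OF assms(2)] by simp
  then show ?thesis
    using assms by (auto simp: differentiable_def)
qed

lemma bounded_derivs_SucD:
  assumes "bounded_derivs (Suc k) M g"
  shows "(g has_derivative frechet_derivative g (at x)) (at x)"
    and "bounded_derivs k (M * norm v) (\<lambda>x. frechet_derivative g (at x) v)"
  using assms by (auto simp: frechet_derivative_works)

lemma bounded_derivs_mono_bound:
  "bounded_derivs k M g \<Longrightarrow> M \<le> M' \<Longrightarrow> bounded_derivs k M' g"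
proof (induction k arbitrary: M M' g)
  case 0
  have "\<bar>g x\<bar> \<le> M'" for x
    using bounded_derivs_bound[OF 0(1), of x] 0(2) by linarith
  then show ?case by simp
next
  case (Suc k)
  have "bounded_derivs k (M' * norm v) (\<lambda>x. frechet_derivative g (at x) v)" for v
    using bounded_derivs_SucD(2)[OF Suc.prems(1)] by (rule Suc.IH) (simp add: Suc.prems(2) mult_right_mono)
  moreover have "\<bar>g x\<bar> \<le> M'" for x
    using bounded_derivs_bound[OF Suc.prems(1), of x] Suc.prems(2) by linarith
  ultimately show ?case
    using Suc.prems(1) unfolding bounded_derivs.simps by blast
qed

lemma bounded_derivs_Suc_imp: "bounded_derivs (Suc k) M g \<Longrightarrow> bounded_derivs k M g"
proof (induction k arbitrary: M g)
  case (Suc k)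
  have "\<And>v. bounded_derivs k (M * norm v) (\<lambda>x. frechet_derivative g (at x) v)"
    using Suc.prems by (intro Suc.IH) (simp del: bounded_derivs.simps(2) add: bounded_derivs.simps(2)[of "Suc k"])
  then show ?case
    using Suc.prems by auto
qed auto

lemma bounded_derivs_const: "\<bar>a\<bar> \<le> M \<Longrightarrow> bounded_derivs k M (\<lambda>x. a)"
proof (induction k arbitrary: a M)
  case (Suc k)
  show ?case
    using Suc.prems
    by (intro bounded_derivs_SucI[where g' = "\<lambda>x v. 0"] Suc.IH) auto
qed auto

lemma bounded_derivs_add:
  "bounded_derivs k M1 f \<Longrightarrow> bounded_derivs k M2 g \<Longrightarrow> bounded_derivs k (M1 + M2) (\<lambda>x. f x + g x)"
proof (induction k arbitrary: M1 M2 f g)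
  case 0
  have "\<bar>f x + g x\<bar> \<le> M1 + M2" for x
    using 0[THEN bounded_derivs_bound, of x] by linarith
  then show ?case by simp
next
  case (Suc k)
  show ?case
  proof (rule bounded_derivs_SucI)
    show "((\<lambda>x. f x + g x) has_derivative
        (\<lambda>v. frechet_derivative f (at x) v + frechet_derivative g (at x) v)) (at x)" for x
      using Suc.prems[THEN bounded_derivs_SucD(1)] by (intro has_derivative_add)
    show "bounded_derivs k ((M1 + M2) * norm v)
        (\<lambda>x. frechet_derivative f (at x) v + frechet_derivative g (at x) v)" for v
      unfolding distrib_right using Suc.prems[THEN bounded_derivs_SucD(2)] by (intro Suc.IH)
    show "\<bar>f x + g x\<bar> \<le> M1 + M2" for x
      using Suc.prems[THEN bounded_derivs_bound, of x] by linarith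
  qed
qed

text \<open>By the Leibniz rule every order doubles the number of products, which gives
  \<open>2 ^ k\<close>. Since \<open>bounded_derivs\<close> uses one constant for all orders up to
  \<open>k\<close>, the factor that is not differentiated obeys the same bound.\<close>

lemma bounded_derivs_mult:
  "bounded_derivs k M1 f \<Longrightarrow> bounded_derivs k M2 g \<Longrightarrow>
    bounded_derivs k (2 ^ k * (M1 * M2)) (\<lambda>x. f x * g x)"
proof (induction k arbitrary: M1 M2 f g)
  case 0
  have "0 \<le> M1" using 0(1) by (rule bounded_derivs_nonneg)
  with 0 show ?case by (auto simp: abs_mult intro!: mult_mono)
next
  case (Suc k)
  note nn = Suc.prems[THEN bounded_derivs_nonneg]
  show ?case
  proof (rule bounded_derivs_SucI)
    show "((\<lambda>x. f x * g x) has_derivative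
        (\<lambda>v. f x * frechet_derivative g (at x) v + frechet_derivative f (at x) v * g x)) (at x)" for x
      using Suc.prems[THEN bounded_derivs_SucD(1)] by (intro has_derivative_mult)
    have eq: "2 ^ Suc k * (M1 * M2) * norm v =
        2 ^ k * (M1 * (M2 * norm v)) + 2 ^ k * ((M1 * norm v) * M2)" for v :: 'a
      by (simp add: algebra_simps)
    show "bounded_derivs k (2 ^ Suc k * (M1 * M2) * norm v)
        (\<lambda>x. f x * frechet_derivative g (at x) v + frechet_derivative f (at x) v * g x)" for v
      unfolding eq using Suc.prems[THEN bounded_derivs_SucD(2)] Suc.prems[THEN bounded_derivs_Suc_imp]
      by (intro Suc.IH bounded_derivs_add)
    show "\<bar>f x * g x\<bar> \<le> 2 ^ Suc k * (M1 * M2)" for x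
    proof -
      have "\<bar>f x * g x\<bar> \<le> M1 * M2"
        using Suc.prems[THEN bounded_derivs_bound, of x] nn by (auto simp: abs_mult intro!: mult_mono)
      also have "\<dots> \<le> 2 ^ Suc k * (M1 * M2)"
        using nn mult_right_mono[of 1 "2 ^ Suc k" "M1 * M2"] one_le_power[of "2::real" "Suc k"] by auto
      finally show ?thesis .
    qed
  qed
qed

lemma bounded_derivs_cmult:
  "bounded_derivs k M g \<Longrightarrow> bounded_derivs k (\<bar>a\<bar> * M) (\<lambda>x. a * g x)"
proof (induction k arbitrary: M g)
  case 0
  then have "\<bar>a * g x\<bar> \<le> \<bar>a\<bar> * M" for x
    by (simp add: abs_mult mult_left_mono)
  then show ?case by simp
next
  case (Suc k)
  show ?case
  proof (rule bounded_derivs_SucI)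
    show "((\<lambda>x. a * g x) has_derivative (\<lambda>v. a * frechet_derivative g (at x) v)) (at x)" for x
      using Suc.prems[THEN bounded_derivs_SucD(1)] by (intro has_derivative_mult_right)
    show "bounded_derivs k (\<bar>a\<bar> * M * norm v) (\<lambda>x. a * frechet_derivative g (at x) v)" for v
      unfolding mult.assoc using Suc.prems[THEN bounded_derivs_SucD(2)] by (intro Suc.IH)
    show "\<bar>a * g x\<bar> \<le> \<bar>a\<bar> * M" for x
      using Suc.prems[THEN bounded_derivs_bound, of x] by (auto simp: abs_mult intro!: mult_left_mono)
  qed
qed

lemma bounded_derivs_prod:
  assumes "finite I" "\<And>i. i \<in> I \<Longrightarrow> \<exists>M. bounded_derivs k M (g i)"
  shows "\<exists>M. bounded_derivs k M (\<lambda>x. \<Prod>i\<in>I. g i x)"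
  using assms
proof (induction I rule: finite_induct)
  case empty
  show ?case using bounded_derivs_const[of 1 1] by auto
next
  case (insert i I)
  then show ?case using bounded_derivs_mult by fastforce
qed

text \<open>\<open>R\<close> depends on \<open>k\<close> and \<open>M\<close> only, because it is
  applied to the slopes of all bump sets and all widths. The derivative of
  \<open>1 / (1 + g)\<close> is \<open>- g' / (1 + g) ^ 2\<close>, so order \<open>k + 1\<close>
  follows from order \<open>k\<close> by the product rule.\<close>

lemma bounded_derivs_reciprocal:
  assumes "0 \<le> M"
  shows "\<exists>R. \<forall>g :: 'a::real_normed_vector \<Rightarrow> real. bounded_derivs k M g \<longrightarrow> (\<forall>x. \<bar>g x\<bar> \<le> 1/2) \<longrightarrow>
      bounded_derivs k R (\<lambda>x. 1 / (1 + g x))"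
proof (induction k)
  case 0
  have "\<bar>1 / (1 + y)\<bar> \<le> 2" if "\<bar>y\<bar> \<le> 1/2" for y :: real
    using that by (auto simp: abs_le_iff divide_simps)
  then show ?case unfolding bounded_derivs.simps by blast
next
  case (Suc k)
  then obtain R where R: "\<And>g :: 'a \<Rightarrow> real. bounded_derivs k M g \<Longrightarrow> (\<forall>x. \<bar>g x\<bar> \<le> 1/2) \<Longrightarrow>
      bounded_derivs k R (\<lambda>x. 1 / (1 + g x))" by blast
  define R' where "R' = max 2 (2 ^ k * (M * (2 ^ k * (R * R))))"
  have "bounded_derivs (Suc k) R' (\<lambda>x. 1 / (1 + g x))"
    if g: "bounded_derivs (Suc k) M g" "\<forall>x. \<bar>g x\<bar> \<le> 1/2" for g :: "'a \<Rightarrow> real"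
  proof (rule bounded_derivs_SucI)
    have pos: "1 + g x \<ge> 1/2" for x
      using g(2)[rule_format, of x] by linarith
    show "\<bar>1 / (1 + g x)\<bar> \<le> R'" for x
      using pos[of x] by (auto simp: R'_def le_max_iff_disj divide_simps)
    have gd: "(g has_derivative frechet_derivative g (at x)) (at x)" for x
      using g(1) by (rule bounded_derivs_SucD)
    show "((\<lambda>x. 1 / (1 + g x)) has_derivative
        (\<lambda>v. (-1) * (frechet_derivative g (at x) v * (1 / (1 + g x) * (1 / (1 + g x)))))) (at x)" for x
    proof -
      have "((\<lambda>x. 1 + g x) has_derivative frechet_derivative g (at x)) (at x)"
        using has_derivative_add[OF has_derivative_const gd, of 1 x] by simp
      moreover have "1 + g x \<noteq> 0" using pos[of x] by linarith
      ultimately have "((\<lambda>x. inverse (1 + g x)) has_derivative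
          (\<lambda>v. - (inverse (1 + g x) * frechet_derivative g (at x) v * inverse (1 + g x)))) (at x)"
        by (intro Deriv.has_derivative_inverse)
      then show ?thesis by (simp add: inverse_eq_divide mult_ac)
    qed
    fix v
    have "bounded_derivs k R (\<lambda>x. 1 / (1 + g x))"
      using g(2) by (rule R[OF bounded_derivs_Suc_imp[OF g(1)]])
    from this this have "bounded_derivs k (\<bar>-1\<bar> * (2 ^ k * (M * norm v * (2 ^ k * (R * R)))))
       (\<lambda>x. (-1) * (frechet_derivative g (at x) v * (1 / (1 + g x) * (1 / (1 + g x)))))"
      by (rule bounded_derivs_cmult[OF bounded_derivs_mult[OF bounded_derivs_SucD(2)[OF g(1)] bounded_derivs_mult]])
    then show "bounded_derivs k (R' * norm v)
       (\<lambda>x. (-1) * (frechet_derivative g (at x) v * (1 / (1 + g x) * (1 / (1 + g x)))))"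
    proof (rule bounded_derivs_mono_bound)
      have "\<bar>-1\<bar> * (2 ^ k * (M * norm v * (2 ^ k * (R * R)))) =
         2 ^ k * (M * (2 ^ k * (R * R))) * norm v" by (simp add: mult_ac)
      also have "\<dots> \<le> R' * norm v" by (intro mult_right_mono) (auto simp: R'_def)
      finally show "\<bar>-1\<bar> * (2 ^ k * (M * norm v * (2 ^ k * (R * R)))) \<le> R' * norm v" .
    qed
  qed
  then show ?case by blast
qed

lemma abs_mult_le_of_abs_le_1:
  fixes a b :: real
  assumes "\<bar>a\<bar> \<le> 1" "\<bar>b\<bar> \<le> M"
  shows "\<bar>a * b\<bar> \<le> M"
  using mult_mono[OF assms] assms by (simp add: abs_mult)

text \<open>The factor \<open>w\<close> may jump, but only inside the open set \<open>W\<close>,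
  where \<open>g\<close> is identically \<open>0\<close>; elsewhere it is locally constant and acts
  like a number. So no derivative of \<open>w\<close> enters.\<close>

lemma has_derivative_cutoff:
  fixes g :: "'a::real_normed_vector \<Rightarrow> real"
  assumes "open W" "\<And>x. x \<in> W \<Longrightarrow> g x = 0" "\<And>x. x \<notin> W \<Longrightarrow> \<forall>\<^sub>F y in nhds x. w y = w x"
    and g: "(g has_derivative g') (at x)"
  shows "((\<lambda>x. w x * g x) has_derivative (\<lambda>v. w x * g' v)) (at x)"
    and "x \<in> W \<Longrightarrow> g' = (\<lambda>v. 0)"
proof -
  show zero: "g' = (\<lambda>v. 0)" if "x \<in> W"
    using has_derivative_transform_within_open[OF has_derivative_const assms(1) that, of 0 g] assms(2)
      has_derivative_unique[OF g] by auto
  show "((\<lambda>x. w x * g x) has_derivative (\<lambda>v. w x * g' v)) (at x)"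
  proof (cases "x \<in> W")
    case True
    have "((\<lambda>x. w x * g x) has_derivative (\<lambda>v. 0)) (at x)"
      by (rule has_derivative_transform_within_open[OF has_derivative_const assms(1) True, of 0])
        (simp add: assms(2))
    then show ?thesis by (simp add: zero[OF True])
  next
    case False
    obtain S where S: "open S" "x \<in> S" "\<And>y. y \<in> S \<Longrightarrow> w y = w x"
      using assms(3)[OF False] unfolding eventually_nhds by blast
    show ?thesis
      by (rule has_derivative_transform_within_open[OF has_derivative_mult_right[OF g, of "w x"] S(1,2)])
        (simp add: S(3))
  qed
qed

text \<open>On the open set \<open>W\<close> the derivative of \<open>g\<close> vanishes together
  with \<open>g\<close>, so the induction can keep \<open>w\<close>, \<open>W\<close> and the
  constant.\<close>

lemma bounded_derivs_cutoff:
  fixes g :: "'a::real_normed_vector \<Rightarrow> real"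
  assumes "bounded_derivs k M g" "open W" "\<And>x. x \<in> W \<Longrightarrow> g x = 0"
    and "\<And>x. \<bar>w x\<bar> \<le> 1" "\<And>x. x \<notin> W \<Longrightarrow> \<forall>\<^sub>F y in nhds x. w y = w x"
  shows "bounded_derivs k M (\<lambda>x. w x * g x)"
  using assms(1,3)
proof (induction k arbitrary: M g)
  case 0
  then show ?case
    unfolding bounded_derivs.simps by (intro allI abs_mult_le_of_abs_le_1 assms(4)) blast
next
  case (Suc k)
  note cut = has_derivative_cutoff[OF assms(2) Suc.prems(2) assms(5) bounded_derivs_SucD(1)[OF Suc.prems(1)]]
  show ?case
  proof (rule bounded_derivs_SucI)
    show "\<bar>w x * g x\<bar> \<le> M" for x
      by (rule abs_mult_le_of_abs_le_1[OF assms(4) bounded_derivs_bound[OF Suc.prems(1)]])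
    show "((\<lambda>x. w x * g x) has_derivative (\<lambda>v. w x * frechet_derivative g (at x) v)) (at x)" for x
      by (rule cut(1))
    show "bounded_derivs k (M * norm v) (\<lambda>x. w x * frechet_derivative g (at x) v)" for v
      by (rule Suc.IH[OF bounded_derivs_SucD(2)[OF Suc.prems(1)]]) (simp add: cut(2))
  qed
qed

text \<open>Each direction consumes one order and contributes its norm to the constant. For unit
  vectors the constant remains \<open>M\<close>, which is how bounds on operator norms are read
  off.\<close>

lemma bounded_derivs_iter_deriv:
  "bounded_derivs k M g \<Longrightarrow> length vs \<le> k \<Longrightarrow>
    bounded_derivs (k - length vs) (M * (\<Prod>v\<leftarrow>vs. norm v)) (iter_deriv g vs)"
proof (induction vs)
  case Nil
  have "iter_deriv g [] = g" by auto
  with Nil show ?case by simp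
next
  case (Cons v vs)
  then have "bounded_derivs (Suc (k - length (v # vs))) (M * (\<Prod>v\<leftarrow>vs. norm v)) (iter_deriv g vs)"
    by (auto simp: Suc_diff_Suc simp del: bounded_derivs.simps)
  from bounded_derivs_SucD(2)[OF this, of v] show ?case
    by (simp add: mult_ac cong: if_cong)
qed

lemma bounded_derivs_lipschitz:
  fixes g :: "'a::real_normed_vector \<Rightarrow> real"
  assumes "bounded_derivs (Suc k) M g"
  shows "\<bar>g x - g y\<bar> \<le> M * norm (x - y)"
proof -
  have "norm (g x - g y) \<le> M * norm (x - y)"
  proof (rule differentiable_bound[of UNIV g "\<lambda>x. frechet_derivative g (at x)"])
    show "(g has_derivative frechet_derivative g (at x)) (at x within UNIV)" for x
      using bounded_derivs_SucD(1)[OF assms] by simp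
    show "onorm (frechet_derivative g (at x)) \<le> M" for x
      using bounded_derivs_bound[OF bounded_derivs_SucD(2)[OF assms]]
      by (intro onorm_bound bounded_derivs_nonneg[OF assms]) auto
  qed auto
  then show ?thesis by simp
qed


section \<open>Rescaled functions and the smoothness class\<close>

lemma iter_deriv_affine:
  assumes "bounded_derivs k M b" "length vs \<le> k"
  shows "iter_deriv (\<lambda>x. C + c * b ((1 / h) *\<^sub>R (x - p))) vs =
    (\<lambda>x. (if vs = [] then C else 0) + c * (1 / h) ^ length vs * iter_deriv b vs ((1 / h) *\<^sub>R (x - p)))"
  using assms(2)
proof (induction vs)
  case Nil
  show ?case by auto
next
  case (Cons v vs)
  \<comment> \<open>The additive constant survives only as long as nothing has been
    differentiated.\<close>
  let ?C = "if vs = [] then C else 0"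
  let ?c = "c * (1 / h) ^ length vs"
  have "bounded_derivs (Suc (k - length (v # vs))) (M * (\<Prod>v\<leftarrow>vs. norm v)) (iter_deriv b vs)"
    using bounded_derivs_iter_deriv[OF assms(1), of vs] Cons.prems
    by (auto simp: Suc_diff_Suc simp del: bounded_derivs.simps)
  note D = bounded_derivs_SucD(1)[OF this]
  have "frechet_derivative (iter_deriv (\<lambda>x. C + c * b ((1 / h) *\<^sub>R (x - p))) vs) (at x) v =
      ?c * (1 / h) * frechet_derivative (iter_deriv b vs) (at ((1 / h) *\<^sub>R (x - p))) v" for x
  proof -
    let ?D = "frechet_derivative (iter_deriv b vs) (at ((1 / h) *\<^sub>R (x - p)))"
    have "((\<lambda>x. (1 / h) *\<^sub>R (x - p)) has_derivative (\<lambda>v. (1 / h) *\<^sub>R v)) (at x)"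
      by (auto intro!: derivative_eq_intros)
    from has_derivative_compose[OF this D]
    have "((\<lambda>x. ?C + ?c * iter_deriv b vs ((1 / h) *\<^sub>R (x - p))) has_derivative
        (\<lambda>v. 0 + ?c * ?D ((1 / h) *\<^sub>R v))) (at x)"
      by (intro has_derivative_add has_derivative_const has_derivative_mult_right)
    from frechet_derivative_at[OF this, symmetric] show ?thesis
      using Cons linear_scale[OF has_derivative_linear[OF D], of "(1 / h) *\<^sub>R (x - p)" "1 / h" v] by simp
  qed
  then show ?case by (intro ext) (simp add: mult_ac)
qed

lemma holder_order_less: "\<beta> > 0 \<Longrightarrow> real (holder_order \<beta>) < \<beta>"
  and holder_order_ge: "\<beta> > 0 \<Longrightarrow> \<beta> \<le> real (holder_order \<beta>) + 1"
proof -
  assume "\<beta> > 0"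
  have bdd: "l \<le> nat \<lceil>\<beta>\<rceil>" if "real l < \<beta>" for l using that by linarith
  show "real (holder_order \<beta>) < \<beta>"
    unfolding holder_order_def
    by (rule GreatestI_nat[of "\<lambda>l. real l < \<beta>" 0 "nat \<lceil>\<beta>\<rceil>"]) (simp add: \<open>\<beta> > 0\<close>, rule bdd)
  have "\<not> real (Suc (holder_order \<beta>)) < \<beta>"
  proof
    assume "real (Suc (holder_order \<beta>)) < \<beta>"
    then have "Suc (holder_order \<beta>) \<le> holder_order \<beta>"
      unfolding holder_order_def by (rule Greatest_le_nat[of "\<lambda>l. real l < \<beta>"]) (rule bdd)
    then show False by simp
  qed
  then show "\<beta> \<le> real (holder_order \<beta>) + 1" by simp
qed

text \<open>Undoing the rescaling costs a factor \<open>1 / h\<close> per derivative, so an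
  amplitude \<open>h powr \<beta>\<close> leaves \<open>h powr (\<beta> - k) \<le> 1\<close> at
  order \<open>k \<le> l < \<beta>\<close>, and the Hoelder quotient of exponent
  \<open>\<beta> - l\<close> at order \<open>l\<close> uses up the power exactly. One bounded
  derivative more than \<open>l\<close> gives the Hoelder bound at small distances. The components
  have the form \<open>\<kappa> + \<kappa> * b\<close> because they are either \<open>0\<close> or a
  perturbed constant.\<close>

lemma smooth_classI:
  fixes f :: "real^'d \<Rightarrow> real^'d" and \<beta> :: real
  defines "l \<equiv> holder_order \<beta>"
  assumes \<beta>: "\<beta> > 0" and h: "0 < h" "h \<le> 1" and A: "A \<ge> 0"
    and b: "bounded_derivs (Suc l) (A * h powr \<beta> * M) b" "\<And>z. \<bar>b z\<bar> \<le> 1"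
    and f: "\<And>j. \<exists>\<kappa>. \<bar>\<kappa>\<bar> \<le> c \<and> (\<forall>x. f x $ j = \<kappa> + \<kappa> * b ((1 / h) *\<^sub>R (x - p)))"
    and L: "2 * c \<le> L 0" "\<And>k. k \<le> l \<Longrightarrow> c * A * M \<le> L k" "2 * (c * A * M) \<le> L\<beta>"
  shows "f \<in> smooth_class \<beta> L L\<beta>"
  unfolding smooth_class_def Let_def mem_Collect_eq l_def[symmetric]
proof (rule allI)
  fix j
  obtain \<kappa> where \<kappa>: "\<bar>\<kappa>\<bar> \<le> c" and fj: "(\<lambda>x. f x $ j) = (\<lambda>x. \<kappa> + \<kappa> * b ((1 / h) *\<^sub>R (x - p)))"
    using f[of j] by blast
  have "c \<ge> 0" using \<kappa> by linarith
  have l: "real l < \<beta>" "\<beta> \<le> real l + 1"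
    using holder_order_less[OF \<beta>] holder_order_ge[OF \<beta>] by (auto simp: l_def)
  have b_le: "\<bar>iter_deriv b vs z\<bar> \<le> A * h powr \<beta> * M" and
    b_lip: "length vs \<le> l \<Longrightarrow> \<bar>iter_deriv b vs z - iter_deriv b vs z'\<bar> \<le> A * h powr \<beta> * M * norm (z - z')"
    if "length vs \<le> Suc l" "\<forall>v\<in>set vs. norm v = 1" for vs z z'
  proof -
    have "(\<Prod>v\<leftarrow>vs. norm v) = 1"
      using that(2) by (induction vs) auto
    with bounded_derivs_iter_deriv[OF b(1) that(1)]
    have 1: "bounded_derivs (Suc l - length vs) (A * h powr \<beta> * M) (iter_deriv b vs)" by simp
    from bounded_derivs_bound[OF this] show "\<bar>iter_deriv b vs z\<bar> \<le> A * h powr \<beta> * M" .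
    assume "length vs \<le> l"
    then have "Suc l - length vs = Suc (l - length vs)" by simp
    with 1 show "\<bar>iter_deriv b vs z - iter_deriv b vs z'\<bar> \<le> A * h powr \<beta> * M * norm (z - z')"
      by (metis bounded_derivs_lipschitz)
  qed
  have AM: "0 \<le> A * h powr \<beta> * M" using b_le[of "[]" 0] by auto
  have iter: "iter_deriv (\<lambda>x. f x $ j) vs x = (if vs = [] then \<kappa> else 0) +
      \<kappa> * (1 / h) ^ length vs * iter_deriv b vs ((1 / h) *\<^sub>R (x - p))" if "length vs \<le> Suc l" for vs x
    unfolding fj using iter_deriv_affine[OF b(1) that] by simp
  show "times_differentiable l (\<lambda>x. f x $ j) \<and>
       (\<forall>k\<le>l. (SUP x. form_norm k (\<lambda>vs. iter_deriv (\<lambda>x. f x $ j) vs x)) \<le> ennreal (L k)) \<and>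
       (\<forall>x x'. form_norm l (\<lambda>vs. iter_deriv (\<lambda>x. f x $ j) vs x - iter_deriv (\<lambda>x. f x $ j) vs x')
                 \<le> ennreal (L\<beta> * norm (x - x') powr (\<beta> - real l)))"
  proof (intro conjI allI impI)
    show "times_differentiable l (\<lambda>x. f x $ j)"
      unfolding times_differentiable_def
    proof (intro allI impI)
      fix vs :: "(real^'d) list" and x assume vs: "length vs < l"
      have "bounded_derivs (Suc (l - length vs)) (A * h powr \<beta> * M * (\<Prod>v\<leftarrow>vs. norm v)) (iter_deriv b vs)"
        using bounded_derivs_iter_deriv[OF b(1), of vs] vs by (simp add: Suc_diff_le del: bounded_derivs.simps)
      note D = bounded_derivs_SucD(1)[OF this]
      have "((\<lambda>x. (1 / h) *\<^sub>R (x - p)) has_derivative (\<lambda>v. (1 / h) *\<^sub>R v)) (at x)"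
        by (auto intro!: derivative_eq_intros)
      from has_derivative_compose[OF this D]
      have "(\<lambda>x. iter_deriv b vs ((1 / h) *\<^sub>R (x - p))) differentiable (at x)"
        unfolding differentiable_def by blast
      moreover have "iter_deriv (\<lambda>x. f x $ j) vs = (\<lambda>x. (if vs = [] then \<kappa> else 0) +
          \<kappa> * (1 / h) ^ length vs * iter_deriv b vs ((1 / h) *\<^sub>R (x - p)))"
        using iter[of vs] vs by auto
      ultimately show "iter_deriv (\<lambda>x. f x $ j) vs differentiable (at x)"
        by (auto intro!: differentiable_add differentiable_mult)
    qed
    fix k assume k: "k \<le> l"
    show "(SUP x. form_norm k (\<lambda>vs. iter_deriv (\<lambda>x. f x $ j) vs x)) \<le> ennreal (L k)"
      unfolding form_norm_def
    proof (intro SUP_least ennreal_leI)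
      fix x :: "real^'d" and vs :: "(real^'d) list"
      assume "vs \<in> {vs. length vs = k \<and> (\<forall>v\<in>set vs. norm v = 1)}"
      then have vs: "length vs = k" "\<forall>v\<in>set vs. norm v = 1" by auto
      show "\<bar>iter_deriv (\<lambda>x. f x $ j) vs x\<bar> \<le> L k"
      proof (cases "vs = []")
        case True
        have "\<bar>\<kappa> + \<kappa> * b ((1 / h) *\<^sub>R (x - p))\<bar> \<le> \<bar>\<kappa>\<bar> + \<bar>\<kappa>\<bar> * \<bar>b ((1 / h) *\<^sub>R (x - p))\<bar>"
          by (metis abs_mult abs_triangle_ineq)
        also have "\<dots> \<le> c + c * 1"
          using \<kappa> b(2) \<open>c \<ge> 0\<close> by (intro add_mono mult_mono) auto
        finally show ?thesis using L(1) True vs(1) by (simp add: fj)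
      next
        case False
        have "\<bar>iter_deriv (\<lambda>x. f x $ j) vs x\<bar> = \<bar>\<kappa>\<bar> * ((1 / h) ^ k * \<bar>iter_deriv b vs ((1 / h) *\<^sub>R (x - p))\<bar>)"
          using iter[of vs x] vs k False h by (simp add: abs_mult)
        also have "\<dots> \<le> c * ((1 / h) ^ k * (A * h powr \<beta> * M))"
          using \<kappa> \<open>c \<ge> 0\<close> h vs k by (intro mult_mono mult_left_mono b_le) auto
        also have "\<dots> = c * A * M * h powr (\<beta> - real k)"
          using h by (simp add: powr_diff powr_realpow power_divide)
        also have "\<dots> \<le> c * A * M * 1"
        proof (rule mult_left_mono)
          show "h powr (\<beta> - real k) \<le> 1" using h k l by (intro powr_le1) auto
          have "0 \<le> A * M * h powr \<beta>" using AM by (simp add: mult_ac)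
          then have "0 \<le> A * M" using h by (simp add: zero_le_mult_iff)
          then show "0 \<le> c * A * M" using \<open>c \<ge> 0\<close> by (simp add: mult.assoc)
        qed
        finally show ?thesis using L(2)[OF k] by simp
      qed
    qed
  next
    fix x x' :: "real^'d"
    show "form_norm l (\<lambda>vs. iter_deriv (\<lambda>x. f x $ j) vs x - iter_deriv (\<lambda>x. f x $ j) vs x')
                 \<le> ennreal (L\<beta> * norm (x - x') powr (\<beta> - real l))"
      unfolding form_norm_def
    proof (intro SUP_least ennreal_leI)
      fix vs :: "(real^'d) list"
      assume "vs \<in> {vs. length vs = l \<and> (\<forall>v\<in>set vs. norm v = 1)}"
      then have vs: "length vs = l" "\<forall>v\<in>set vs. norm v = 1" by auto
      define z z' where "z = (1 / h) *\<^sub>R (x - p)" and "z' = (1 / h) *\<^sub>R (x' - p)"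
      define r where "r = norm (x - x') / h"
      have r: "norm (z - z') = r" "0 \<le> r"
        using h by (auto simp: z_def z'_def r_def scaleR_diff_right[symmetric])
      \<comment> \<open>In the rescaled distance \<open>r\<close>, the Lipschitz bound is used up to
        \<open>r = 1\<close>, where \<open>r \<le> r powr (\<beta> - real l)\<close> as the exponent
        is at most \<open>1\<close>; beyond that, twice the supremum is enough.\<close>
      have D: "\<bar>iter_deriv b vs z - iter_deriv b vs z'\<bar> \<le> A * h powr \<beta> * M * (2 * r powr (\<beta> - real l))"
      proof (cases "r = 0")
        case True
        then have "z = z'" using r by simp
        then show ?thesis using AM by simp
      next
        case False
        then have "r > 0" using r by simp
        show ?thesis
        proof (cases "r \<le> 1")
          case True
          have "r = r powr 1" using \<open>r > 0\<close> by simp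
          also have "\<dots> \<le> r powr (\<beta> - real l)"
            using True \<open>r > 0\<close> l by (intro powr_mono') auto
          also have "\<dots> \<le> 2 * r powr (\<beta> - real l)" by simp
          finally have "A * h powr \<beta> * M * r \<le> A * h powr \<beta> * M * (2 * r powr (\<beta> - real l))"
            using AM by (rule mult_left_mono)
          then show ?thesis
            using b_lip[of vs z z'] vs r by simp
        next
          case False
          then have "1 \<le> r powr (\<beta> - real l)"
            using l by (intro ge_one_powr_ge_zero) auto
          then have "A * h powr \<beta> * M * 2 \<le> A * h powr \<beta> * M * (2 * r powr (\<beta> - real l))"
            using AM by (intro mult_left_mono) auto
          moreover have "\<bar>iter_deriv b vs z\<bar> \<le> A * h powr \<beta> * M" "\<bar>iter_deriv b vs z'\<bar> \<le> A * h powr \<beta> * M"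
            using vs by (auto intro: b_le)
          ultimately show ?thesis by linarith
        qed
      qed
      have "\<bar>iter_deriv (\<lambda>x. f x $ j) vs x - iter_deriv (\<lambda>x. f x $ j) vs x'\<bar> =
          \<bar>\<kappa>\<bar> * ((1 / h) ^ l * \<bar>iter_deriv b vs z - iter_deriv b vs z'\<bar>)"
        using iter[of vs x] iter[of vs x'] vs h
        by (simp add: abs_mult z_def z'_def flip: right_diff_distrib)
      also have "\<dots> \<le> c * ((1 / h) ^ l * (A * h powr \<beta> * M * (2 * r powr (\<beta> - real l))))"
        using \<kappa> \<open>c \<ge> 0\<close> h D by (intro mult_mono mult_left_mono) auto
      also have "\<dots> = 2 * (c * A * M) * (h powr (\<beta> - real l) * r powr (\<beta> - real l))"
        using h by (simp add: powr_diff powr_realpow power_divide)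
      also have "h powr (\<beta> - real l) * r powr (\<beta> - real l) = norm (x - x') powr (\<beta> - real l)"
        using h by (simp add: r_def flip: powr_mult)
      also have "2 * (c * A * M) * norm (x - x') powr (\<beta> - real l) \<le> L\<beta> * norm (x - x') powr (\<beta> - real l)"
        using L(3) by (intro mult_right_mono) auto
      finally show "\<bar>iter_deriv (\<lambda>x. f x $ j) vs x - iter_deriv (\<lambda>x. f x $ j) vs x'\<bar>
          \<le> L\<beta> * norm (x - x') powr (\<beta> - real l)" .
    qed
  qed
qed

section \<open>Likelihood ratios of product measures\<close>

text \<open>A one-sided way to say that the likelihood ratio of \<open>P\<close> to \<open>Q\<close>
  is at most \<open>t\<close> on an event of \<open>P\<close>-probability at least \<open>q\<close>.
  Integrals of arbitrary measurable functions take the place of the density, so that losses can be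
  inserted directly.\<close>

definition hard_to_distinguish :: "real \<Rightarrow> real \<Rightarrow> 'a measure \<Rightarrow> 'a measure \<Rightarrow> bool" where
  "hard_to_distinguish q t P Q \<longleftrightarrow> prob_space P \<and> prob_space Q \<and> sets Q = sets P \<and>
     (\<exists>G\<in>sets P. ennreal q \<le> emeasure P G \<and>
       (\<forall>g\<in>borel_measurable P. (\<integral>\<^sup>+y. g y * indicator G y \<partial>P) \<le> ennreal t * (\<integral>\<^sup>+y. g y \<partial>Q)))"

text \<open>The value \<open>\<infinity>\<close> of \<open>KL\<close> covers both ways to fail, so
  any finite bound yields absolute continuity and integrability. The logarithm to base
  \<open>exp 1\<close> is \<open>ln\<close>.\<close>

lemma KL_finite:
  assumes "KL P Q \<le> ereal \<kappa>"
  shows "absolutely_continuous Q P" "integrable P (\<lambda>y. ln (enn2real (RN_deriv Q P y)))"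
    and "(\<integral>y. ln (enn2real (RN_deriv Q P y)) \<partial>P) \<le> \<kappa>"
proof -
  have eq: "entropy_density (exp 1) Q P = (\<lambda>y. ln (enn2real (RN_deriv Q P y)))"
    by (auto simp: entropy_density_def log_def)
  show "absolutely_continuous Q P" "integrable P (\<lambda>y. ln (enn2real (RN_deriv Q P y)))"
    "(\<integral>y. ln (enn2real (RN_deriv Q P y)) \<partial>P) \<le> \<kappa>"
    using assms by (auto simp: KL_def KL_divergence_def eq split: if_splits)
qed

text \<open>A product measure is determined by its values on rectangles, and there the integral of
  the product of densities factorizes.\<close>

lemma prod_density:
  fixes P Q :: "'i \<Rightarrow> 'a measure"
  assumes "finite I" "\<And>i. prob_space (P i)" "\<And>i. prob_space (Q i)"
    and "\<And>i. i \<in> I \<Longrightarrow> p i \<in> borel_measurable (Q i)" "\<And>i. i \<in> I \<Longrightarrow> density (Q i) (p i) = P i"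
  shows "PiM I P = density (PiM I Q) (\<lambda>y. \<Prod>i\<in>I. p i (y i))"
proof -
  interpret P: product_prob_space P by (rule product_prob_spaceI) (rule assms)
  interpret Q: product_prob_space Q by (rule product_prob_spaceI) (rule assms)
  have sets_eq: "sets (P i) = sets (Q i)" if "i \<in> I" for i
    using assms(5)[OF that] by (metis sets_density)
  note [measurable] = assms(4)
  have [measurable]: "(\<lambda>y. \<Prod>i\<in>I. p i (y i)) \<in> borel_measurable (PiM I Q)"
    by (intro borel_measurable_prod_ennreal) measurable
  have "density (PiM I Q) (\<lambda>y. \<Prod>i\<in>I. p i (y i)) = PiM I P"
  proof (rule P.PiM_eqI)
    show "sets (density (PiM I Q) (\<lambda>y. \<Prod>i\<in>I. p i (y i))) = sets (PiM I P)"
      by (simp cong: sets_PiM_cong add: sets_eq)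
    fix A assume "\<And>i. i \<in> I \<Longrightarrow> A i \<in> sets (P i)"
    then have A[measurable]: "\<And>i. i \<in> I \<Longrightarrow> A i \<in> sets (Q i)" by (simp add: sets_eq)
    have "emeasure (density (PiM I Q) (\<lambda>y. \<Prod>i\<in>I. p i (y i))) (Pi\<^sub>E I A) =
        (\<integral>\<^sup>+y. (\<Prod>i\<in>I. p i (y i)) * indicator (Pi\<^sub>E I A) y \<partial>PiM I Q)"
      using assms(1) A by (intro emeasure_density sets_PiM_I_finite) auto
    also have "\<dots> = (\<integral>\<^sup>+y. (\<Prod>i\<in>I. p i (y i) * indicator (A i) (y i)) \<partial>PiM I Q)"
    proof (rule nn_integral_cong)
      fix y assume "y \<in> space (PiM I Q)"
      then have "indicator (Pi\<^sub>E I A) y = (\<Prod>i\<in>I. indicator (A i) (y i) :: ennreal)"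
        using assms(1) by (auto simp: indicator_def space_PiM PiE_def prod_zero_iff intro!: prod.neutral)
      then show "(\<Prod>i\<in>I. p i (y i)) * indicator (Pi\<^sub>E I A) y =
          (\<Prod>i\<in>I. p i (y i) * indicator (A i) (y i))"
        by (simp add: prod.distrib)
    qed
    also have "\<dots> = (\<Prod>i\<in>I. \<integral>\<^sup>+y. p i y * indicator (A i) y \<partial>Q i)"
      by (rule Q.product_nn_integral_prod) (auto simp: assms(1))
    also have "\<dots> = (\<Prod>i\<in>I. emeasure (P i) (A i))"
    proof (rule prod.cong[OF refl])
      fix i assume i: "i \<in> I"
      show "(\<integral>\<^sup>+y. p i y * indicator (A i) y \<partial>Q i) = emeasure (P i) (A i)"
        using emeasure_density[OF assms(4)[OF i] A[OF i]] assms(5)[OF i] by simp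
    qed
    finally show "emeasure (density (PiM I Q) (\<lambda>y. \<Prod>i\<in>I. p i (y i))) (Pi\<^sub>E I A) =
      (\<Prod>i\<in>I. emeasure (P i) (A i))" .
  qed (use assms(1) in auto)
  then show ?thesis ..
qed

text \<open>Markov's inequality for the log-likelihood ratio \<open>S\<close>, applied to \<open>S + exp (- S)\<close> because
  \<open>S\<close> may be negative.\<close>

lemma product_hard_to_distinguish:
  fixes P Q :: "'i \<Rightarrow> 'a measure"
  assumes I: "finite I" and P: "\<And>i. prob_space (P i)" and Q: "\<And>i. prob_space (Q i)"
    and sets: "\<And>i. sets (P i) = sets (Q i)"
    and KL: "\<And>i. i \<in> I \<Longrightarrow> KL (P i) (Q i) \<le> ereal (\<kappa> i)" and "b > 0"
  shows "hard_to_distinguish (1 - ((\<Sum>i\<in>I. \<kappa> i) + 1) / b) (exp b) (PiM I P) (PiM I Q)"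
proof -
  interpret P: product_prob_space P by (rule product_prob_spaceI) (rule P)
  interpret Q: product_prob_space Q by (rule product_prob_spaceI) (rule Q)
  have PP: "prob_space (PiM I P)" and QQ: "prob_space (PiM I Q)"
    by (rule prob_space_PiM, rule P, rule prob_space_PiM, rule Q)
  note emeasure_PP = finite_measure.emeasure_eq_measure[OF prob_space.finite_measure[OF PP]]
  define p where "p i = RN_deriv (Q i) (P i)" for i
  define l where "l i y = ln (enn2real (p i y))" for i y
  define S where "S y = (\<Sum>i\<in>I. l i (y i))" for y
  have p_meas[measurable]: "p i \<in> borel_measurable (Q i)" for i
    by (simp add: p_def)
  have [measurable]: "p i \<in> borel_measurable (P i)" for i
    using p_meas[of i] by (simp cong: measurable_cong_sets add: sets)
  have [measurable]: "l i \<in> borel_measurable (P i)" "l i \<in> borel_measurable (Q i)" for i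
    unfolding l_def by measurable
  have S_meas[measurable]: "S \<in> borel_measurable (PiM I P)" "S \<in> borel_measurable (PiM I Q)"
    unfolding S_def by measurable
  note KLf = KL_finite[OF KL, folded p_def, folded l_def]
  have dens: "density (Q i) (p i) = P i" if "i \<in> I" for i
    unfolding p_def by (rule sigma_finite_measure.density_RN_deriv[OF prob_space_imp_sigma_finite[OF Q]]) (use KLf(1)[OF that] sets in auto)
  have fin: "AE y in Q i. p i y \<noteq> \<infinity>" if "i \<in> I" for i
    unfolding p_def using KLf(1)[OF that] sets[of i]
    by (intro sigma_finite_measure.RN_deriv_finite prob_space_imp_sigma_finite P Q) auto
  \<comment> \<open>\<open>exp (- l i y)\<close> is \<open>1 / p i y\<close> where
    \<open>p i y\<close> is positive, so the integral is a \<open>Q i\<close>-mass. Where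
    \<open>p i y = 0\<close>, the default \<open>ln 0 = 0\<close> does no harm because the weight
    \<open>p i y\<close> is \<open>0\<close>.\<close>
  have exp_le: "(\<integral>\<^sup>+y. ennreal (exp (- l i y)) \<partial>P i) \<le> 1" if "i \<in> I" for i
  proof -
    have "(\<integral>\<^sup>+y. ennreal (exp (- l i y)) \<partial>P i) = (\<integral>\<^sup>+y. p i y * ennreal (exp (- l i y)) \<partial>Q i)"
      by (subst dens[OF that, symmetric], subst nn_integral_density) auto
    also have "\<dots> \<le> (\<integral>\<^sup>+y. 1 \<partial>Q i)"
    proof (rule nn_integral_mono_AE, use fin[OF that] in eventually_elim)
      case (elim y)
      then obtain r where r: "p i y = ennreal r" "r \<ge> 0" by (cases "p i y") auto
      show "p i y * ennreal (exp (- l i y)) \<le> 1"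
      proof (cases "r = 0")
        case False
        then have "r > 0" using r by simp
        then show ?thesis
          by (simp add: l_def r exp_minus ennreal_mult'[symmetric])
      qed (use r in simp)
    qed
    also have "\<dots> = 1" by (simp add: prob_space.emeasure_space_1[OF Q])
    finally show ?thesis .
  qed
  have exp_S_le: "(\<integral>\<^sup>+y. ennreal (exp (- S y)) \<partial>PiM I P) \<le> 1"
  proof -
    have "ennreal (exp (- S y)) = (\<Prod>i\<in>I. ennreal (exp (- l i (y i))))" for y
      by (simp add: S_def prod_ennreal exp_sum[OF I, symmetric] sum_negf)
    then have "(\<integral>\<^sup>+y. ennreal (exp (- S y)) \<partial>PiM I P) = (\<integral>\<^sup>+y. (\<Prod>i\<in>I. ennreal (exp (- l i (y i)))) \<partial>PiM I P)"
      by simp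
    also have "\<dots> = (\<Prod>i\<in>I. \<integral>\<^sup>+y. ennreal (exp (- l i y)) \<partial>P i)"
      by (rule P.product_nn_integral_prod) (auto simp: I)
    also have "\<dots> \<le> (\<Prod>i\<in>I. 1)" by (intro prod_mono_ennreal exp_le)
    finally show ?thesis by simp
  qed
  have exp_int: "integrable (PiM I P) (\<lambda>y. exp (- S y))"
    using exp_S_le by (intro integrableI_nonneg) (auto simp: top_unique order.strict_iff_order)
  have exp_int_le: "(\<integral>y. exp (- S y) \<partial>PiM I P) \<le> 1"
    using exp_S_le by (subst integral_eq_nn_integral) (auto intro!: enn2real_leI)
  have comp: "distr (PiM I P) (P i) (\<lambda>y. y i) = P i" if "i \<in> I" for i
    using that P by (intro distr_PiM_component) auto
  have comp_int: "integrable (PiM I P) (\<lambda>y. l i (y i))" "(\<integral>y. l i (y i) \<partial>PiM I P) \<le> \<kappa> i" if "i \<in> I" for i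
  proof -
    have "integrable (distr (PiM I P) (P i) (\<lambda>y. y i)) (l i)"
      using KLf(2)[OF that] comp[OF that] by simp
    then show "integrable (PiM I P) (\<lambda>y. l i (y i))"
      using that by (subst (asm) integrable_distr_eq) auto
    have "(\<integral>y. l i y \<partial>distr (PiM I P) (P i) (\<lambda>y. y i)) = (\<integral>y. l i (y i) \<partial>PiM I P)"
      using that by (subst integral_distr) auto
    then show "(\<integral>y. l i (y i) \<partial>PiM I P) \<le> \<kappa> i"
      using KLf(3)[OF that] comp[OF that] by simp
  qed
  have S_int: "integrable (PiM I P) S"
    unfolding S_def using comp_int by (intro Bochner_Integration.integrable_sum)
  have S_le: "(\<integral>y. S y \<partial>PiM I P) \<le> (\<Sum>i\<in>I. \<kappa> i)"
    unfolding S_def using comp_int by (subst Bochner_Integration.integral_sum) (auto intro: sum_mono)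
  define G where "G = {y \<in> space (PiM I P). S y \<le> b}"
  have G[measurable]: "G \<in> sets (PiM I P)" unfolding G_def by measurable
  have "b * measure (PiM I P) (space (PiM I P) - G) = (\<integral>y. b * indicator (space (PiM I P) - G) y \<partial>PiM I P)"
    by simp
  also have "\<dots> \<le> (\<integral>y. S y + exp (- S y) \<partial>PiM I P)"
  proof (rule integral_mono)
    \<comment> \<open>The right-hand side is at least \<open>1\<close> everywhere, by
      \<open>1 - S y \<le> exp (- S y)\<close>, and exceeds \<open>b\<close> outside
      \<open>G\<close>.\<close>
    show "b * indicator (space (PiM I P) - G) y \<le> S y + exp (- S y)" if "y \<in> space (PiM I P)" for y
      using exp_ge_add_one_self[of "- S y"] that assms(6)
      by (auto simp: indicator_def G_def not_le intro: order_trans[OF less_imp_le] )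
    show "integrable (PiM I P) (\<lambda>y. b * indicator (space (PiM I P) - G) y)"
      by (intro integrable_mult_right integrable_real_indicator) (auto simp: emeasure_PP)
  qed (use S_int exp_int in auto)
  also have "\<dots> \<le> (\<Sum>i\<in>I. \<kappa> i) + 1"
    using S_int exp_int S_le exp_int_le by simp
  finally have "measure (PiM I P) (space (PiM I P) - G) \<le> ((\<Sum>i\<in>I. \<kappa> i) + 1) / b"
    using assms(6) by (simp add: field_simps)
  then have G_prob: "1 - ((\<Sum>i\<in>I. \<kappa> i) + 1) / b \<le> measure (PiM I P) G"
    using prob_space.prob_compl[OF PP G] by linarith
  have dens_PiM: "PiM I P = density (PiM I Q) (\<lambda>y. \<Prod>i\<in>I. p i (y i))"
    by (rule prod_density[OF I P Q]) (auto simp: dens)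
  have fin_PiM: "AE y in PiM I Q. \<forall>i\<in>I. p i (y i) \<noteq> \<infinity>"
    using I fin Q by (intro AE_finite_allI AE_PiM_component) auto
  have sets_PiM: "sets (PiM I Q) = sets (PiM I P)"
    by (intro sets_PiM_cong) (auto simp: sets)
  have prod_meas: "(\<lambda>y. \<Prod>i\<in>I. p i (y i)) \<in> borel_measurable (PiM I Q)"
    by (intro borel_measurable_prod_ennreal) measurable
  have "(\<integral>\<^sup>+y. g y * indicator G y \<partial>PiM I P) \<le> ennreal (exp b) * (\<integral>\<^sup>+y. g y \<partial>PiM I Q)"
    if g: "g \<in> borel_measurable (PiM I P)" for g
  proof -
    have g'[measurable]: "g \<in> borel_measurable (PiM I Q)" and [measurable]: "G \<in> sets (PiM I Q)"
      using g G by (simp_all cong: measurable_cong_sets add: sets_PiM)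
    have "(\<integral>\<^sup>+y. g y * indicator G y \<partial>PiM I P) =
        (\<integral>\<^sup>+y. (\<Prod>i\<in>I. p i (y i)) * (g y * indicator G y) \<partial>PiM I Q)"
      by (subst dens_PiM, subst nn_integral_density) (use prod_meas in auto)
    also have "\<dots> \<le> (\<integral>\<^sup>+y. ennreal (exp b) * g y \<partial>PiM I Q)"
    proof (rule nn_integral_mono_AE, use fin_PiM in eventually_elim)
      case (elim y)
      show "(\<Prod>i\<in>I. p i (y i)) * (g y * indicator G y) \<le> ennreal (exp b) * g y"
      proof (cases "y \<in> G")
        case True
        \<comment> \<open>Because of \<open>ln 0 = 0\<close> the product equals
          \<open>exp (S y)\<close> only if no factor vanishes; a vanishing factor makes the bound
          trivial.\<close>
        have "(\<Prod>i\<in>I. p i (y i)) \<le> ennreal (exp b)"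
        proof (cases "\<exists>i\<in>I. p i (y i) = 0")
          case True
          then have "(\<Prod>i\<in>I. p i (y i)) = 0" using I by (auto simp: prod_zero_iff)
          then show ?thesis by (simp only: zero_le)
        next
          case False
          have "p i (y i) = ennreal (exp (l i (y i)))" if "i \<in> I" for i
          proof -
            have "p i (y i) \<noteq> 0" "p i (y i) \<noteq> \<infinity>" using that elim False by auto
            then have "enn2real (p i (y i)) > 0"
              by (simp add: enn2real_positive_iff less_top zero_less_iff_neq_zero)
            then have "exp (l i (y i)) = enn2real (p i (y i))" by (simp add: l_def)
            then show ?thesis using \<open>p i (y i) \<noteq> \<infinity>\<close> by (simp add: less_top)
          qed
          then have "(\<Prod>i\<in>I. p i (y i)) = ennreal (exp (S y))"
            by (simp add: S_def exp_sum[OF I] prod_ennreal)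
          then show ?thesis using True by (simp add: G_def)
        qed
        then show ?thesis using True by (simp add: mult_right_mono)
      qed simp
    qed
    also have "\<dots> = ennreal (exp b) * (\<integral>\<^sup>+y. g y \<partial>PiM I Q)"
      by (rule nn_integral_cmult) measurable
    finally show ?thesis .
  qed
  moreover have "ennreal (1 - ((\<Sum>i\<in>I. \<kappa> i) + 1) / b) \<le> emeasure (PiM I P) G"
    using G_prob by (simp add: emeasure_PP ennreal_leI)
  ultimately show ?thesis
    unfolding hard_to_distinguish_def using G sets_PiM PP QQ by blast
qed

section \<open>Flows along a coordinate axis\<close>

text \<open>
  Along a line in direction \<open>axis i 1\<close>, the field \<open>c / (1 + \<phi>)\<close> with \<open>\<phi> = \<partial>\<^sub>i \<psi>\<close> moves the quantity
  \<open>s + \<psi>\<close> at constant speed \<open>c\<close>.  Where \<open>\<psi>\<close> vanishes, a trajectory has therefore neither delay nor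
  advance with respect to the unperturbed one.
\<close>

locale axis_flow =
  fixes i0 :: "'d::finite" and c B :: real and \<psi> \<phi> :: "real^'d \<Rightarrow> real"
  assumes c_pos: "c > 0"
    and deriv: "\<And>x. ((\<lambda>s. \<psi> (x + s *\<^sub>R axis i0 1)) has_real_derivative \<phi> x) (at 0)"
    and deriv_le: "\<And>x. \<bar>\<phi> x\<bar> \<le> 1 / 2"
    and bound: "\<And>x. \<bar>\<psi> x\<bar> \<le> B"
begin

definition field :: "real^'d \<Rightarrow> real^'d" where
  "field x = (c / (1 + \<phi> x)) *\<^sub>R axis i0 1"

definition clock :: "real^'d \<Rightarrow> real \<Rightarrow> real" where
  "clock x s = s + \<psi> (x + s *\<^sub>R axis i0 1)"

lemma one_plus_ge: "1 + \<phi> x \<ge> 1 / 2"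
  using deriv_le[of x] by linarith

lemma clock_deriv: "(clock x has_real_derivative 1 + \<phi> (x + s *\<^sub>R axis i0 1)) (at s)"
proof -
  have "((\<lambda>u. \<psi> (x + (u + s) *\<^sub>R axis i0 1)) has_real_derivative \<phi> (x + s *\<^sub>R axis i0 1)) (at 0)"
    using deriv[of "x + s *\<^sub>R axis i0 1"] by (simp add: scaleR_left_distrib add_ac)
  then have "((\<lambda>s. \<psi> (x + s *\<^sub>R axis i0 1)) has_real_derivative \<phi> (x + s *\<^sub>R axis i0 1)) (at s)"
    using DERIV_shift[of "\<lambda>s. \<psi> (x + s *\<^sub>R axis i0 1)" _ 0 s] by simp
  then show ?thesis
    unfolding clock_def by (intro DERIV_add DERIV_ident)
qed

lemma clock_strict_mono: "s < s' \<Longrightarrow> clock x s < clock x s'"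
proof (rule DERIV_pos_imp_increasing[where f = "clock x"])
  fix u
  show "\<exists>y. (clock x has_real_derivative y) (at u) \<and> 0 < y"
    using clock_deriv[of x u] one_plus_ge[of "x + u *\<^sub>R axis i0 1"] by force
qed

lemma clock_less_iff: "clock x s < clock x s' \<longleftrightarrow> s < s'"
  using clock_strict_mono[of s s' x] clock_strict_mono[of s' s x]
  by (cases s s' rule: linorder_cases) auto

lemma clock_eq_iff: "clock x s = clock x s' \<longleftrightarrow> s = s'"
  using clock_strict_mono[of s s' x] clock_strict_mono[of s' s x]
  by (cases s s' rule: linorder_cases) auto

lemma clock_cont: "isCont (clock x) s"
  using clock_deriv by (rule DERIV_isCont)

lemma clock_surj: "\<exists>s. clock x s = y"
proof -
  have "0 \<le> B" using bound[of 0] by linarith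
  moreover have "clock x (y - B) \<le> y" "y \<le> clock x (y + B)"
    using bound[of "x + (y - B) *\<^sub>R axis i0 1"] bound[of "x + (y + B) *\<^sub>R axis i0 1"]
    by (auto simp: clock_def)
  ultimately show ?thesis
    using IVT[of "clock x" "y - B" y "y + B"] clock_cont by auto
qed

definition unclock :: "real^'d \<Rightarrow> real \<Rightarrow> real" where
  "unclock x y = (SOME s. clock x s = y)"

lemma clock_unclock [simp]: "clock x (unclock x y) = y"
  unfolding unclock_def using clock_surj by (rule someI_ex)

lemma unclock_clock [simp]: "unclock x (clock x s) = s"
  using clock_unclock[of x "clock x s"] unfolding clock_eq_iff .

lemma unclock_deriv:
  "(unclock x has_real_derivative inverse (1 + \<phi> (x + unclock x y *\<^sub>R axis i0 1))) (at y)"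
proof (rule DERIV_inverse_function[where f = "clock x" and a = "y - 1" and b = "y + 1"])
  show "(clock x has_real_derivative 1 + \<phi> (x + unclock x y *\<^sub>R axis i0 1)) (at (unclock x y))"
    by (rule clock_deriv)
  show "1 + \<phi> (x + unclock x y *\<^sub>R axis i0 1) \<noteq> 0"
    using one_plus_ge[of "x + unclock x y *\<^sub>R axis i0 1"] by linarith
  have "isCont (unclock x) (clock x (unclock x y))"
    by (rule isCont_inverse_function[where d = 1]) (auto intro: clock_cont)
  then show "isCont (unclock x) y" by simp
qed auto

text \<open>The clock shows \<open>\<psi> x\<close> at the start and has to advance by
  \<open>c * t\<close>; inverting it gives the distance travelled.\<close>

definition path :: "real^'d \<Rightarrow> real \<Rightarrow> real^'d" where
  "path x t = x + unclock x (c * t + \<psi> x) *\<^sub>R axis i0 1"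

lemma path_deriv: "(path x has_vector_derivative field (path x t)) (at t)"
proof -
  have 1: "((\<lambda>t. c * t + \<psi> x) has_real_derivative c) (at t)"
    by (auto intro!: derivative_eq_intros)
  have "((\<lambda>t. unclock x (c * t + \<psi> x)) has_real_derivative
      inverse (1 + \<phi> (path x t)) * c) (at t)"
    using DERIV_chain2[OF unclock_deriv 1] by (simp add: path_def)
  then show ?thesis
    unfolding path_def field_def
    by (auto intro!: derivative_eq_intros simp: path_def has_real_derivative_iff_has_vector_derivative
        divide_inverse mult.commute)
qed

text \<open>Uniqueness rests on conserved quantities: along any solution the coordinates other than
  \<open>i0\<close> are constant, and so is the clock reading minus \<open>c * t\<close>, which
  fixes the position since the clock is injective. The definite description in \<open>flow\<close>
  makes uniqueness indispensable.\<close>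

lemma path_unique:
  assumes "w 0 = x" and w: "\<And>t. (w has_vector_derivative field (w t)) (at t)"
  shows "w t = path x t"
proof -
  have comp: "((\<lambda>t. w t $ j) has_real_derivative field (w t) $ j) (at t)" for j t
    using bounded_linear.has_vector_derivative[OF bounded_linear_vec_nth w]
    by (simp add: has_real_derivative_iff_has_vector_derivative)
  define r where "r t = w t $ i0 - x $ i0" for t
  have other: "w t $ j = x $ j" if "j \<noteq> i0" for j t
  proof -
    have "((\<lambda>t. w t $ j) has_real_derivative 0) (at t)" for t
      using comp[of j t] that by (simp add: field_def axis_def)
    then have "w t $ j = w 0 $ j" by (intro DERIV_isconst_all) auto
    then show ?thesis by (simp add: assms(1))
  qed
  have w_eq: "w t = x + r t *\<^sub>R axis i0 1" for t
    by (auto simp: vec_eq_iff r_def axis_def other)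
  have r: "(r has_real_derivative c / (1 + \<phi> (x + r t *\<^sub>R axis i0 1))) (at t)" for t
  proof -
    have "(r has_real_derivative field (w t) $ i0) (at t)"
      unfolding r_def using DERIV_diff[OF comp[of i0 t] DERIV_const, of "x $ i0"] by simp
    then show ?thesis
      unfolding w_eq[of t] by (simp add: field_def)
  qed
  have "((\<lambda>t. clock x (r t) - c * t) has_real_derivative 0) (at t)" for t
  proof -
    have "((\<lambda>t. clock x (r t)) has_real_derivative
       (1 + \<phi> (x + r t *\<^sub>R axis i0 1)) * (c / (1 + \<phi> (x + r t *\<^sub>R axis i0 1)))) (at t)"
      by (rule DERIV_chain2[OF clock_deriv r])
    moreover have "1 + \<phi> (x + r t *\<^sub>R axis i0 1) \<noteq> 0"
      using one_plus_ge[of "x + r t *\<^sub>R axis i0 1"] by linarith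
    ultimately show ?thesis
      by (auto intro!: derivative_eq_intros)
  qed
  then have "clock x (r t) - c * t = clock x (r 0) - c * 0"
    by (intro DERIV_isconst_all) auto
  then have "clock x (r t) = c * t + \<psi> x"
    by (simp add: r_def assms(1) clock_def)
  then have "r t = unclock x (c * t + \<psi> x)"
    using unclock_clock[of x "r t"] by simp
  then show ?thesis using w_eq[of t] by (simp add: path_def)
qed

lemma path_0: "path x 0 = x"
proof -
  have "clock x 0 = \<psi> x" by (simp add: clock_def)
  then have "unclock x (\<psi> x) = 0" using unclock_clock[of x 0] by simp
  then show ?thesis by (simp add: path_def)
qed

lemma flow_eq_path: "flow field x = path x"
  unfolding flow_def
proof (rule the_equality)
  show "path x 0 = x \<and> (\<forall>t. (path x has_vector_derivative field (path x t)) (at t))"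
    by (simp add: path_0 path_deriv)
  fix u assume "u 0 = x \<and> (\<forall>t. (u has_vector_derivative field (u t)) (at t))"
  then show "u = path x" by (intro ext path_unique) auto
qed

lemma flow_eqI: "clock x s = c * t + \<psi> x \<Longrightarrow> flow field x t = x + s *\<^sub>R axis i0 1"
  unfolding flow_eq_path path_def using unclock_clock[of x s] by simp

lemma vector_derivative_flow:
  assumes "T > 0" "t \<in> {0..T}"
  shows "vector_derivative (flow field x) (at t within {0..T}) = field (flow field x t)"
  unfolding flow_eq_path
  by (rule vector_derivative_within_closed_interval[OF assms has_vector_derivative_at_within[OF path_deriv]])

end

section \<open>Bumps\<close>

text \<open>At \<open>0\<close> the difference quotient is at most
  \<open>\<bar>v\<bar> ^ Suc n\<close> in absolute value, so an exponent of two or more smooths the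
  kink.\<close>

lemma pos_part_power_deriv:
  "((\<lambda>u::real. max 0 u ^ Suc (Suc n)) has_real_derivative real (Suc (Suc n)) * max 0 u ^ Suc n) (at u)"
proof (cases u "0::real" rule: linorder_cases)
  case less
  have "((\<lambda>u::real. 0) has_real_derivative 0) (at u)" by simp
  then have "((\<lambda>u::real. max 0 u ^ Suc (Suc n)) has_real_derivative 0) (at u)"
    by (rule has_field_derivative_transform_within_open[where S = "{..<0}"]) (use less in auto)
  then show ?thesis using less by simp
next
  case greater
  have "((\<lambda>u::real. u ^ Suc (Suc n)) has_real_derivative real (Suc (Suc n)) * u ^ Suc n) (at u)"
    using DERIV_pow[of "Suc (Suc n)" u UNIV] by simp
  then have "((\<lambda>u::real. max 0 u ^ Suc (Suc n)) has_real_derivative real (Suc (Suc n)) * u ^ Suc n) (at u)"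
    by (rule has_field_derivative_transform_within_open[where S = "{0<..}"]) (use greater in auto)
  then show ?thesis using greater by simp
next
  case equal
  have "((\<lambda>v::real. (max 0 v ^ Suc (Suc n) - max 0 0 ^ Suc (Suc n)) / (v - 0)) \<longlongrightarrow> 0) (at 0)"
  proof (rule Lim_null_comparison)
    show "\<forall>\<^sub>F v in at (0::real). norm ((max 0 v ^ Suc (Suc n) - max 0 0 ^ Suc (Suc n)) / (v - 0)) \<le> \<bar>v\<bar> ^ Suc n"
    proof (rule always_eventually, rule allI)
      fix v :: real
      show "norm ((max 0 v ^ Suc (Suc n) - max 0 0 ^ Suc (Suc n)) / (v - 0)) \<le> \<bar>v\<bar> ^ Suc n"
        by (cases "v \<le> 0") (simp_all add: abs_mult mult_nonpos_nonneg)
    qed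
    have "((\<lambda>v::real. \<bar>v\<bar> ^ Suc n) \<longlongrightarrow> \<bar>0\<bar> ^ Suc n) (at 0)"
      by (intro tendsto_intros)
    then show "((\<lambda>v::real. \<bar>v\<bar> ^ Suc n) \<longlongrightarrow> 0) (at 0)" by simp
  qed
  then show ?thesis using equal by (simp add: has_field_derivative_iff)
qed

text \<open>A power of the positive part of the cosine has period \<open>1\<close>, so one formula
  supplies a bump in every cell. It vanishes at distance \<open>1 / 4\<close> or more from the
  integers, which leaves gaps between the bumps. Its smoothness grows with \<open>N\<close>, and a
  class of finite order asks for no more.\<close>

definition bump :: "nat \<Rightarrow> real \<Rightarrow> real" where
  "bump N t = max 0 (cos (2 * pi * t)) ^ N"

lemma bump_deriv:
  "(bump (Suc (Suc n)) has_real_derivative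
     - (2 * pi * real (Suc (Suc n))) * (bump (Suc n) t * sin (2 * pi * t))) (at t)"
proof -
  have "((\<lambda>t. cos (2 * pi * t)) has_real_derivative - (2 * pi) * sin (2 * pi * t)) (at t)"
    by (auto intro!: derivative_eq_intros)
  from DERIV_chain2[OF pos_part_power_deriv this, of n] show ?thesis
    unfolding bump_def by (rule DERIV_cong) (simp add: algebra_simps)
qed

lemma bump_range: "0 \<le> bump N t" "bump N t \<le> 1"
  by (auto simp: bump_def intro!: power_le_one)

text \<open>Up to sign and the factor \<open>2 * pi\<close> each is the derivative of the other,
  hence the joint induction.\<close>

lemma bounded_derivs_sin_cos:
  fixes i :: "'d::finite"
  shows "bounded_derivs k ((2 * pi) ^ k) (\<lambda>z :: real^'d. sin (2 * pi * z $ i)) \<and>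
    bounded_derivs k ((2 * pi) ^ k) (\<lambda>z :: real^'d. cos (2 * pi * z $ i))"
proof (induction k)
  case (Suc k)
  have ge1: "(1::real) \<le> (2 * pi) ^ Suc k"
    using pi_ge_two by (intro one_le_power) auto
  \<comment> \<open>\<open>a\<close> is the sign: \<open>1\<close> when the sine is differentiated,
    \<open>-1\<close> for the cosine.\<close>
  have *: "bounded_derivs k ((2 * pi) ^ Suc k * norm v) (\<lambda>z :: real^'d. (2 * pi * v $ i * a) * g z)"
    if "bounded_derivs k ((2 * pi) ^ k) g" "\<bar>a\<bar> = 1" for g :: "real^'d \<Rightarrow> real" and a and v :: "real^'d"
  proof (rule bounded_derivs_mono_bound[OF bounded_derivs_cmult[OF that(1)]])
    show "\<bar>2 * pi * v $ i * a\<bar> * (2 * pi) ^ k \<le> (2 * pi) ^ Suc k * norm v"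
      using component_le_norm_cart[of v i] that(2) by (simp add: abs_mult mult_ac mult_left_mono)
  qed
  have "bounded_derivs (Suc k) ((2 * pi) ^ Suc k) (\<lambda>z :: real^'d. sin (2 * pi * z $ i))"
  proof (rule bounded_derivs_SucI)
    show "\<bar>sin (2 * pi * z $ i)\<bar> \<le> (2 * pi) ^ Suc k" for z :: "real^'d"
      using abs_sin_le_one[of "2 * pi * z $ i"] ge1 by linarith
    show "((\<lambda>z :: real^'d. sin (2 * pi * z $ i)) has_derivative
        (\<lambda>v. (2 * pi * v $ i * 1) * cos (2 * pi * z $ i))) (at z)" for z
      by (auto intro!: derivative_eq_intros bounded_linear.has_derivative[OF bounded_linear_vec_nth])
    show "bounded_derivs k ((2 * pi) ^ Suc k * norm v) (\<lambda>z :: real^'d. (2 * pi * v $ i * 1) * cos (2 * pi * z $ i))" for v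
      using Suc by (intro *) auto
  qed
  moreover have "bounded_derivs (Suc k) ((2 * pi) ^ Suc k) (\<lambda>z :: real^'d. cos (2 * pi * z $ i))"
  proof (rule bounded_derivs_SucI)
    show "\<bar>cos (2 * pi * z $ i)\<bar> \<le> (2 * pi) ^ Suc k" for z :: "real^'d"
      using abs_cos_le_one[of "2 * pi * z $ i"] ge1 by linarith
    show "((\<lambda>z :: real^'d. cos (2 * pi * z $ i)) has_derivative
        (\<lambda>v. (2 * pi * v $ i * -1) * sin (2 * pi * z $ i))) (at z)" for z
      by (auto intro!: derivative_eq_intros bounded_linear.has_derivative[OF bounded_linear_vec_nth])
    show "bounded_derivs k ((2 * pi) ^ Suc k * norm v) (\<lambda>z :: real^'d. (2 * pi * v $ i * -1) * sin (2 * pi * z $ i))" for v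
      using Suc by (intro *) auto
  qed
  ultimately show ?case ..
qed auto

text \<open>A derivative turns \<open>bump N\<close> into a multiple of \<open>bump (N - 1)\<close>
  times a sine, so the exponent drops by one per order.\<close>

lemma bounded_derivs_bump:
  fixes i :: "'d::finite"
  shows "k < N \<Longrightarrow> \<exists>M. bounded_derivs k M (\<lambda>z :: real^'d. bump N (z $ i))"
proof (induction k arbitrary: N)
  case 0
  then show ?case using bump_range by (auto intro!: exI[of _ 1] simp: abs_le_iff)
next
  case (Suc k)
  define n where "n = N - 2"
  have N: "N = Suc (Suc n)" using Suc.prems by (simp add: n_def)
  obtain M where "bounded_derivs k M (\<lambda>z :: real^'d. bump (Suc n) (z $ i))"
    using Suc.IH[of "Suc n"] Suc.prems N by auto
  from bounded_derivs_mult[OF this conjunct1[OF bounded_derivs_sin_cos]]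
  obtain M' where M': "bounded_derivs k M' (\<lambda>z :: real^'d. bump (Suc n) (z $ i) * sin (2 * pi * z $ i))"
    by blast
  define M'' where "M'' = max 1 (2 * pi * real N * M')"
  have "bounded_derivs (Suc k) M'' (\<lambda>z :: real^'d. bump N (z $ i))"
  proof (rule bounded_derivs_SucI)
    show "\<bar>bump N (z $ i)\<bar> \<le> M''" for z :: "real^'d"
      using bump_range[of N "z $ i"] by (auto simp: M''_def)
    show "((\<lambda>z :: real^'d. bump N (z $ i)) has_derivative
        (\<lambda>v. (- (2 * pi * real N) * v $ i) * (bump (Suc n) (z $ i) * sin (2 * pi * z $ i)))) (at z)" for z
    proof -
      have "((\<lambda>z :: real^'d. z $ i) has_derivative (\<lambda>v. v $ i)) (at z)"
        by (rule bounded_linear_imp_has_derivative[OF bounded_linear_vec_nth])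
      from DERIV_compose_FDERIV[OF bump_deriv this, of n] show ?thesis
        by (simp add: N mult_ac)
    qed
    fix v :: "real^'d"
    show "bounded_derivs k (M'' * norm v) (\<lambda>z :: real^'d. (- (2 * pi * real N) * v $ i) * (bump (Suc n) (z $ i) * sin (2 * pi * z $ i)))"
    proof (rule bounded_derivs_mono_bound[OF bounded_derivs_cmult[OF M']])
      have "\<bar>- (2 * pi * real N) * v $ i\<bar> * M' = (2 * pi * real N * M') * \<bar>v $ i\<bar>"
        by (simp add: abs_mult mult_ac)
      also have "\<dots> \<le> M'' * norm v"
        using component_le_norm_cart[of v i] by (intro mult_mono) (auto simp: M''_def)
      finally show "\<bar>- (2 * pi * real N) * v $ i\<bar> * M' \<le> M'' * norm v" .
    qed
  qed
  then show ?case by blast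
qed

definition profile :: "nat \<Rightarrow> real^'d::finite \<Rightarrow> real" where
  "profile N z = (\<Prod>i\<in>UNIV. bump N (z $ i))"

definition profile_deriv :: "'d::finite \<Rightarrow> nat \<Rightarrow> real^'d \<Rightarrow> real" where
  "profile_deriv i0 N z = frechet_derivative (profile N) (at z) (axis i0 1)"

lemma profile_range: "0 \<le> profile N z" "profile N z \<le> 1"
  by (auto simp: profile_def bump_range intro!: prod_nonneg prod_le_1)

lemma bounded_derivs_profile: "k < N \<Longrightarrow> \<exists>M. bounded_derivs k M (profile N :: real^'d::finite \<Rightarrow> real)"
  unfolding profile_def by (intro bounded_derivs_prod bounded_derivs_bump) auto

lemma bounded_derivs_profile_deriv:
  fixes i0 :: "'d::finite"
  assumes "Suc k < N"
  shows "\<exists>M. bounded_derivs k M (profile_deriv i0 N)"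
proof -
  obtain M where "bounded_derivs (Suc k) M (profile N :: real^'d \<Rightarrow> real)"
    using bounded_derivs_profile[OF assms] by auto
  from bounded_derivs_SucD(2)[OF this, of "axis i0 1"] show ?thesis
    unfolding profile_deriv_def by auto
qed

lemma has_derivative_along_line:
  assumes "(g has_derivative g') (at (x + s *\<^sub>R v))"
  shows "((\<lambda>s. g (x + s *\<^sub>R v)) has_real_derivative g' v) (at s)"
proof -
  have "((\<lambda>s. x + s *\<^sub>R v) has_derivative (\<lambda>u. u *\<^sub>R v)) (at s)"
    by (auto intro!: derivative_eq_intros)
  from has_derivative_compose[OF this assms]
  have "((\<lambda>s. g (x + s *\<^sub>R v)) has_derivative (\<lambda>u. g' (u *\<^sub>R v))) (at s)" .
  moreover have "g' (u *\<^sub>R v) = g' v * u" for u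
    using linear_scale[OF has_derivative_linear[OF assms]] by simp
  ultimately show ?thesis
    by (simp add: has_field_derivative_def)
qed

lemma profile_has_derivative:
  assumes "2 \<le> N"
  shows "(profile N has_derivative frechet_derivative (profile N) (at z)) (at (z :: real^'d::finite))"
proof -
  obtain M where "bounded_derivs (Suc 0) M (profile N :: real^'d \<Rightarrow> real)"
    using bounded_derivs_profile[of "Suc 0" N] assms by auto
  then show ?thesis by (rule bounded_derivs_SucD)
qed

text \<open>Only the distance to the nearest integer matters, and the cosine decreases on
  \<open>{0..pi}\<close>. The nonstrict statement shows where the profile vanishes, the strict one
  how close to the integers the points outside \<open>cut_region\<close> are.\<close>

lemma cos_sign_far:
  shows "1 / 4 \<le> \<bar>t - of_int (round t)\<bar> \<Longrightarrow> cos (2 * pi * t) \<le> 0"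
    and "1 / 4 < \<bar>t - of_int (round t)\<bar> \<Longrightarrow> cos (2 * pi * t) < 0"
proof -
  define u where "u = t - of_int (round t)"
  have u: "\<bar>u\<bar> \<le> 1/2"
    using of_int_round_abs_le[of t] by (auto simp: u_def abs_minus_commute)
  have "2 * pi * t = 2 * pi * u + 2 * pi * of_int (round t)"
    by (simp add: u_def algebra_simps)
  then have eq: "cos (2 * pi * t) = cos (2 * pi * \<bar>u\<bar>)"
    by (simp add: cos_add abs_if sin_int_2pin cos_int_2pin)
  have "2 * pi * \<bar>u\<bar> \<le> 2 * pi * (1 / 2)"
    using u by (intro mult_left_mono) auto
  then have le: "2 * pi * \<bar>u\<bar> \<le> pi" by simp
  show "cos (2 * pi * t) \<le> 0" if "1 / 4 \<le> \<bar>t - of_int (round t)\<bar>"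
  proof -
    have "2 * pi * (1 / 4) \<le> 2 * pi * \<bar>u\<bar>"
      using that by (intro mult_left_mono) (auto simp: u_def)
    then have "cos (2 * pi * \<bar>u\<bar>) \<le> cos (pi / 2)"
      using le by (intro cos_monotone_0_pi_le) auto
    then show ?thesis by (simp add: eq)
  qed
  show "cos (2 * pi * t) < 0" if "1 / 4 < \<bar>t - of_int (round t)\<bar>"
  proof -
    have "2 * pi * (1 / 4) < 2 * pi * \<bar>u\<bar>"
      using that by (intro mult_strict_left_mono) (auto simp: u_def)
    then have "cos (2 * pi * \<bar>u\<bar>) < cos (pi / 2)"
      using le by (intro cos_monotone_0_pi) auto
    then show ?thesis by (simp add: eq)
  qed
qed

lemma profile_eq_0_if_cos:
  assumes "cos (2 * pi * z $ i) \<le> 0" "N > 0"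
  shows "profile N z = 0"
proof -
  have "bump N (z $ i) = 0" using assms by (simp add: bump_def max_def)
  then show ?thesis unfolding profile_def by (intro prod_zero) auto
qed

lemma profile_eq_0:
  "1 / 4 \<le> \<bar>z $ i - of_int (round (z $ i))\<bar> \<Longrightarrow> N > 0 \<Longrightarrow> profile N z = 0"
  by (rule profile_eq_0_if_cos[OF cos_sign_far(1)])

section \<open>Selecting bumps by cells\<close>

definition cell :: "real^'d::finite \<Rightarrow> 'd \<Rightarrow> int" where
  "cell z i = round (z $ i)"

text \<open>An open set on which the profile is \<open>0\<close> and which contains all jumps of
  \<open>cell\<close>, since the cosine is \<open>-1\<close> at half-integers. It plays the role of
  \<open>W\<close> in \<open>bounded_derivs_cutoff\<close>.\<close>

definition cut_region :: "(real^'d::finite) set" where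
  "cut_region = {z. \<exists>i. cos (2 * pi * z $ i) < 0}"

lemma open_cut_region: "open (cut_region :: (real^'d::finite) set)"
proof -
  have eq: "(cut_region :: (real^'d) set) = (\<Union>i\<in>UNIV. {z. cos (2 * pi * z $ i) < 0})"
    by (auto simp: cut_region_def)
  show ?thesis
    unfolding eq by (intro open_UN ballI open_Collect_less continuous_intros)
qed

lemma profile_cut_region: "N > 0 \<Longrightarrow> z \<in> cut_region \<Longrightarrow> profile N z = 0"
  unfolding cut_region_def mem_Collect_eq by (elim exE) (rule profile_eq_0_if_cos[OF less_imp_le])

lemma cell_locally_constant:
  assumes "z \<notin> cut_region"
  shows "\<forall>\<^sub>F y in nhds z. cell y = cell z"
proof -
  \<comment> \<open>A coordinate within \<open>1 / 4\<close> of an integer stays within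
    \<open>3 / 8 < 1 / 2\<close> of it, so rounding gives the same value.\<close>
  have "cell y = cell z" if "dist y z < 1 / 8" for y
  proof
    fix i
    have "\<bar>z $ i - of_int (round (z $ i))\<bar> \<le> 1 / 4"
      
    proof (rule ccontr)
      assume "\<not> \<bar>z $ i - of_int (round (z $ i))\<bar> \<le> 1 / 4"
      then have "cos (2 * pi * z $ i) < 0" by (intro cos_sign_far(2)) simp
      then show False using assms unfolding cut_region_def by blast
    qed
    moreover have "\<bar>y $ i - z $ i\<bar> < 1 / 8"
      using component_le_norm_cart[of "y - z" i] that by (simp add: dist_norm)
    ultimately have "\<bar>y $ i - of_int (round (z $ i))\<bar> < 1 / 2" by linarith
    then show "cell y i = cell z i" unfolding cell_def by (rule round_unique')
  qed
  then have "\<forall>y. dist y z < 1 / 8 \<longrightarrow> cell y = cell z" by blast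
  moreover have "(0::real) < 1 / 8" by simp
  ultimately show ?thesis unfolding eventually_nhds_metric by blast
qed

text \<open>The indicator of \<open>cell z \<in> Z\<close> keeps exactly the bumps of
  \<open>Z\<close> from the periodic profile. No sum over \<open>Z\<close> occurs, so
  \<open>Z\<close> may be any set and bounds do not depend on it.\<close>

definition wave :: "nat \<Rightarrow> ('d::finite \<Rightarrow> int) set \<Rightarrow> real^'d \<Rightarrow> real" where
  "wave N Z z = of_bool (cell z \<in> Z) * profile N z"

definition wave_deriv :: "'d::finite \<Rightarrow> nat \<Rightarrow> ('d \<Rightarrow> int) set \<Rightarrow> real^'d \<Rightarrow> real" where
  "wave_deriv i0 N Z z = of_bool (cell z \<in> Z) * profile_deriv i0 N z"

lemma wave_range: "0 \<le> wave N Z z" "wave N Z z \<le> 1"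
  using profile_range[of N z] by (auto simp: wave_def)

lemma wave_cut:
  assumes "2 \<le> N"
  shows "((\<lambda>z. of_bool (cell z \<in> Z) * profile N z) has_derivative
      (\<lambda>v. of_bool (cell z \<in> Z) * frechet_derivative (profile N) (at z) v)) (at z)"
    and "z \<in> cut_region \<Longrightarrow> frechet_derivative (profile N) (at z) = (\<lambda>v. 0)"
proof -
  have "\<forall>\<^sub>F y in nhds x. of_bool (cell y \<in> Z) = (of_bool (cell x \<in> Z) :: real)" if "x \<notin> cut_region" for x
    using cell_locally_constant[OF that] by eventually_elim simp
  note has_derivative_cutoff[OF open_cut_region _ this profile_has_derivative[OF assms]]
  then show "((\<lambda>z. of_bool (cell z \<in> Z) * profile N z) has_derivative
      (\<lambda>v. of_bool (cell z \<in> Z) * frechet_derivative (profile N) (at z) v)) (at z)"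
    "z \<in> cut_region \<Longrightarrow> frechet_derivative (profile N) (at z) = (\<lambda>v. 0)"
    using assms by (auto simp: profile_cut_region)
qed

lemma wave_has_deriv:
  assumes "2 \<le> N"
  shows "((\<lambda>s. wave N Z (z + s *\<^sub>R axis i0 1)) has_real_derivative wave_deriv i0 N Z z) (at 0)"
proof -
  have "(wave N Z has_derivative (\<lambda>v. of_bool (cell z \<in> Z) * frechet_derivative (profile N) (at z) v))
      (at (z + 0 *\<^sub>R axis i0 1))"
    using wave_cut(1)[OF assms, of Z z] by (simp add: wave_def[abs_def])
  from has_derivative_along_line[OF this] show ?thesis
    by (simp add: wave_deriv_def profile_deriv_def)
qed

lemma bounded_derivs_wave_deriv:
  assumes "bounded_derivs k M (profile_deriv i0 N)" "2 \<le> N"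
  shows "bounded_derivs k M (wave_deriv i0 N Z)"
  unfolding wave_deriv_def
proof (rule bounded_derivs_cutoff[OF assms(1) open_cut_region])
  show "profile_deriv i0 N z = 0" if "z \<in> cut_region" for z
    using wave_cut(2)[OF assms(2) that] by (simp add: profile_deriv_def)
  show "\<forall>\<^sub>F y in nhds x. of_bool (cell y \<in> Z) = (of_bool (cell x \<in> Z) :: real)" if "x \<notin> cut_region" for x
    using cell_locally_constant[OF that] by eventually_elim simp
qed simp

definition lattice_point :: "('d::finite \<Rightarrow> int) \<Rightarrow> real^'d" where
  "lattice_point k = (\<chi> i. of_int (k i))"

lemma profile_periodic: "profile N (z + lattice_point k) = profile N z"
  unfolding profile_def bump_def lattice_point_def
  by (simp add: distrib_left cos_add sin_int_2pin cos_int_2pin)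

lemma profile_deriv_periodic:
  assumes "2 \<le> N"
  shows "profile_deriv i0 N (z + lattice_point k) = profile_deriv i0 N z"
proof -
  have "((\<lambda>s. profile N (z + lattice_point k + s *\<^sub>R axis i0 1)) has_real_derivative
      profile_deriv i0 N (z + lattice_point k)) (at 0)"
    unfolding profile_deriv_def using profile_has_derivative[OF assms]
    by (intro has_derivative_along_line) simp
  moreover have "z + lattice_point k + s *\<^sub>R axis i0 1 = (z + s *\<^sub>R axis i0 1) + lattice_point k" for s
    by simp
  ultimately have "((\<lambda>s. profile N (z + s *\<^sub>R axis i0 1)) has_real_derivative
      profile_deriv i0 N (z + lattice_point k)) (at 0)"
    by (simp only: profile_periodic)
  moreover have "((\<lambda>s. profile N (z + s *\<^sub>R axis i0 1)) has_real_derivative profile_deriv i0 N z) (at 0)"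
    unfolding profile_deriv_def using profile_has_derivative[OF assms]
    by (intro has_derivative_along_line) simp
  ultimately show ?thesis by (rule DERIV_unique)
qed

text \<open>From the centre of a cell, where the profile is \<open>1\<close>, to the midpoint of its
  face in direction \<open>i0\<close>, where it is \<open>0\<close>, the mean value theorem finds
  slope \<open>-2\<close>. As the derivative is Lipschitz, its absolute value stays at least
  \<open>1\<close> on a small cube. \<open>z0\<close> lies on the axis \<open>i0\<close>, so that
  shifts by multiples of it leave the transversal coordinates alone.\<close>

lemma profile_deriv_large:
  fixes i0 :: "'d::finite"
  assumes "3 \<le> N"
  shows "\<exists>z0 :: real^'d. \<exists>\<epsilon>>0. (\<forall>i. 0 \<le> z0 $ i \<and> z0 $ i < 1 / 2) \<and> (\<forall>i. i \<noteq> i0 \<longrightarrow> z0 $ i = 0) \<and> \<epsilon> < 1 / 2 \<and>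
    (\<forall>z. (\<forall>i. \<bar>z $ i - z0 $ i\<bar> \<le> \<epsilon>) \<longrightarrow> cell z = (\<lambda>_. 0) \<and> 1 \<le> \<bar>profile_deriv i0 N z\<bar>)"
proof -
  have N: "2 \<le> N" using assms by simp
  have deriv: "((\<lambda>s. profile N (0 + s *\<^sub>R axis i0 1)) has_real_derivative profile_deriv i0 N (0 + s *\<^sub>R axis i0 1)) (at s)" for s
    unfolding profile_deriv_def by (intro has_derivative_along_line profile_has_derivative N)
  obtain s where s: "0 < s" "s < 1 / 2" and
    "profile N (0 + (1/2) *\<^sub>R axis i0 1) - profile N (0 + 0 *\<^sub>R axis i0 1) =
      (1 / 2 - 0) * profile_deriv i0 N (0 + s *\<^sub>R axis i0 1)"
    using MVT2[of 0 "1 / 2", OF _ deriv] by auto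
  moreover have "profile N ((1/2) *\<^sub>R axis i0 1) = 0"
    by (rule profile_eq_0_if_cos[where i = i0]) (use N in auto)
  moreover have "profile N (0 :: real^'d) = 1"
    by (simp add: profile_def bump_def)
  ultimately have D: "profile_deriv i0 N (s *\<^sub>R axis i0 1) = -2" by simp
  obtain M where M: "bounded_derivs (Suc 0) M (profile_deriv i0 N)"
    using bounded_derivs_profile_deriv[of "Suc 0" N i0] assms by auto
  have "M \<ge> 0" using bounded_derivs_nonneg[OF M] .
  \<comment> \<open>The first entry keeps the cube inside cell \<open>0\<close>; the second limits
    the change of the derivative to \<open>1\<close>, the norm being estimated by the sum of
    \<open>CARD('d)\<close> coordinates.\<close>
  define \<epsilon> where "\<epsilon> = min ((1 / 2 - s) / 2) (1 / (real CARD('d) * M + 1))"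
  have pos: "real CARD('d) * M + 1 > 0" using \<open>M \<ge> 0\<close> by (simp add: add_nonneg_pos)
  have \<epsilon>: "0 < \<epsilon>" "\<epsilon> < 1 / 2 - s" "\<epsilon> \<le> 1 / (real CARD('d) * M + 1)"
    using s pos by (auto simp: \<epsilon>_def min_less_iff_disj)
  have "cell z = (\<lambda>_. 0) \<and> 1 \<le> \<bar>profile_deriv i0 N z\<bar>"
    if z: "\<forall>i. \<bar>z $ i - (s *\<^sub>R axis i0 1 :: real^'d) $ i\<bar> \<le> \<epsilon>" for z
  proof
    show "cell z = (\<lambda>_. 0)"
    proof
      fix i
      have "\<bar>z $ i - of_int 0\<bar> < 1 / 2"
        using z[rule_format, of i] s \<epsilon> by (auto simp: axis_def split: if_splits)
      then show "cell z i = 0" unfolding cell_def by (rule round_unique')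
    qed
    have "norm (z - s *\<^sub>R axis i0 1) \<le> (\<Sum>i\<in>UNIV. \<bar>(z - s *\<^sub>R axis i0 1) $ i\<bar>)"
      by (rule norm_le_l1_cart)
    also have "\<dots> \<le> (\<Sum>i\<in>(UNIV :: 'd set). \<epsilon>)"
      using z by (intro sum_mono) auto
    finally have "norm (z - s *\<^sub>R axis i0 1) \<le> real CARD('d) * \<epsilon>" by simp
    then have "M * norm (z - s *\<^sub>R axis i0 1) \<le> M * (real CARD('d) * \<epsilon>)"
      using \<open>M \<ge> 0\<close> by (rule mult_left_mono)
    also have "\<dots> \<le> M * (real CARD('d) * (1 / (real CARD('d) * M + 1)))"
      using \<epsilon> \<open>M \<ge> 0\<close> by (intro mult_left_mono) auto
    also have "\<dots> \<le> 1" using pos by (simp add: divide_simps mult_ac)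
    finally have "\<bar>profile_deriv i0 N z - profile_deriv i0 N (s *\<^sub>R axis i0 1)\<bar> \<le> 1"
      using bounded_derivs_lipschitz[OF M, of z "s *\<^sub>R axis i0 1"] by linarith
    then show "1 \<le> \<bar>profile_deriv i0 N z\<bar>" unfolding D by linarith
  qed
  then show ?thesis
    using s \<epsilon> by (intro exI[of _ "s *\<^sub>R axis i0 1"] exI[of _ \<epsilon>]) (auto simp: axis_def)
qed

section \<open>Perturbed fields\<close>

text \<open>\<open>h\<close> is the cell width and \<open>p\<close> the origin of the lattice.
  \<open>a\<close> scales the slope, so that the potential has height \<open>a * h\<close>.
  \<open>aM\<close> keeps \<open>1 + slope\<close> at or above \<open>1 / 2\<close>.\<close>

locale wave_field =
  fixes i0 :: "'d::finite" and N :: nat and c a h M :: real and p :: "real^'d"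
  assumes N: "3 \<le> N" and c: "c > 0" and a: "a \<ge> 0" and h: "h > 0"
    and M: "\<And>z. \<bar>profile_deriv i0 N z\<bar> \<le> M" and aM: "a * M \<le> 1 / 2"
begin

definition rescale :: "real^'d \<Rightarrow> real^'d" where
  "rescale x = (1 / h) *\<^sub>R (x - p)"

definition potential :: "('d \<Rightarrow> int) set \<Rightarrow> real^'d \<Rightarrow> real" where
  "potential Z x = a * h * wave N Z (rescale x)"

definition slope :: "('d \<Rightarrow> int) set \<Rightarrow> real^'d \<Rightarrow> real" where
  "slope Z x = a * wave_deriv i0 N Z (rescale x)"

lemma rescale_nth: "rescale x $ i = (x $ i - p $ i) / h"
  by (simp add: rescale_def)

lemma potential_range: "0 \<le> potential Z x" "potential Z x \<le> a * h"
  using wave_range[of N Z "rescale x"] a h mult_left_mono[of "wave N Z (rescale x)" 1 "a * h"]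
  by (auto simp: potential_def)

lemma slope_le: "\<bar>slope Z x\<bar> \<le> 1 / 2"
proof -
  have "0 \<le> M" using M[of 0] by linarith
  have "\<bar>slope Z x\<bar> = a * \<bar>wave_deriv i0 N Z (rescale x)\<bar>"
    using a by (simp add: slope_def abs_mult)
  also have "\<bar>wave_deriv i0 N Z (rescale x)\<bar> \<le> M"
    using M[of "rescale x"] \<open>0 \<le> M\<close> by (simp add: wave_deriv_def)
  then have "a * \<bar>wave_deriv i0 N Z (rescale x)\<bar> \<le> a * M"
    using a by (rule mult_left_mono)
  finally show ?thesis using aM by linarith
qed

sublocale fl: axis_flow i0 c "a * h" "potential Z" "slope Z" for Z
proof
  show "c > 0" by (rule c)
  show "\<bar>slope Z x\<bar> \<le> 1 / 2" for x by (rule slope_le)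
  show "\<bar>potential Z x\<bar> \<le> a * h" for x using potential_range[of Z x] by simp
  fix x
  have "((\<lambda>s. wave N Z (rescale x + s *\<^sub>R axis i0 1)) has_real_derivative wave_deriv i0 N Z (rescale x)) (at (0 * (1 / h)))"
    using wave_has_deriv[of N Z "rescale x" i0] N by simp
  moreover have "((\<lambda>s. s * (1 / h)) has_real_derivative 1 / h) (at 0)"
    using DERIV_cmult_right[OF DERIV_ident, of "1 / h" 0] by simp
  ultimately have "((\<lambda>s. wave N Z (rescale x + (s * (1 / h)) *\<^sub>R axis i0 1)) has_real_derivative
      wave_deriv i0 N Z (rescale x) * (1 / h)) (at 0)"
    by (rule DERIV_chain2)
  then have "((\<lambda>s. a * h * wave N Z (rescale x + (s * (1 / h)) *\<^sub>R axis i0 1)) has_real_derivative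
      a * h * (wave_deriv i0 N Z (rescale x) * (1 / h))) (at 0)"
    by (rule DERIV_cmult)
  moreover have "rescale (x + s *\<^sub>R axis i0 1) = rescale x + (s * (1 / h)) *\<^sub>R axis i0 1" for s
    by (simp add: rescale_def algebra_simps)
  moreover have "a * h * (wave_deriv i0 N Z (rescale x) * (1 / h)) = slope Z x"
    using h by (simp add: slope_def)
  ultimately show "((\<lambda>s. potential Z (x + s *\<^sub>R axis i0 1)) has_real_derivative slope Z x) (at 0)"
    by (simp only: potential_def)
qed

abbreviation "vfield Z \<equiv> fl.field Z"

lemma flow_cases:
  obtains s where "flow (vfield Z) x t = x + s *\<^sub>R axis i0 1" "fl.clock Z x s = c * t + potential Z x"
  using fl.clock_surj[of Z x "c * t + potential Z x"] fl.flow_eqI[of Z x _ t] by blast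

text \<open>Both clocks show \<open>c * t\<close>, so the two positions differ by the difference of
  the potentials there.\<close>

lemma flow_diff_le:
  assumes "potential Z x = 0" "potential Z' x = 0"
  shows "norm (flow (vfield Z) x t - flow (vfield Z') x t) \<le> 2 * a * h"
proof -
  obtain s where s: "flow (vfield Z) x t = x + s *\<^sub>R axis i0 1" "fl.clock Z x s = c * t"
    using flow_cases[of Z x t] assms by auto
  obtain s' where s': "flow (vfield Z') x t = x + s' *\<^sub>R axis i0 1" "fl.clock Z' x s' = c * t"
    using flow_cases[of Z' x t] assms by auto
  have "\<bar>s - s'\<bar> \<le> 2 * a * h"
    using s(2) s'(2) potential_range[of Z "x + s *\<^sub>R axis i0 1"] potential_range[of Z' "x + s' *\<^sub>R axis i0 1"]
    by (auto simp: fl.clock_def)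
  moreover have "flow (vfield Z) x t - flow (vfield Z') x t = (s - s') *\<^sub>R axis i0 1"
    by (simp add: s s' algebra_simps)
  ultimately show ?thesis by simp
qed

text \<open>If the two potentials agreed at the point reached, both clocks would show the same there
  and the flows would coincide; so this point lies in bump \<open>k\<close>. At both ends of the
  bump in direction \<open>i0\<close> the potential vanishes and the clock shows the true position,
  so monotonicity turns the position into a time window that does not depend on
  \<open>Z\<close>.\<close>

lemma flow_diff_support:
  assumes "potential Z x = 0" "potential (insert k Z) x = 0"
    and "flow (vfield Z) x t \<noteq> flow (vfield (insert k Z)) x t"
  shows "\<And>i. i \<noteq> i0 \<Longrightarrow> \<bar>rescale x $ i - of_int (k i)\<bar> < 1 / 4"
    and "c * t \<in> {p $ i0 - x $ i0 + h * (of_int (k i0) - 1 / 4) .. p $ i0 - x $ i0 + h * (of_int (k i0) + 1 / 4)}"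
proof -
  obtain s where s: "flow (vfield Z) x t = x + s *\<^sub>R axis i0 1" "fl.clock Z x s = c * t"
    using flow_cases[of Z x t] assms by auto
  define y where "y = x + s *\<^sub>R axis i0 1"
  have "potential Z y \<noteq> potential (insert k Z) y"
  proof
    assume "potential Z y = potential (insert k Z) y"
    then have "fl.clock (insert k Z) x s = c * t + potential (insert k Z) x"
      using s assms by (simp add: fl.clock_def y_def)
    from fl.flow_eqI[OF this] show False using s assms(3) by simp
  qed
  then have cy: "cell (rescale y) = k" and py: "profile N (rescale y) \<noteq> 0"
    by (auto simp: potential_def wave_def of_bool_def split: if_splits)
  have near: "\<bar>rescale y $ i - of_int (k i)\<bar> < 1 / 4" for i
    using profile_eq_0[of "rescale y" i N] py N cy by (force simp: cell_def)
  have "rescale y $ i = rescale x $ i" if "i \<noteq> i0" for i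
    using that by (simp add: rescale_nth y_def axis_def)
  then show "\<bar>rescale x $ i - of_int (k i)\<bar> < 1 / 4" if "i \<noteq> i0" for i
    using near[of i] that by simp
  define q where "q u = p $ i0 - x $ i0 + h * (of_int (k i0) + u)" for u
  have clock_q: "fl.clock Z x (q u) = q u" if u: "\<bar>u\<bar> = 1 / 4" for u
  proof -
    have eq: "rescale (x + q u *\<^sub>R axis i0 1) $ i0 = of_int (k i0) + u"
      using h by (simp add: rescale_nth q_def)
    have "round (of_int (k i0) + u) = k i0"
      using u by (intro round_unique') auto
    then have "profile N (rescale (x + q u *\<^sub>R axis i0 1)) = 0"
      using u N by (intro profile_eq_0[where i = i0]) (simp_all add: eq)
    then show ?thesis by (simp add: fl.clock_def potential_def wave_def)
  qed
  have "rescale y $ i0 = (x $ i0 + s - p $ i0) / h" by (simp add: rescale_nth y_def)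
  then have "s = p $ i0 - x $ i0 + h * rescale y $ i0" using h by simp
  moreover have "h * (of_int (k i0) - 1 / 4) < h * rescale y $ i0" "h * rescale y $ i0 < h * (of_int (k i0) + 1 / 4)"
    by (rule mult_strict_left_mono[OF _ h], use near[of i0] in linarith)+
  ultimately have "q (- 1 / 4) < s" "s < q (1 / 4)" by (auto simp: q_def)
  then have "fl.clock Z x (q (- 1 / 4)) < fl.clock Z x s" "fl.clock Z x s < fl.clock Z x (q (1 / 4))"
    by (simp_all only: fl.clock_less_iff)
  then have "q (- 1 / 4) < c * t" "c * t < q (1 / 4)"
    using s clock_q[of "- 1 / 4"] clock_q[of "1 / 4"] by auto
  then show "c * t \<in> {p $ i0 - x $ i0 + h * (of_int (k i0) - 1 / 4) .. p $ i0 - x $ i0 + h * (of_int (k i0) + 1 / 4)}"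
    by (auto simp: q_def)
qed

text \<open>The tube point belongs to the time at which the trajectory has the
  \<open>i0\<close>-coordinate of \<open>y\<close>; what remains is orthogonal to the field. This
  happens at a clock reading of at most \<open>2 + a * h \<le> 3\<close>.\<close>

lemma mem_tube:
  assumes "y $ i0 \<in> {0..1}" "x $ i0 = -1" "potential Z x = 0" "3 \<le> c * T" "a * h \<le> 1"
    and "norm (y - x - (y $ i0 + 1) *\<^sub>R axis i0 1) \<le> \<delta>"
  shows "y \<in> tube T (flow (vfield Z) x) \<delta>"
proof -
  define s where "s = y $ i0 + 1"
  define t where "t = fl.clock Z x s / c"
  have clock: "0 \<le> fl.clock Z x s" "fl.clock Z x s \<le> 3"
    using assms(1,5) potential_range[of Z "x + s *\<^sub>R axis i0 1"] by (auto simp: fl.clock_def s_def)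
  have ct: "c * t = fl.clock Z x s" using c by (simp add: t_def)
  have "T > 0" using assms(4) c zero_less_mult_pos[of c T] by linarith
  have t: "t \<in> {0..T}"
    using clock c assms(4) by (auto simp: t_def field_simps)
  have flow: "flow (vfield Z) x t = x + s *\<^sub>R axis i0 1"
    by (rule fl.flow_eqI) (simp add: ct assms(3))
  have vd: "vector_derivative (flow (vfield Z) x) (at t within {0..T}) = vfield Z (flow (vfield Z) x t)"
    by (rule fl.vector_derivative_flow[OF \<open>T > 0\<close> t])
  define v where "v = y - x - s *\<^sub>R axis i0 1"
  have "y = flow (vfield Z) x t + v" by (simp add: flow v_def)
  moreover have "vfield Z (flow (vfield Z) x t) \<noteq> 0"
    using c fl.one_plus_ge[of Z "flow (vfield Z) x t"] by (auto simp: fl.field_def)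
  moreover have "v $ i0 = 0" by (simp add: v_def s_def assms(2))
  then have "v \<bullet> vfield Z (flow (vfield Z) x t) = 0"
    by (simp add: fl.field_def inner_axis)
  moreover have "norm v \<le> \<delta>" using assms(6) by (simp add: v_def s_def)
  ultimately show ?thesis
    unfolding tube_def by (intro UN_I[OF t] CollectI exI[of _ v]) (simp add: vd)
qed

lemma vfield_off_cells: "cell (rescale x) \<notin> Z \<Longrightarrow> vfield Z x = c *\<^sub>R axis i0 1"
  by (simp add: fl.field_def slope_def wave_deriv_def)

text \<open>Without bump \<open>k\<close> the field has speed \<open>c\<close> there; with slope
  \<open>a * D\<close> the speed changes by \<open>c * a * \<bar>D\<bar> / (1 + a * D)\<close>, with
  a denominator of at most \<open>2\<close>. Periodicity reduces cell \<open>k\<close> to cell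
  \<open>0\<close>.\<close>

lemma vfield_insert_diff:
  assumes "k \<notin> Z" "cell (rescale x - lattice_point k) = (\<lambda>_. 0)" "1 \<le> \<bar>profile_deriv i0 N (rescale x - lattice_point k)\<bar>"
  shows "a * c / 2 \<le> norm (vfield (insert k Z) x - vfield Z x)" "cell (rescale x) = k"
proof -
  show cell: "cell (rescale x) = k"
  proof
    fix i
    have "round (rescale x $ i - of_int (k i)) = 0"
      using fun_cong[OF assms(2), of i] by (simp add: cell_def lattice_point_def)
    moreover have "rescale x $ i - of_int (k i) + 1 / 2 = (rescale x $ i + 1 / 2) - of_int (k i)" by simp
    ultimately show "cell (rescale x) i = k i"
      unfolding cell_def round_def by (simp only: floor_diff_of_int)
  qed
  define D where "D = profile_deriv i0 N (rescale x)"
  have "\<bar>D\<bar> \<ge> 1"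
    using assms(3) N profile_deriv_periodic[of N i0 "rescale x - lattice_point k" k] by (simp add: D_def)
  have slope: "slope (insert k Z) x = a * D"
    using cell by (simp add: slope_def wave_deriv_def D_def)
  have aD: "\<bar>a * D\<bar> \<le> 1 / 2" using slope_le[of "insert k Z" x] by (simp add: slope)
  then have pos: "0 < 1 + a * D" "1 + a * D \<le> 2" by (auto simp: abs_le_iff)
  have "vfield (insert k Z) x - vfield Z x = (c / (1 + a * D) - c) *\<^sub>R axis i0 1"
    using vfield_off_cells[of x Z] cell assms(1) by (simp add: fl.field_def slope algebra_simps)
  then have "norm (vfield (insert k Z) x - vfield Z x) = \<bar>c / (1 + a * D) - c\<bar>" by simp
  also have "c / (1 + a * D) - c = - (c * (a * D) / (1 + a * D))"
    using pos by (simp add: field_simps)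
  also have "\<bar>\<dots>\<bar> = c * (a * \<bar>D\<bar>) / (1 + a * D)"
    using pos c a by (simp add: abs_mult)
  also have "c * (a * \<bar>D\<bar>) / (1 + a * D) \<ge> c * (a * 1) / 2"
    using pos c a \<open>\<bar>D\<bar> \<ge> 1\<close> by (intro frac_le mult_left_mono mult_nonneg_nonneg) auto
  finally show "a * c / 2 \<le> norm (vfield (insert k Z) x - vfield Z x)" by (simp add: mult.commute)
qed

end

section \<open>Testing lower bounds\<close>

lemma hard_to_distinguish_mono:
  assumes "hard_to_distinguish q t P Q" "q' \<le> q"
  shows "hard_to_distinguish q' t P Q"
  using assms unfolding hard_to_distinguish_def by (meson ennreal_leI order_trans)

text \<open>Integrating \<open>u + v\<close> over \<open>G\<close> under \<open>P\<close> gives at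
  least \<open>q * s\<close>; passing from \<open>P\<close> to \<open>Q\<close> in the integral of
  \<open>v\<close> costs the factor \<open>t\<close>.\<close>

lemma two_point_bound:
  assumes "hard_to_distinguish q t P Q" "1 \<le> t" "0 \<le> s"
    and u: "u \<in> borel_measurable P" and v: "v \<in> borel_measurable P"
    and uv: "\<And>y. ennreal s \<le> u y + v y"
  shows "ennreal (q * s / t) \<le> (\<integral>\<^sup>+y. u y \<partial>P) + (\<integral>\<^sup>+y. v y \<partial>Q)"
proof -
  obtain G where G: "G \<in> sets P" "ennreal q \<le> emeasure P G"
    "(\<integral>\<^sup>+y. v y * indicator G y \<partial>P) \<le> ennreal t * (\<integral>\<^sup>+y. v y \<partial>Q)"
    using assms(1) v unfolding hard_to_distinguish_def by blast
  have "ennreal (q * s) = ennreal s * ennreal q"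
    using assms(3) by (simp add: ennreal_mult'' mult.commute)
  also have "\<dots> \<le> ennreal s * emeasure P G"
    using G(2) by (intro mult_left_mono) auto
  also have "\<dots> = (\<integral>\<^sup>+y. ennreal s * indicator G y \<partial>P)"
    using G(1) by (simp add: nn_integral_cmult_indicator)
  also have "\<dots> \<le> (\<integral>\<^sup>+y. u y * indicator G y + v y * indicator G y \<partial>P)"
    using uv by (intro nn_integral_mono) (auto simp: indicator_def)
  also have "\<dots> = (\<integral>\<^sup>+y. u y * indicator G y \<partial>P) + (\<integral>\<^sup>+y. v y * indicator G y \<partial>P)"
    using u v G(1) by (intro nn_integral_add) auto
  also have "\<dots> \<le> ennreal t * (\<integral>\<^sup>+y. u y \<partial>P) + ennreal t * (\<integral>\<^sup>+y. v y \<partial>Q)"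
  proof (intro add_mono G(3))
    have "(\<integral>\<^sup>+y. u y * indicator G y \<partial>P) \<le> 1 * (\<integral>\<^sup>+y. u y \<partial>P)"
      by (auto intro!: nn_integral_mono simp: indicator_def)
    also have "\<dots> \<le> ennreal t * (\<integral>\<^sup>+y. u y \<partial>P)"
      using assms(2) by (intro mult_right_mono) (auto simp: one_ennreal_def[symmetric] simp flip: ennreal_1)
    finally show "(\<integral>\<^sup>+y. u y * indicator G y \<partial>P) \<le> ennreal t * (\<integral>\<^sup>+y. u y \<partial>P)" .
  qed
  also have "\<dots> = ((\<integral>\<^sup>+y. u y \<partial>P) + (\<integral>\<^sup>+y. v y \<partial>Q)) * ennreal t"
    by (simp add: algebra_simps)
  finally have "ennreal (q * s) / ennreal t \<le> (\<integral>\<^sup>+y. u y \<partial>P) + (\<integral>\<^sup>+y. v y \<partial>Q)"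
    using assms(2) by (intro divide_le_posI_ennreal) (auto simp: mult.commute)
  moreover have "ennreal (q * s / t) \<le> ennreal (q * s) / ennreal t"
  proof (cases "0 \<le> q * s")
    case True
    then show ?thesis using assms(2) by (simp add: divide_ennreal)
  next
    case False
    then have "q * s / t \<le> 0" using assms(2) by (simp add: divide_nonpos_nonneg)
    then show ?thesis by (simp add: ennreal_neg)
  qed
  ultimately show ?thesis by (rule order_trans[rotated])
qed

text \<open>A test that tells the \<open>P k\<close> apart would have, under \<open>Q\<close>, at least \<open>card S\<close> disjoint rejection
  regions of probability at least \<open>1 / (4 * t)\<close> each.\<close>

lemma many_hypotheses_bound:
  assumes S: "finite S" "t \<le> real (card S)" "S \<noteq> {}" "t > 0"
    and hard: "\<And>k. k \<in> S \<Longrightarrow> hard_to_distinguish (1 / 2) t (P k) Q"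
    and A: "\<And>k. k \<in> S \<Longrightarrow> A k \<in> sets Q" and "s > 0"
    and Q: "\<And>y k. k \<in> S \<Longrightarrow> y \<in> A k \<Longrightarrow> ennreal s \<le> m y" "(\<integral>\<^sup>+y. m y \<partial>Q) \<le> R"
    and P: "\<And>y k. k \<in> S \<Longrightarrow> y \<notin> A k \<Longrightarrow> ennreal s \<le> l k y"
      "\<And>y k j. k \<in> S \<Longrightarrow> j \<in> S \<Longrightarrow> j \<noteq> k \<Longrightarrow> y \<in> A j \<Longrightarrow> ennreal s \<le> l k y"
      "\<And>k. k \<in> S \<Longrightarrow> (\<integral>\<^sup>+y. l k y \<partial>P k) \<le> R"
  shows "ennreal (s / 4) \<le> R"
proof (rule ccontr)
  assume "\<not> ennreal (s / 4) \<le> R"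
  then have R: "R < ennreal (s / 4)" by simp
  then obtain r where r: "R = ennreal r" "0 \<le> r" "r < s / 4"
    using \<open>s > 0\<close> by (cases R) (auto simp: ennreal_less_iff)
  obtain k0 where k0: "k0 \<in> S" using S by blast
  interpret Q: prob_space Q using hard[OF k0] by (simp add: hard_to_distinguish_def)
  \<comment> \<open>Removing overlaps makes the regions disjoint. This is harmless: a point of
    \<open>A k\<close> that is removed lies in some other \<open>A j\<close>, where hypothesis
    \<open>k\<close> has a large loss as well.\<close>
  define B where "B k = A k - (\<Union>j\<in>S - {k}. A j)" for k
  have B: "B k \<in> sets Q" if "k \<in> S" for k
    unfolding B_def using that A S(1) by (intro sets.Diff sets.finite_UN) auto
  have disj: "disjoint_family_on B S"
    by (auto simp: disjoint_family_on_def B_def)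
  have Q_le: "s * measure Q (\<Union>k\<in>S. B k) \<le> r"
  proof -
    have "ennreal (s * measure Q (\<Union>k\<in>S. B k)) = (\<integral>\<^sup>+y. ennreal s * indicator (\<Union>k\<in>S. B k) y \<partial>Q)"
      using B S(1) \<open>s > 0\<close>
      by (subst nn_integral_cmult_indicator) (auto simp: Q.emeasure_eq_measure ennreal_mult)
    also have "\<dots> \<le> (\<integral>\<^sup>+y. m y \<partial>Q)"
      by (intro nn_integral_mono) (auto simp: indicator_def B_def intro: Q(1))
    also have "\<dots> \<le> ennreal r" using Q(2) r by simp
    finally show ?thesis using r by simp
  qed
  have "1 / 4 \<le> t * measure Q (B k)" if k: "k \<in> S" for k
  proof -
    interpret P: prob_space "P k" using hard[OF k] by (simp add: hard_to_distinguish_def)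
    have sets: "sets Q = sets (P k)" using hard[OF k] by (simp add: hard_to_distinguish_def)
    then have space: "space Q = space (P k)" by (rule sets_eq_imp_space_eq)
    have Bk: "B k \<in> sets (P k)" using B[OF k] sets by simp
    obtain G where G: "G \<in> sets (P k)" "ennreal (1 / 2) \<le> emeasure (P k) G"
      "\<And>g. g \<in> borel_measurable (P k) \<Longrightarrow> (\<integral>\<^sup>+y. g y * indicator G y \<partial>P k) \<le> ennreal t * (\<integral>\<^sup>+y. g y \<partial>Q)"
      using hard[OF k] unfolding hard_to_distinguish_def by blast
    have "ennreal (s * measure (P k) (space (P k) - B k)) = (\<integral>\<^sup>+y. ennreal s * indicator (space (P k) - B k) y \<partial>P k)"
      using Bk \<open>s > 0\<close> by (subst nn_integral_cmult_indicator) (auto simp: P.emeasure_eq_measure ennreal_mult)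
    also have "\<dots> \<le> (\<integral>\<^sup>+y. l k y \<partial>P k)"
      using k by (intro nn_integral_mono) (auto simp: indicator_def B_def intro: P(1,2))
    also have "\<dots> \<le> ennreal r" using P(3)[OF k] r by simp
    finally have "ennreal (s * measure (P k) (space (P k) - B k)) \<le> ennreal r" .
    then have "s * measure (P k) (space (P k) - B k) \<le> r"
      using r by simp
    also have "r < s * (1 / 4)" using r(3) by simp
    finally have "s * measure (P k) (space (P k) - B k) < s * (1 / 4)" .
    \<comment> \<open>The loss is at least \<open>s\<close> outside \<open>B k\<close> and has mean
      below \<open>s / 4\<close>, so \<open>B k\<close> misses less than a quarter of the mass.
      \<open>G\<close> has at least one half, which leaves a quarter in common.\<close>
    then have 1: "measure (P k) (space (P k) - B k) < 1 / 4"
      using \<open>s > 0\<close> by (simp only: mult_less_cancel_left_pos)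
    have 2: "1 / 2 \<le> measure (P k) G" using G(2) unfolding P.emeasure_eq_measure by (simp only: ennreal_le_iff measure_nonneg)
    have "measure (P k) G \<le> measure (P k) (B k \<inter> G \<union> (space (P k) - B k))"
      using Bk G(1) sets.sets_into_space[OF G(1)] by (intro P.finite_measure_mono) auto
    also have "\<dots> \<le> measure (P k) (B k \<inter> G) + measure (P k) (space (P k) - B k)"
      using Bk G(1) by (intro measure_Un_le) auto
    finally have 3: "1 / 4 \<le> measure (P k) (B k \<inter> G)" using 1 2 by linarith
    have "emeasure (P k) (B k \<inter> G) = (\<integral>\<^sup>+y. indicator (B k) y * indicator G y \<partial>P k)"
      using Bk G(1) by (simp add: nn_integral_indicator[symmetric] indicator_inter_arith)
    also have "\<dots> \<le> ennreal t * (\<integral>\<^sup>+y. indicator (B k) y \<partial>Q)"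
      using Bk by (intro G(3)) auto
    also have "\<dots> = ennreal (t * measure Q (B k))"
      using B[OF k] \<open>t > 0\<close> by (simp add: Q.emeasure_eq_measure ennreal_mult)
    finally have "measure (P k) (B k \<inter> G) \<le> t * measure Q (B k)"
      using \<open>t > 0\<close> by (simp add: P.emeasure_eq_measure)
    with 3 show ?thesis by linarith
  qed
  then have "(\<Sum>k\<in>S. 1 / 4) \<le> (\<Sum>k\<in>S. t * measure Q (B k))" by (rule sum_mono)
  also have "\<dots> = t * measure Q (\<Union>k\<in>S. B k)"
    using B disj S(1) by (subst Q.finite_measure_finite_Union) (auto simp: sum_distrib_left)
  finally have "real (card S) / 4 \<le> t * measure Q (\<Union>k\<in>S. B k)" by simp
  then have "t / 4 \<le> t * measure Q (\<Union>k\<in>S. B k)" using S(2) by linarith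
  then have "1 / 4 \<le> measure Q (\<Union>k\<in>S. B k)" using S(4) by simp
  then have "s * (1 / 4) \<le> s * measure Q (\<Union>k\<in>S. B k)"
    using \<open>s > 0\<close> by (intro mult_left_mono) auto
  then show False using Q_le r(3) by linarith
qed

section \<open>The law of the observations\<close>

lemma finite_obs_index: "finite (obs_index tss)"
  by (auto simp: obs_index_def)

lemma prob_space_shift:
  fixes P :: "(real^'d::finite) measure"
  assumes "prob_space P" "sets P = sets borel"
  shows "prob_space (shift v P)"
  unfolding shift_def
proof (rule prob_space.prob_space_distr[OF assms(1)])
  have "(\<lambda>e. v + e) \<in> borel \<rightarrow>\<^sub>M borel" by measurable
  then show "(\<lambda>e. v + e) \<in> P \<rightarrow>\<^sub>M borel" using assms(2) by (simp cong: measurable_cong_sets)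
qed

text \<open>Shifted components remain independent, and it suffices to compare rectangles. As a
  product of shifted noise laws the model fits \<open>product_hard_to_distinguish\<close>.\<close>

lemma obs_law_eq_PiM:
  fixes P :: "(real^'d::finite) measure"
  assumes P: "prob_space P" "sets P = sets borel"
  shows "obs_law P D (f, xs, Ts) =
    (\<Pi>\<^sub>M k\<in>obs_index (D Ts). shift (flow f (xs ! fst k) (D Ts ! fst k ! snd k)) P)"
proof -
  define I where "I = obs_index (D Ts)"
  define u where "u k = flow f (xs ! fst k) (D Ts ! fst k ! snd k)" for k
  have I: "finite I" by (simp add: I_def finite_obs_index)
  interpret N: product_prob_space "\<lambda>k. shift (u k) P"
    by (rule product_prob_spaceI) (rule prob_space_shift[OF P])
  interpret P: product_prob_space "\<lambda>k :: nat \<times> nat. P"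
    by (rule product_prob_spaceI) (rule P)
  have [measurable_cong]: "sets P = sets borel" by (rule P)
  let ?g = "\<lambda>\<epsilon>. \<lambda>k\<in>I. u k + \<epsilon> k"
  have g[measurable]: "?g \<in> (\<Pi>\<^sub>M k\<in>I. P) \<rightarrow>\<^sub>M (\<Pi>\<^sub>M k\<in>I. borel)"
    by measurable
  have "distr (\<Pi>\<^sub>M k\<in>I. P) (\<Pi>\<^sub>M k\<in>I. borel) ?g = (\<Pi>\<^sub>M k\<in>I. shift (u k) P)"
  proof (rule N.PiM_eqI)
    show "sets (distr (\<Pi>\<^sub>M k\<in>I. P) (\<Pi>\<^sub>M k\<in>I. borel) ?g) = sets (\<Pi>\<^sub>M k\<in>I. shift (u k) P)"
      unfolding sets_distr by (intro sets_PiM_cong) (auto simp: shift_def)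
    fix A assume "\<And>i. i \<in> I \<Longrightarrow> A i \<in> sets (shift (u i) P)"
    then have A: "\<And>i. i \<in> I \<Longrightarrow> A i \<in> sets borel" by (simp add: shift_def)
    have A': "(\<lambda>e. u i + e) -` A i \<in> sets P" if "i \<in> I" for i
    proof -
      have "(\<lambda>e. u i + e) \<in> borel \<rightarrow>\<^sub>M borel" by measurable
      from measurable_sets[OF this A[OF that]] show ?thesis using P(2) by simp
    qed
    have "emeasure (distr (\<Pi>\<^sub>M k\<in>I. P) (\<Pi>\<^sub>M k\<in>I. borel) ?g) (Pi\<^sub>E I A) =
        emeasure (\<Pi>\<^sub>M k\<in>I. P) (?g -` (Pi\<^sub>E I A) \<inter> space (\<Pi>\<^sub>M k\<in>I. P))"
      using A I by (intro emeasure_distr g sets_PiM_I_finite) auto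
    also have "?g -` (Pi\<^sub>E I A) \<inter> space (\<Pi>\<^sub>M k\<in>I. P) = (\<Pi>\<^sub>E i\<in>I. (\<lambda>e. u i + e) -` A i)"
      using sets_eq_imp_space_eq[OF P(2)] by (auto simp: space_PiM PiE_iff)
    also have "emeasure (\<Pi>\<^sub>M k\<in>I. P) (\<Pi>\<^sub>E i\<in>I. (\<lambda>e. u i + e) -` A i) = (\<Prod>i\<in>I. emeasure P ((\<lambda>e. u i + e) -` A i))"
      using A' I by (intro P.emeasure_PiM) auto
    also have "\<dots> = (\<Prod>i\<in>I. emeasure (shift (u i) P) (A i))"
    proof (rule prod.cong[OF refl])
      fix i assume "i \<in> I"
      have "(\<lambda>e. u i + e) \<in> P \<rightarrow>\<^sub>M borel" by measurable
      then show "emeasure P ((\<lambda>e. u i + e) -` A i) = emeasure (shift (u i) P) (A i)"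
        using A[OF \<open>i \<in> I\<close>] sets_eq_imp_space_eq[OF P(2)] by (simp add: shift_def emeasure_distr)
    qed
    finally show "emeasure (distr (\<Pi>\<^sub>M k\<in>I. P) (\<Pi>\<^sub>M k\<in>I. borel) ?g) (Pi\<^sub>E I A) =
        (\<Prod>i\<in>I. emeasure (shift (u i) P) (A i))" .
  qed (rule I)
  moreover have "?g = (\<lambda>\<epsilon>. \<lambda>(j, i)\<in>I. flow f (xs ! j) (D Ts ! j ! i) + \<epsilon> (j, i))"
    by (auto simp: restrict_def u_def fun_eq_iff)
  ultimately show ?thesis
    by (simp add: obs_law_def I_def u_def)
qed

lemma sets_obs_law: "sets (obs_law P D (f, xs, Ts)) = sets (obs_space (D Ts))"
  by (simp add: obs_law_def)

text \<open>Divergences add up over the observations, and the noise assumption bounds each by a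
  multiple of the squared displacement.\<close>

lemma obs_law_hard_to_distinguish:
  fixes P :: "(real^'d::finite) measure"
  assumes P: "noise_law Cn P" and "b > 0"
    and \<kappa>: "Cn * (\<Sum>(j, i)\<in>obs_index (D Ts).
        (norm (flow f (xs ! j) (D Ts ! j ! i) - flow g (xs ! j) (D Ts ! j ! i)))\<^sup>2) \<le> \<kappa>"
  shows "hard_to_distinguish (1 - (\<kappa> + 1) / b) (exp b) (obs_law P D (f, xs, Ts)) (obs_law P D (g, xs, Ts))"
proof -
  have P': "prob_space P" "sets P = sets borel"
    and KL: "\<And>v1 v2. KL (shift v1 P) (shift v2 P) \<le> ereal (Cn * (norm (v1 - v2))\<^sup>2)"
    using P by (auto simp: noise_law_def)
  define u where "u f' k = flow f' (xs ! fst k) (D Ts ! fst k ! snd k)" for f' k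
  have "hard_to_distinguish (1 - ((\<Sum>k\<in>obs_index (D Ts). Cn * (norm (u f k - u g k))\<^sup>2) + 1) / b) (exp b)
      (\<Pi>\<^sub>M k\<in>obs_index (D Ts). shift (u f k) P) (\<Pi>\<^sub>M k\<in>obs_index (D Ts). shift (u g k) P)"
  proof (rule product_hard_to_distinguish)
    show "sets (shift (u f k) P) = sets (shift (u g k) P)" for k by (simp add: shift_def)
  qed (rule finite_obs_index prob_space_shift[OF P'] KL \<open>b > 0\<close>)+
  moreover have "(\<Sum>k\<in>obs_index (D Ts). Cn * (norm (u f k - u g k))\<^sup>2) \<le> \<kappa>"
    using \<kappa> by (simp add: u_def case_prod_beta sum_distrib_left)
  then have "1 - (\<kappa> + 1) / b \<le> 1 - ((\<Sum>k\<in>obs_index (D Ts). Cn * (norm (u f k - u g k))\<^sup>2) + 1) / b"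
    using \<open>b > 0\<close> by (simp add: divide_right_mono)
  ultimately show ?thesis
    unfolding obs_law_eq_PiM[OF P'] u_def by (rule hard_to_distinguish_mono)
qed

section \<open>Lines covering the cube\<close>

lemma card_ints_in_interval:
  fixes S :: "int set"
  assumes "\<And>u. u \<in> S \<Longrightarrow> lo < real_of_int u \<and> real_of_int u < lo + len" "len \<ge> 0"
  shows "finite S" "real (card S) \<le> len + 1"
proof -
  have sub: "S \<subseteq> {\<lfloor>lo\<rfloor> + 1..\<lceil>lo + len\<rceil> - 1}"
  proof
    fix u assume "u \<in> S"
    then have "\<lfloor>lo\<rfloor> < u" "u < \<lceil>lo + len\<rceil>"
      using assms(1)[of u] by (auto simp: floor_less_iff less_ceiling_iff)
    then show "u \<in> {\<lfloor>lo\<rfloor> + 1..\<lceil>lo + len\<rceil> - 1}" by simp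
  qed
  then show "finite S" by (rule finite_subset) simp
  have "card S \<le> card {\<lfloor>lo\<rfloor> + 1..\<lceil>lo + len\<rceil> - 1}" using sub by (intro card_mono) auto
  also have "\<dots> = nat (\<lceil>lo + len\<rceil> - 1 - \<lfloor>lo\<rfloor>)" by simp
  finally have "real (card S) \<le> real (nat (\<lceil>lo + len\<rceil> - 1 - \<lfloor>lo\<rfloor>))" by simp
  also have "\<dots> \<le> len + 1" using assms(2) by linarith
  finally show "real (card S) \<le> len + 1" .
qed

text \<open>The lines start at \<open>-1\<close> in direction \<open>i0\<close>; their other coordinates lie halfway between the points of the
  lattice of width \<open>w\<close> around \<open>p\<close>.  For \<open>w = h\<close> they therefore miss all the bumps.\<close>

definition line_start :: "'d::finite \<Rightarrow> real^'d \<Rightarrow> real \<Rightarrow> ('d \<Rightarrow> int) \<Rightarrow> real^'d" where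
  "line_start i0 p w k = (\<chi> i. if i = i0 then -1 else p $ i + w * (of_int (k i) + 1 / 2))"

text \<open>\<open>line_start\<close> ignores the entry at \<open>i0\<close>, which is pinned to
  \<open>0\<close> so that each line is counted once. The range reaches the whole cube when the
  transversal coordinates of \<open>p\<close> lie in \<open>{0..1}\<close>.\<close>

definition line_index :: "'d::finite \<Rightarrow> real \<Rightarrow> ('d \<Rightarrow> int) set" where
  "line_index i0 w = PiE UNIV (\<lambda>i. if i = i0 then {0} else {- (\<lceil>1 / w\<rceil> + 1)..\<lceil>1 / w\<rceil> + 1})"

lemma finite_line_index: "finite (line_index i0 w)"
  unfolding line_index_def by (rule finite_PiE) auto

lemma card_line_index:
  fixes i0 :: "'d::finite"
  assumes "0 < w" "w \<le> 1"
  shows "real (card (line_index i0 w)) \<le> (7 / w) ^ (CARD('d) - 1)" "line_index i0 w \<noteq> {}"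
proof -
  define K where "K = \<lceil>1 / w\<rceil> + 1"
  have "1 \<le> 1 / w" using assms by simp
  then have K: "1 \<le> K" by (simp add: K_def)
  have "real_of_int K \<le> 1 / w + 2" unfolding K_def by linarith
  \<comment> \<open>\<open>2 * (1 / w + 2) + 1 = 2 / w + 5\<close>, and
    \<open>5 \<le> 5 / w\<close>.\<close>
  then have K7: "real_of_int (2 * K + 1) \<le> 7 / w" 
  proof -
    have "7 / w = 7 * (1 / w)" by simp
    then show ?thesis using \<open>real_of_int K \<le> 1 / w + 2\<close> \<open>1 \<le> 1 / w\<close> by linarith
  qed
  have "card (line_index i0 w) = (\<Prod>i\<in>UNIV. card (if i = i0 then {0::int} else {-K..K}))"
    unfolding line_index_def K_def by (simp add: card_PiE)
  also have "\<dots> = (\<Prod>i\<in>UNIV - {i0}. card (if i = i0 then {0::int} else {-K..K}))"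
    by (subst prod.remove[of UNIV i0]) auto
  also have "\<dots> = (\<Prod>i\<in>UNIV - {i0}. nat (2 * K + 1))" by (intro prod.cong) auto
  also have "\<dots> = nat (2 * K + 1) ^ (CARD('d) - 1)" by (simp add: card_Diff_singleton)
  finally have card: "card (line_index i0 w) = nat (2 * K + 1) ^ (CARD('d) - 1)" .
  have "real (nat (2 * K + 1)) \<le> 7 / w" using K7 K by simp
  then show "real (card (line_index i0 w)) \<le> (7 / w) ^ (CARD('d) - 1)"
    unfolding card of_nat_power by (intro power_mono) auto
  have "card (line_index i0 w) > 0" unfolding card using K by simp
  then show "line_index i0 w \<noteq> {}" by auto
qed

lemma line_index_covers:
  fixes y p :: "real^'d::finite"
  assumes w: "0 < w" and y: "y \<in> unit_cube" and p: "\<And>i. i \<noteq> i0 \<Longrightarrow> p $ i \<in> {0..1}"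
  shows "\<exists>k\<in>line_index i0 w. norm (y - line_start i0 p w k - (y $ i0 + 1) *\<^sub>R axis i0 1) \<le> real CARD('d) * w"
proof -
  \<comment> \<open>The line with this index runs through the middle of the lattice cell of
    \<open>y\<close>.\<close>
  define k where "k i = (if i = i0 then 0 else \<lfloor>(y $ i - p $ i) / w\<rfloor>)" for i
  have "k i \<in> {- (\<lceil>1 / w\<rceil> + 1)..\<lceil>1 / w\<rceil> + 1}" if "i \<noteq> i0" for i
  proof -
    have "0 \<le> y $ i" "y $ i \<le> 1" "0 \<le> p $ i" "p $ i \<le> 1"
      using y p[OF that] by (auto simp: unit_cube_def)
    then have "\<bar>y $ i - p $ i\<bar> \<le> 1" by linarith
    then have "\<bar>y $ i - p $ i\<bar> / w \<le> 1 / w" using w by (intro divide_right_mono) auto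
    moreover have "\<bar>(y $ i - p $ i) / w\<bar> = \<bar>y $ i - p $ i\<bar> / w" using w by (simp only: abs_divide abs_of_pos)
    ultimately have "\<bar>(y $ i - p $ i) / w\<bar> \<le> 1 / w" by (simp only:)
    then have "- (1 / w) \<le> (y $ i - p $ i) / w" "(y $ i - p $ i) / w \<le> 1 / w" by linarith+
    then have "- (\<lceil>1 / w\<rceil> + 1) \<le> \<lfloor>(y $ i - p $ i) / w\<rfloor>" "\<lfloor>(y $ i - p $ i) / w\<rfloor> \<le> \<lceil>1 / w\<rceil> + 1"
      by linarith+
    then show ?thesis unfolding k_def using that by simp
  qed
  then have k: "k \<in> line_index i0 w"
    unfolding line_index_def by (auto simp: PiE_UNIV_domain k_def)
  define v where "v = y - line_start i0 p w k - (y $ i0 + 1) *\<^sub>R axis i0 1"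
  have "\<bar>v $ i\<bar> \<le> w" for i
  proof (cases "i = i0")
    case True
    then show ?thesis using w by (simp add: v_def line_start_def)
  next
    case False
    define r where "r = (y $ i - p $ i) / w"
    have r: "y $ i - p $ i = w * r" using w by (simp add: r_def)
    have "v $ i = (y $ i - p $ i) - w * (of_int \<lfloor>r\<rfloor> + 1 / 2)"
      using False by (simp add: v_def line_start_def k_def axis_def r_def)
    also have "\<dots> = w * (r - of_int \<lfloor>r\<rfloor> - 1 / 2)" unfolding r by (simp add: algebra_simps)
    finally have "\<bar>v $ i\<bar> = w * \<bar>r - of_int \<lfloor>r\<rfloor> - 1 / 2\<bar>" using w by (simp add: abs_mult)
    also have "\<dots> \<le> w * 1"
    proof (rule mult_left_mono)
      show "\<bar>r - of_int \<lfloor>r\<rfloor> - 1 / 2\<bar> \<le> 1" by linarith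
    qed (use w in simp)
    finally show ?thesis by simp
  qed
  then have "(\<Sum>i\<in>UNIV. \<bar>v $ i\<bar>) \<le> (\<Sum>i\<in>(UNIV :: 'd set). w)" by (intro sum_mono)
  then have "norm v \<le> real CARD('d) * w" using norm_le_l1_cart[of v] by simp
  then show ?thesis using k unfolding v_def by blast
qed

text \<open>The bumps lie between the starting plane \<open>-1\<close> and the plane
  \<open>2\<close>: trajectories start with potential \<open>0\<close> and have left all bumps once
  the clock has advanced by \<open>3\<close>.\<close>

definition admissible :: "'d::finite \<Rightarrow> real \<Rightarrow> real^'d \<Rightarrow> ('d \<Rightarrow> int) set \<Rightarrow> bool" where
  "admissible i0 h p Z \<longleftrightarrow> (\<forall>k\<in>Z. -1 \<le> p $ i0 + h * (of_int (k i0) - 1 / 4) \<and> p $ i0 + h * (of_int (k i0) + 1 / 4) \<le> 2)"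

section \<open>Lines that meet a bump\<close>

context wave_field
begin

definition hits :: "real \<Rightarrow> ('d \<Rightarrow> int) \<Rightarrow> ('d \<Rightarrow> int) set" where
  "hits w k = {l \<in> line_index i0 w. \<forall>i. i \<noteq> i0 \<longrightarrow> \<bar>rescale (line_start i0 p w l) $ i - of_int (k i)\<bar> < 1 / 4}"

text \<open>In each transversal coordinate the lines closer than \<open>h / 4\<close> to the centre
  have indices in an open interval of length \<open>h / (2 * w)\<close>. It contains at most
  \<open>h / (2 * w) + 1 \<le> 2 * h / w\<close> integers, because \<open>w \<le> h\<close>.\<close>

lemma card_hits:
  assumes w: "0 < w" "w \<le> h"
  shows "real (card (hits w k)) \<le> (2 * h / w) ^ (CARD('d) - 1)"
proof -
  define S where "S i = (if i = i0 then {0} else {u. \<bar>(w * (of_int u + 1 / 2)) / h - of_int (k i)\<bar> < 1 / 4})" for i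
  have S: "finite (S i)" "real (card (S i)) \<le> 2 * h / w" if "i \<noteq> i0" for i
  proof -
    define lo where "lo = (of_int (k i) - 1 / 4) * h / w - 1 / 2"
    have *: "lo < real_of_int u \<and> real_of_int u < lo + h / (2 * w)" if "u \<in> S i" for u
    proof -
      define q where "q = of_int u + (1 / 2 :: real)"
      have "\<bar>w * q / h - of_int (k i)\<bar> < 1 / 4"
        using that \<open>i \<noteq> i0\<close> by (simp add: S_def q_def)
      then have 1: "of_int (k i) - 1 / 4 < w * q / h" "w * q / h < of_int (k i) + 1 / 4"
        by linarith+
      have "(of_int (k i) - 1 / 4) * h < w * q" "w * q < (of_int (k i) + 1 / 4) * h"
        using 1 h by (simp_all only: pos_less_divide_eq pos_divide_less_eq)
      then have "(of_int (k i) - 1 / 4) * h / w < q" "q < (of_int (k i) + 1 / 4) * h / w"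
        using w by (auto simp: pos_less_divide_eq pos_divide_less_eq mult.commute)
      moreover have "(of_int (k i) + 1 / 4) * h / w = (of_int (k i) - 1 / 4) * h / w + h / (2 * w)"
        using w by (simp add: field_simps)
      ultimately show ?thesis unfolding lo_def q_def by linarith
    qed
    have len: "h / (2 * w) \<ge> 0" using h w by simp
    show "finite (S i)" by (rule card_ints_in_interval[OF * len])
    have "real (card (S i)) \<le> h / (2 * w) + 1" by (rule card_ints_in_interval[OF * len])
    also have "\<dots> \<le> 2 * h / w" using w h by (simp add: field_simps)
    finally show "real (card (S i)) \<le> 2 * h / w" .
  qed
  have fin: "finite (PiE UNIV S)"
  proof (rule finite_PiE)
    show "finite (S i)" for i using S(1)[of i] by (cases "i = i0") (auto simp: S_def)
  qed simp
  have "hits w k \<subseteq> PiE UNIV S"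
  proof
    fix l assume l: "l \<in> hits w k"
    have "l i \<in> S i" for i
    proof (cases "i = i0")
      case True
      then show ?thesis using l by (auto simp: hits_def line_index_def S_def PiE_UNIV_domain Pi_iff split: if_splits)
    next
      case False
      then show ?thesis using l by (simp add: hits_def S_def rescale_nth line_start_def)
    qed
    then show "l \<in> PiE UNIV S" by (simp add: PiE_UNIV_domain)
  qed
  then have "card (hits w k) \<le> card (PiE UNIV S)" using fin by (intro card_mono)
  also have "\<dots> = (\<Prod>i\<in>UNIV. card (S i))" by (simp add: card_PiE)
  also have "\<dots> = (\<Prod>i\<in>UNIV - {i0}. card (S i))"
    by (subst prod.remove[of UNIV i0]) (auto simp: S_def)
  finally have "real (card (hits w k)) \<le> (\<Prod>i\<in>UNIV - {i0}. real (card (S i)))"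
    by (simp flip: of_nat_prod)
  also have "\<dots> \<le> (\<Prod>i\<in>UNIV - {i0}. 2 * h / w)" by (intro prod_mono) (auto simp: S)
  also have "\<dots> = (2 * h / w) ^ (CARD('d) - 1)" by (simp add: card_Diff_singleton)
  finally show ?thesis .
qed

text \<open>In rescaled coordinates the lines of width \<open>h\<close> sit at half-integers, beyond
  the reach \<open>1 / 4\<close> of the bumps. Two dimensions guarantee a transversal coordinate in
  which to see this.\<close>

lemma no_hits:
  assumes "CARD('d) \<ge> 2"
  shows "hits h k = {}"
proof -
  obtain i where i: "i \<noteq> i0"
  proof -
    have "\<not> (UNIV :: 'd set) \<subseteq> {i0}"
    proof
      assume "(UNIV :: 'd set) \<subseteq> {i0}"
      then have "CARD('d) \<le> card {i0}" by (intro card_mono) auto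
      then show False using assms by simp
    qed
    then show ?thesis using that by blast
  qed
  have "\<not> \<bar>rescale (line_start i0 p h l) $ i - of_int (k i)\<bar> < 1 / 4" for l
  proof -
    have eq: "rescale (line_start i0 p h l) $ i = of_int (l i) + 1 / 2"
      using h i by (simp add: rescale_nth line_start_def)
    have "real_of_int (k i) \<le> real_of_int (l i) \<or> real_of_int (l i + 1) \<le> real_of_int (k i)"
      unfolding of_int_le_iff by linarith
    then show ?thesis unfolding eq by auto
  qed
  then show ?thesis using i by (auto simp: hits_def)
qed

text \<open>A start point in a cell of \<open>Z\<close> lies at least \<open>1 / 4\<close> before
  its centre in direction \<open>i0\<close>, where the profile is \<open>0\<close>.\<close>

lemma potential_start:
  assumes "admissible i0 h p Z" "x $ i0 = -1"
  shows "potential Z x = 0"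
proof (cases "cell (rescale x) \<in> Z")
  case True
  define k where "k = cell (rescale x)"
  have "- 1 - p $ i0 \<le> h * (of_int (k i0) - 1 / 4)"
    using assms(1) True by (force simp: admissible_def k_def)
  then have "rescale x $ i0 \<le> of_int (k i0) - 1 / 4"
    using h assms(2) by (simp add: rescale_nth pos_divide_le_eq mult.commute)
  then have "1 / 4 \<le> \<bar>rescale x $ i0 - of_int (round (rescale x $ i0))\<bar>"
    by (simp add: k_def cell_def)
  then have "profile N (rescale x) = 0" using N by (intro profile_eq_0) auto
  then show ?thesis by (simp add: potential_def wave_def)
qed (simp add: potential_def wave_def)

text \<open>Neither the start points nor the equal durations \<open>Tsum / real m\<close> depend on
  \<open>Z\<close>. Width \<open>\<delta> / real CARD('d)\<close> turns the coordinatewise covering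
  into distance \<open>\<delta>\<close>, and \<open>3 * real m \<le> c * Tsum\<close> gives each
  line the time to cross the cube.\<close>

lemma snake_model_mem:
  assumes Z: "admissible i0 h p Z" and smooth: "vfield Z \<in> smooth_class \<beta> L L\<beta>"
    and p: "\<And>i. i \<noteq> i0 \<Longrightarrow> p $ i \<in> {0..1}"
    and ks: "set ks = line_index i0 (\<delta> / real CARD('d))" "length ks = m"
    and "0 < \<delta>" "\<delta> \<le> 1" "Tsum > 0" "m \<le> n" "3 * real m \<le> c * Tsum" "a * h \<le> 1"
  shows "(vfield Z, map (line_start i0 p (\<delta> / real CARD('d))) ks, replicate m (Tsum / real m)) \<in> snake_model \<beta> L L\<beta> \<delta> Tsum n"
proof -
  define w where "w = \<delta> / real CARD('d)"
  have w: "0 < w" "w \<le> 1" and dw: "real CARD('d) * w = \<delta>"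
    using assms(6,7) by (auto simp: w_def field_simps intro: order_trans)
  have m: "m > 0" using card_line_index(2)[OF w, of i0] ks by (auto simp: w_def)
  have T: "Tsum / real m > 0" "3 \<le> c * (Tsum / real m)"
    using m assms(8,10) by (auto simp: field_simps)
  have cover: "unit_cube \<subseteq> (\<Union>j<length (replicate m (Tsum / real m)).
      tube (replicate m (Tsum / real m) ! j) (flow (vfield Z) (map (line_start i0 p w) ks ! j)) \<delta>)"
  proof
    fix y :: "real^'d" assume y: "y \<in> unit_cube"
    obtain k where k: "k \<in> line_index i0 w"
      "norm (y - line_start i0 p w k - (y $ i0 + 1) *\<^sub>R axis i0 1) \<le> \<delta>"
      using line_index_covers[OF w(1) y p] unfolding dw by blast
    then obtain j where j: "j < m" "ks ! j = k"
      using ks unfolding w_def by (metis in_set_conv_nth)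
    have start: "line_start i0 p w k $ i0 = -1" by (simp add: line_start_def)
    have "y \<in> tube (Tsum / real m) (flow (vfield Z) (line_start i0 p w k)) \<delta>"
      using y start potential_start[OF Z start] T assms(11) k(2)
      by (intro mem_tube) (auto simp: unit_cube_def)
    then show "y \<in> (\<Union>j<length (replicate m (Tsum / real m)).
      tube (replicate m (Tsum / real m) ! j) (flow (vfield Z) (map (line_start i0 p w) ks ! j)) \<delta>)"
      using j ks(2) by auto
  qed
  have "tube_dist unit_cube (vfield Z, map (line_start i0 p w) ks, replicate m (Tsum / real m)) \<le> ennreal \<delta>"
    unfolding tube_dist_def case_prod_conv using cover assms(6) by (intro Inf_lower imageI) auto
  moreover have "sum_list (replicate m (Tsum / real m)) = Tsum" using m by (simp add: sum_list_replicate)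
  ultimately show ?thesis
    using smooth m T(1) ks(2) assms(9) unfolding w_def[symmetric]
    by (auto simp: snake_model_def snake_class_def)
qed

end

section \<open>Smoothness and information of the perturbed fields\<close>

text \<open>With \<open>g\<close> the slope, \<open>c / (1 + g) = c + c * b\<close> for
  \<open>b = - g / (1 + g)\<close>, which is the form that \<open>smooth_classI\<close> expects.
  \<open>b\<close> inherits the amplitude \<open>A * h powr \<beta>\<close> of \<open>g\<close>,
  with a constant independent of \<open>h\<close>, \<open>p\<close> and \<open>Z\<close>.\<close>

lemma wave_field_smooth:
  fixes i0 :: "'d::finite"
  assumes "\<beta> > 0" and L: "\<forall>k\<le>holder_order \<beta>. L k > 0" "L\<beta> > 0" and cf: "c > 0" "2 * c \<le> L 0"
  obtains N A M where "3 \<le> N" "0 < A" "A \<le> 1" "\<And>z. \<bar>profile_deriv i0 N z\<bar> \<le> M" "A * M \<le> 1 / 2"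
    "\<And>h p Z. 0 < h \<Longrightarrow> h \<le> 1 \<Longrightarrow>
      axis_flow.field i0 c (wave_field.slope i0 N (A * h powr \<beta>) h p Z) \<in> smooth_class \<beta> L L\<beta>"
proof -
  define l where "l = holder_order \<beta>"
  \<comment> \<open>\<open>profile_deriv\<close> needs \<open>l + 1\<close> bounded derivatives,
    hence the profile \<open>l + 2\<close>, and the exponent has to exceed this number.\<close>
  define N where "N = l + 4"
  have Nf: "Suc (Suc l) < N" "2 \<le> N" "3 \<le> N" by (auto simp: N_def)
  obtain M where Mf: "bounded_derivs (Suc l) M (profile_deriv i0 N)"
    using bounded_derivs_profile_deriv[OF Nf(1), of i0] by blast
  have "M \<ge> 0" using bounded_derivs_nonneg[OF Mf] .
  obtain R where R: "\<And>g :: real^'d \<Rightarrow> real. bounded_derivs (Suc l) M g \<Longrightarrow> (\<forall>x. \<bar>g x\<bar> \<le> 1/2) \<Longrightarrow>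
      bounded_derivs (Suc l) R (\<lambda>x. 1 / (1 + g x))"
    using bounded_derivs_reciprocal[OF \<open>M \<ge> 0\<close>] by blast
  define M2 where "M2 = 2 ^ Suc l * (M * R)"
  have "bounded_derivs (Suc l) M (\<lambda>_ :: real^'d. 0)" using \<open>M \<ge> 0\<close> by (intro bounded_derivs_const) auto
  then have "bounded_derivs (Suc l) R (\<lambda>_ :: real^'d. 1 / (1 + 0))" by (intro R) auto
  then have "R \<ge> 0" by (rule bounded_derivs_nonneg)
  then have "M2 \<ge> 0" using \<open>M \<ge> 0\<close> by (simp add: M2_def)
  \<comment> \<open>\<open>A\<close> is the least of finitely many thresholds: \<open>1\<close>, one
    for a slope of at most \<open>1 / 2\<close>, and one for each constant of the smoothness class.
    The summands \<open>1\<close> in the denominators exclude division by \<open>0\<close>.\<close>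
  define S where "S = insert 1 (insert (1 / (2 * (M + 1))) (insert (L\<beta> / (2 * (c * M2 + 1))) ((\<lambda>k. L k / (c * M2 + 1)) ` {..l})))"
  define A where "A = Min S"
  have cM2: "c * M2 \<ge> 0" using cf \<open>M2 \<ge> 0\<close> by simp
  have S: "finite S" "S \<noteq> {}" by (auto simp: S_def)
  have "\<forall>x\<in>S. 0 < x"
    using \<open>M \<ge> 0\<close> cM2 L by (auto simp: S_def l_def intro!: divide_pos_pos)
  then have A_pos: "A > 0" unfolding A_def using S by (simp add: Min_gr_iff)
  have A_le: "A \<le> x" if "x \<in> S" for x unfolding A_def using S that by simp
  have A1: "A \<le> 1" by (rule A_le) (simp add: S_def)
  have "A \<le> 1 / (2 * (M + 1))" by (rule A_le) (simp add: S_def)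
  then have "A * (2 * (M + 1)) \<le> 1" using \<open>M \<ge> 0\<close> by (simp add: pos_le_divide_eq)
  then have AM: "A * M \<le> 1 / 2" using A_pos by (simp add: algebra_simps)
  have AL: "c * A * M2 \<le> L k" if "k \<le> l" for k
  proof -
    have "A \<le> L k / (c * M2 + 1)" 
      by (rule A_le) (use that in \<open>unfold S_def, blast\<close>)
    then have "A * (c * M2 + 1) \<le> L k" using cM2 by (simp add: pos_le_divide_eq)
    then show ?thesis using A_pos by (simp add: algebra_simps)
  qed
  have AL\<beta>: "2 * (c * A * M2) \<le> L\<beta>"
  proof -
    have "A \<le> L\<beta> / (2 * (c * M2 + 1))" by (rule A_le) (simp add: S_def)
    then have "A * (2 * (c * M2 + 1)) \<le> L\<beta>" using cM2 by (simp add: pos_le_divide_eq)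
    then show ?thesis using A_pos by (simp add: algebra_simps)
  qed
  have smooth: "axis_flow.field i0 c (wave_field.slope i0 N (A * h powr \<beta>) h p Z) \<in> smooth_class \<beta> L L\<beta>"
    if hf: "0 < h" "h \<le> 1" for h p Z
  proof -
    define a where "a = A * h powr \<beta>"
    have hp: "0 < h powr \<beta>" "h powr \<beta> \<le> 1" using hf \<open>\<beta> > 0\<close> by (auto intro: powr_le1)
    have af: "0 \<le> a" "a \<le> 1" "a \<le> A"
      using A_pos A1 hp mult_mono[of A 1 "h powr \<beta>" 1] mult_left_mono[of "h powr \<beta>" 1 A] by (auto simp: a_def)
    have "a * M \<le> A * M" using af \<open>M \<ge> 0\<close> by (intro mult_right_mono)
    then have aMf: "a * M \<le> 1 / 2" using AM by linarith
    interpret wave_field i0 N c a h M p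
      by unfold_locales (use Nf cf af hf aMf bounded_derivs_bound[OF Mf] in auto)
    define g where "g = (\<lambda>z. a * wave_deriv i0 N Z z)"
    have wM: "bounded_derivs (Suc l) M (wave_deriv i0 N Z)" by (rule bounded_derivs_wave_deriv[OF Mf Nf(2)])
    have g: "bounded_derivs (Suc l) (a * M) g"
      using bounded_derivs_cmult[OF wM, of a] af by (simp add: g_def)
    \<comment> \<open>\<open>R\<close> belongs to the constant \<open>M\<close>, so \<open>g\<close>
      is needed with \<open>M\<close> besides the sharper \<open>a * M\<close>.\<close>
    have gM: "bounded_derivs (Suc l) M g"
      by (rule bounded_derivs_mono_bound[OF g]) (use af \<open>M \<ge> 0\<close> in \<open>simp add: mult_left_le_one_le\<close>)
    have g_le: "\<bar>g z\<bar> \<le> 1 / 2" for z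
      using bounded_derivs_bound[OF g, of z] aMf by linarith
    have rec: "bounded_derivs (Suc l) R (\<lambda>z. 1 / (1 + g z))" using gM g_le by (intro R) auto
    define b where "b = (\<lambda>z. (-1) * (g z * (1 / (1 + g z))))"
    have "bounded_derivs (Suc l) (\<bar>-1\<bar> * (2 ^ Suc l * (a * M * R))) b"
      unfolding b_def by (rule bounded_derivs_cmult[OF bounded_derivs_mult[OF g rec]])
    then have b: "bounded_derivs (Suc l) (A * h powr \<beta> * M2) b"
      by (simp add: M2_def a_def mult_ac)
    have b_le: "\<bar>b z\<bar> \<le> 1" for z
    proof -
      have pos: "1 / 2 \<le> 1 + g z" using g_le[of z] by linarith
      have "\<bar>b z\<bar> = \<bar>g z\<bar> / (1 + g z)" using pos by (simp add: b_def abs_mult)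
      also have "\<dots> \<le> 1" using pos g_le[of z] by (simp add: pos_divide_le_eq)
      finally show ?thesis .
    qed
    have "vfield Z \<in> smooth_class \<beta> L L\<beta>"
    proof (rule smooth_classI[OF \<open>\<beta> > 0\<close> hf less_imp_le[OF A_pos] b[unfolded l_def] b_le, where c = c and p = p])
      fix j
      have "vfield Z x $ j = c * axis i0 1 $ j + c * axis i0 1 $ j * b ((1 / h) *\<^sub>R (x - p))" for x
      proof -
        have "1 + slope Z x \<noteq> 0" using fl.one_plus_ge[of Z x] by linarith
        then have "c / (1 + slope Z x) = c + c * b (rescale x)"
          by (simp add: b_def g_def slope_def field_simps)
        then show ?thesis by (simp add: fl.field_def rescale_def algebra_simps)
      qed
      moreover have "\<bar>c * axis i0 1 $ j\<bar> \<le> c" using cf by (simp add: axis_def)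
      ultimately show "\<exists>\<kappa>. \<bar>\<kappa>\<bar> \<le> c \<and> (\<forall>x. vfield Z x $ j = \<kappa> + \<kappa> * b ((1 / h) *\<^sub>R (x - p)))" by blast
    qed (use cf AL AL\<beta> in \<open>auto simp: l_def\<close>)
    then show ?thesis by (simp add: a_def)
  qed
  show ?thesis
    by (rule that[OF Nf(3) A_pos A1 bounded_derivs_bound[OF Mf] AM smooth])
qed

context wave_field
begin

text \<open>Three bounds multiply: bump \<open>k\<close> is felt only on lines in
  \<open>hits w k\<close>, there only during one time window of length \<open>h / (2 * c)\<close>,
  and each observation in it is displaced by at most \<open>2 * a * h\<close>.\<close>

lemma energy_bound:
  assumes Z: "admissible i0 h p Z" "admissible i0 h p (insert k Z)"
    and ks: "set ks = line_index i0 w" "distinct ks"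
    and T: "3 \<le> c * T"
    and tss: "length tss = length ks"
    and cover: "\<And>j s t. j < length ks \<Longrightarrow> s \<in> {0..T} \<Longrightarrow> t \<in> {0..T} \<Longrightarrow> s < t \<Longrightarrow>
       real (card {i. i < length (tss ! j) \<and> tss ! j ! i \<in> {s..t}}) \<le> max 1 (B * (t - s))"
  shows "(\<Sum>(j, i)\<in>obs_index tss.
      (norm (flow (vfield (insert k Z)) (map (line_start i0 p w) ks ! j) (tss ! j ! i) -
        flow (vfield Z) (map (line_start i0 p w) ks ! j) (tss ! j ! i)))\<^sup>2)
    \<le> real (card (hits w k)) * (max 1 (B * (h / (2 * c))) * (2 * a * h)\<^sup>2)"
proof -
  \<comment> \<open>The bump extends over \<open>h / 2\<close> in direction \<open>i0\<close>, and
    the clock runs at speed \<open>c\<close>; the summand \<open>1\<close> accounts for the start at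
    \<open>-1\<close>. Admissibility places the window inside \<open>{0..T}\<close>.\<close>
  define s where "s = (p $ i0 + 1 + h * (of_int (k i0) - 1 / 4)) / c"
  define t where "t = (p $ i0 + 1 + h * (of_int (k i0) + 1 / 4)) / c"
  have adm: "-1 \<le> p $ i0 + h * (of_int (k i0) - 1 / 4)" "p $ i0 + h * (of_int (k i0) + 1 / 4) \<le> 2"
    using Z(2) by (auto simp: admissible_def)
  have ts: "t - s = h / (2 * c)" using c by (simp add: s_def t_def field_simps)
  have st: "s < t" using ts c h by (smt (verit) divide_pos_pos)
  have "0 \<le> s" using adm(1) c unfolding s_def by (intro divide_nonneg_pos) auto
  have "t \<le> T" using adm(2) c T by (simp add: t_def pos_divide_le_eq mult.commute)
  have st_mem: "s \<in> {0..T}" "t \<in> {0..T}" using \<open>0 \<le> s\<close> \<open>t \<le> T\<close> st by auto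
  define x where "x j = map (line_start i0 p w) ks ! j" for j
  define e where "e j i = (norm (flow (vfield (insert k Z)) (x j) (tss ! j ! i) - flow (vfield Z) (x j) (tss ! j ! i)))\<^sup>2" for j i
  let ?V = "(2 * a * h)\<^sup>2"
  let ?X = "max 1 (B * (h / (2 * c)))"
  have e_le: "e j i \<le> (if ks ! j \<in> hits w k \<and> tss ! j ! i \<in> {s..t} then ?V else 0)" if j: "j < length ks" for j i
  proof -
    have xj: "x j = line_start i0 p w (ks ! j)" using j by (simp add: x_def)
    have x0: "x j $ i0 = -1" by (simp add: xj line_start_def)
    note pot = potential_start[OF Z(1) x0] potential_start[OF Z(2) x0]
    show ?thesis
    proof (cases "flow (vfield Z) (x j) (tss ! j ! i) = flow (vfield (insert k Z)) (x j) (tss ! j ! i)")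
      case True
      then show ?thesis by (simp add: e_def)
    next
      case False
      note supp = flow_diff_support[OF pot False]
      have "ks ! j \<in> line_index i0 w" using j ks(1) nth_mem by blast
      then have "ks ! j \<in> hits w k" using supp(1) by (auto simp: hits_def xj)
      moreover have "tss ! j ! i \<in> {s..t}"
        using supp(2) x0 c by (auto simp: s_def t_def pos_divide_le_eq pos_le_divide_eq algebra_simps)
      moreover have "e j i \<le> ?V"
        unfolding e_def using flow_diff_le[OF pot(2,1)] by (intro power_mono) auto
      ultimately show ?thesis by simp
    qed
  qed
  have "(\<Sum>(j, i)\<in>obs_index tss. e j i) = (\<Sum>j<length ks. \<Sum>i<length (tss ! j). e j i)"
    unfolding obs_index_def tss by (subst sum.Sigma) auto
  also have "\<dots> \<le> (\<Sum>j<length ks. if ks ! j \<in> hits w k then ?X * ?V else 0)"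
  proof (rule sum_mono)
    fix j assume "j \<in> {..<length ks}"
    then have j: "j < length ks" by simp
    show "(\<Sum>i<length (tss ! j). e j i) \<le> (if ks ! j \<in> hits w k then ?X * ?V else 0)"
    proof (cases "ks ! j \<in> hits w k")
      case True
      have "(\<Sum>i<length (tss ! j). e j i) \<le> (\<Sum>i<length (tss ! j). if tss ! j ! i \<in> {s..t} then ?V else 0)"
        using e_le[OF j] True by (intro sum_mono) simp
      also have "\<dots> = real (card {i. i < length (tss ! j) \<and> tss ! j ! i \<in> {s..t}}) * ?V"
        by (simp add: sum.If_cases Int_def)
      also have "\<dots> \<le> ?X * ?V"
        using cover[OF j st_mem st] unfolding ts by (intro mult_right_mono) auto
      finally show ?thesis using True by simp
    next
      case False
      have "(\<Sum>i<length (tss ! j). e j i) \<le> (\<Sum>i<length (tss ! j). 0)"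
        using e_le[OF j] False by (intro sum_mono) simp
      then show ?thesis using False by simp
    qed
  qed
  also have "\<dots> = real (card {j. j < length ks \<and> ks ! j \<in> hits w k}) * (?X * ?V)"
    by (simp add: sum.If_cases Int_def)
  also have "\<dots> \<le> real (card (hits w k)) * (?X * ?V)"
  proof (intro mult_right_mono of_nat_mono mult_nonneg_nonneg)
    have "card {j. j < length ks \<and> ks ! j \<in> hits w k} = card ((!) ks ` {j. j < length ks \<and> ks ! j \<in> hits w k})"
      using ks(2) by (intro card_image[symmetric] inj_on_nth) auto
    also have "\<dots> \<le> card (hits w k)"
      by (intro card_mono) (auto simp: hits_def finite_line_index)
    finally show "card {j. j < length ks \<and> ks ! j \<in> hits w k} \<le> card (hits w k)" .
  qed auto
  finally show ?thesis by (simp add: e_def x_def)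
qed

end

text \<open>\<open>D\<close> stands for \<open>\<delta> ^ (d - 1)\<close>, \<open>H\<close> for the
  number of lines, \<open>X\<close> for the number of observations per crossing, and
  \<open>e\<close> is the exponent \<open>d - 1\<close> from the lines plus
  \<open>2 * \<beta> + 2\<close> from the squared displacement. If \<open>X \<le> 1\<close>, then
  \<open>h\<close> is at most a multiple of \<open>T / n\<close>, and the first bound on
  \<open>D\<close> makes \<open>h powr e / D\<close> of order \<open>1 / C\<close>. Otherwise
  \<open>C \<le> T * D\<close> gives order \<open>n * h powr (1 + e) / C\<close>. The constant is a
  sum to serve both cases.\<close>

lemma divergence_bound:
  fixes d :: nat and n T h D H Cn Cv c \<beta> A C :: real
  defines "e \<equiv> 2 * \<beta> + real d + 1" and "G \<equiv> (2 * real d) ^ (d - 1)"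
  assumes pos: "d \<ge> 2" "n > 0" "T > 0" "h > 0" "D > 0" "Cn > 0" "Cv > 0" "c > 0" "\<beta> > 0" "C > 0"
    and A: "0 \<le> A" "A \<le> 1"
    and D: "C * (T / n) powr e \<le> D" "C * inverse T \<le> D" and H: "H \<le> G * h ^ (d - 1) / D"
  shows "Cn * (H * (max 1 (Cv * (n / T) * (h / (2 * c))) * (2 * (A * h powr \<beta>) * h)\<^sup>2))
    \<le> (4 * Cn * G * ((2 * c / Cv) powr e + Cv / (2 * c))) / C * max 1 (n * h powr (2 * \<beta> + 2 + real d))"
proof -
  define X where "X = Cv * (n / T) * (h / (2 * c))"
  define y where "y = h powr e"
  have G: "G \<ge> 0" by (simp add: G_def)
  have y: "y > 0" using pos by (simp add: y_def)
  have "(2 * (A * h powr \<beta>) * h)\<^sup>2 = A\<^sup>2 * (4 * (h powr (2 * \<beta>) * h\<^sup>2))"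
  proof -
    have "(h powr \<beta>)\<^sup>2 = h powr (2 * \<beta>)"
      by (simp add: power2_eq_square flip: powr_add)
    then show ?thesis by (simp add: power_mult_distrib)
  qed
  also have "h powr (2 * \<beta>) * h\<^sup>2 = h powr (2 * \<beta> + 2)"
    using pos by (simp add: powr_add)
  also have "A\<^sup>2 * (4 * h powr (2 * \<beta> + 2)) \<le> 1 * (4 * h powr (2 * \<beta> + 2))"
    using A by (intro mult_right_mono power_le_one) auto
  finally have V: "(2 * (A * h powr \<beta>) * h)\<^sup>2 \<le> 4 * h powr (2 * \<beta> + 2)" by simp
  have hd: "h ^ (d - 1) * h powr (2 * \<beta> + 2) = y"
  proof -
    have "h ^ (d - 1) = h powr (real d - 1)"
      using pos by (simp add: powr_realpow[symmetric] of_nat_diff)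
    then have "h ^ (d - 1) * h powr (2 * \<beta> + 2) = h powr (real d - 1 + (2 * \<beta> + 2))"
      by (simp only: powr_add)
    also have "real d - 1 + (2 * \<beta> + 2) = e" by (simp add: e_def)
    finally show ?thesis by (simp only: y_def)
  qed
  have "H * (max 1 X * (2 * (A * h powr \<beta>) * h)\<^sup>2) \<le> (G * h ^ (d - 1) / D) * (max 1 X * (4 * h powr (2 * \<beta> + 2)))"
    using H V G pos by (intro mult_mono mult_left_mono mult_nonneg_nonneg divide_nonneg_pos) auto
  also have "\<dots> = max 1 X * (4 * G * y / D)" by (simp add: hd[symmetric])
  finally have 1: "Cn * (H * (max 1 X * (2 * (A * h powr \<beta>) * h)\<^sup>2)) \<le> Cn * (max 1 X * (4 * G * y / D))"
    using pos by (intro mult_left_mono) auto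
  define M where "M = max 1 (n * h powr (2 * \<beta> + 2 + real d))"
  have M: "1 \<le> M" "n * (h * y) \<le> M"
  proof -
    have "2 * \<beta> + 2 + real d = 1 + e" by (simp add: e_def)
    then have "h powr (2 * \<beta> + 2 + real d) = h * y"
      using pos by (simp only: powr_add y_def) simp
    then show "n * (h * y) \<le> M" by (simp add: M_def)
  qed (simp add: M_def)
  have "max 1 X * (y / D) \<le> ((2 * c / Cv) powr e + Cv / (2 * c)) / C * M"
  proof (cases "X \<le> 1")
    case True
    have "h \<le> (2 * c / Cv) * (T / n)"
      using True pos by (simp add: X_def field_simps)
    then have "y \<le> ((2 * c / Cv) * (T / n)) powr e"
      unfolding y_def using pos by (intro powr_mono2) (auto simp: e_def)
    also have "\<dots> = (2 * c / Cv) powr e * (T / n) powr e" by (rule powr_mult)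
    also have "\<dots> \<le> (2 * c / Cv) powr e * (D / C)"
      using D(1) pos by (intro mult_left_mono) (auto simp: pos_le_divide_eq mult.commute)
    finally have "y / D \<le> (2 * c / Cv) powr e / C"
      using pos by (simp add: field_simps)
    also have "\<dots> \<le> ((2 * c / Cv) powr e + Cv / (2 * c)) / C"
      using pos by (intro divide_right_mono) auto
    also have "\<dots> = ((2 * c / Cv) powr e + Cv / (2 * c)) / C * 1" by simp
    also have "\<dots> \<le> ((2 * c / Cv) powr e + Cv / (2 * c)) / C * M"
      using M pos by (intro mult_left_mono divide_nonneg_pos add_nonneg_nonneg) auto
    finally show ?thesis using True by simp
  next
    case False
    have "C \<le> T * D" using D(2) pos by (simp add: field_simps)
    have "max 1 X * (y / D) = Cv / (2 * c) * (n * (h * y)) * (1 / (T * D))"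
      using False pos by (simp add: X_def mult_ac)
    also have "\<dots> \<le> Cv / (2 * c) * M * (1 / C)"
      using M pos y \<open>C \<le> T * D\<close>
      by (intro mult_mono mult_left_mono mult_nonneg_nonneg divide_left_mono) auto
    also have "\<dots> = Cv / (2 * c) / C * M" by simp
    also have "\<dots> \<le> ((2 * c / Cv) powr e + Cv / (2 * c)) / C * M"
      using M pos by (intro mult_right_mono divide_right_mono) auto
    finally show ?thesis .
  qed
  then have "4 * Cn * G * (max 1 X * (y / D)) \<le> 4 * Cn * G * (((2 * c / Cv) powr e + Cv / (2 * c)) / C * M)"
    using pos G by (intro mult_left_mono) auto
  moreover have "Cn * (max 1 X * (4 * G * y / D)) = 4 * Cn * G * (max 1 X * (y / D))" by simp
  ultimately have "Cn * (H * (max 1 X * (2 * (A * h powr \<beta>) * h)\<^sup>2)) \<le>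
      4 * Cn * G * (((2 * c / Cv) powr e + Cv / (2 * c)) / C * M)"
    using 1 by linarith
  then show ?thesis unfolding X_def M_def by simp
qed

lemma (in wave_field) vfield_measurable: "vfield Z \<in> borel_measurable borel"
proof -
  obtain M' where "bounded_derivs (Suc 0) M' (profile_deriv i0 N)"
    using bounded_derivs_profile_deriv[of "Suc 0" N i0] N by auto
  then have "bounded_derivs (Suc 0) M' (wave_deriv i0 N Z)"
    using N by (intro bounded_derivs_wave_deriv) auto
  then have "isCont (wave_deriv i0 N Z) z" for z
    by (rule has_derivative_continuous[OF bounded_derivs_SucD(1)])
  then have "continuous_on UNIV (wave_deriv i0 N Z)"
    by (simp add: continuous_at_imp_continuous_on)
  then have "wave_deriv i0 N Z \<in> borel_measurable borel" by (rule borel_measurable_continuous_onI)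
  moreover have "rescale \<in> borel_measurable borel"
    unfolding rescale_def[abs_def] by measurable
  ultimately have "(\<lambda>x. wave_deriv i0 N Z (rescale x)) \<in> borel_measurable borel"
    by (rule measurable_compose[rotated])
  then show ?thesis
    unfolding fl.field_def[abs_def] slope_def by measurable
qed

section \<open>Families of hypotheses\<close>

definition bump_core :: "real \<Rightarrow> real^'d::finite \<Rightarrow> real^'d \<Rightarrow> real \<Rightarrow> ('d \<Rightarrow> int) \<Rightarrow> (real^'d) set" where
  "bump_core h p z0 \<epsilon> k = {x. \<forall>i. \<bar>(x $ i - p $ i) / h - of_int (k i) - z0 $ i\<bar> \<le> \<epsilon>}"

text \<open>A family of hypotheses indexed by sets \<open>Z\<close> of bumps, in which adding one bump changes the law of
  the observations by a divergence of at most \<open>\<kappa>\<close> and the field by at least \<open>\<Delta>\<close> on the core of the bump.\<close>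

definition perturbation_family ::
    "'d::finite \<Rightarrow> real \<Rightarrow> real^'d \<Rightarrow> real^'d \<Rightarrow> real \<Rightarrow> real \<Rightarrow> real \<Rightarrow> (real^'d) measure \<Rightarrow> design \<Rightarrow>
     'd snake set \<Rightarrow> (('d \<Rightarrow> int) set \<Rightarrow> real^'d \<Rightarrow> real^'d) \<Rightarrow> (real^'d) list \<Rightarrow> real list \<Rightarrow> bool" where
  "perturbation_family i0 h p z0 \<epsilon> \<Delta> \<kappa> P D \<Theta> F xs Ts \<longleftrightarrow>
     (\<forall>Z. admissible i0 h p Z \<longrightarrow> (F Z, xs, Ts) \<in> \<Theta>) \<and>
     (\<forall>Z k b. admissible i0 h p (insert k Z) \<longrightarrow> b > 0 \<longrightarrow>
        hard_to_distinguish (1 - (\<kappa> + 1) / b) (exp b)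
          (obs_law P D (F (insert k Z), xs, Ts)) (obs_law P D (F Z, xs, Ts))) \<and>
     (\<forall>Z k x. k \<notin> Z \<longrightarrow> x \<in> bump_core h p z0 \<epsilon> k \<longrightarrow> \<Delta> \<le> norm (F (insert k Z) x - F Z x)) \<and>
     (\<forall>Z Z' k x. k \<notin> Z \<longrightarrow> k \<notin> Z' \<longrightarrow> x \<in> bump_core h p z0 \<epsilon> k \<longrightarrow> F Z x = F Z' x) \<and>
     (\<forall>Z. F Z \<in> borel_measurable borel)"

definition design_ok :: "real \<Rightarrow> nat \<Rightarrow> real \<Rightarrow> design \<Rightarrow> 'd::finite snake set \<Rightarrow> bool" where
  "design_ok Ccvrtm n Tsum D \<Theta> \<longleftrightarrow>
     (\<forall>(f, xs, Ts)\<in>\<Theta>. valid_times n Ts (D Ts) \<and> cover_time Ccvrtm n Tsum Ts (D Ts))"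

definition regime :: "nat \<Rightarrow> real \<Rightarrow> real \<Rightarrow> nat \<Rightarrow> real \<Rightarrow> real \<Rightarrow> bool" where
  "regime d \<beta> C n \<delta> Tsum \<longleftrightarrow> n \<ge> 1 \<and> \<delta> > 0 \<and> Tsum > 0 \<and>
     C * max ((Tsum / real n) powr (2 * \<beta> + real d + 1)) (inverse Tsum) \<le> \<delta> ^ (d - 1) \<and>
     \<delta> ^ (d - 1) \<le> inverse C * min 1 (real n / Tsum)"

text \<open>Chaining the conditions on \<open>\<delta>\<close> gives
  \<open>C * inverse Tsum \<le> inverse C * (real n / Tsum)\<close>, hence
  \<open>C\<^sup>2 \<le> real n\<close>. A value \<open>Tsum > real n\<close> would push
  \<open>\<delta> ^ (d - 1)\<close> above \<open>1\<close>.\<close>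

lemma regimeD:
  assumes "regime d \<beta> C n \<delta> Tsum" "1 \<le> C" "d \<ge> 2" "\<beta> > 0"
  shows "\<delta> \<le> 1" "Tsum \<le> real n" "1 / \<delta> ^ (d - 1) \<le> Tsum / C" "C\<^sup>2 \<le> real n"
    "C * (Tsum / real n) powr (2 * \<beta> + real d + 1) \<le> \<delta> ^ (d - 1)" "C * inverse Tsum \<le> \<delta> ^ (d - 1)"
    "\<delta> ^ (d - 1) \<le> inverse C"
proof -
  let ?D = "\<delta> ^ (d - 1)" and ?r = "Tsum / real n"
  have pos: "n \<ge> 1" "\<delta> > 0" "Tsum > 0" and
    lo: "C * max (?r powr (2 * \<beta> + real d + 1)) (inverse Tsum) \<le> ?D" and
    hi: "?D \<le> inverse C * min 1 (real n / Tsum)"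
    using assms(1) by (auto simp: regime_def)
  have "C > 0" "?D > 0" using assms pos by auto
  have "inverse C * min 1 (real n / Tsum) \<le> inverse C * 1" "inverse C * min 1 (real n / Tsum) \<le> inverse C * (real n / Tsum)"
    using \<open>C > 0\<close> by (intro mult_left_mono; simp)+
  then have hi2: "?D \<le> inverse C * (real n / Tsum)" and hi1: "?D \<le> inverse C" using hi by linarith+
  show "?D \<le> inverse C" by (rule hi1)
  have "C * (?r powr (2 * \<beta> + real d + 1)) \<le> C * max (?r powr (2 * \<beta> + real d + 1)) (inverse Tsum)"
    "C * inverse Tsum \<le> C * max (?r powr (2 * \<beta> + real d + 1)) (inverse Tsum)"
    using \<open>C > 0\<close> by (intro mult_left_mono; simp)+
  then show lo1: "C * (?r powr (2 * \<beta> + real d + 1)) \<le> ?D" and lo2: "C * inverse Tsum \<le> ?D"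
    using lo by linarith+
  have "inverse C \<le> 1" using assms(2) by (simp add: inverse_le_1_iff)
  then have "?D \<le> 1" using hi1 by linarith
  then show "\<delta> \<le> 1" using pos assms(3) by (auto simp: power_le_one_iff)
  show "Tsum \<le> real n"
  proof (rule ccontr)
    assume "\<not> Tsum \<le> real n"
    then have "?r > 1" using pos by simp
    then have "?r powr (2 * \<beta> + real d + 1) > 1" using assms(4) by (intro gr_one_powr) auto
    then have "1 * 1 < C * (?r powr (2 * \<beta> + real d + 1))" using assms(2) by (intro mult_le_less_imp_less) auto
    then show False using lo1 \<open>?D \<le> 1\<close> by simp
  qed
  show "1 / ?D \<le> Tsum / C" using lo2 \<open>C > 0\<close> \<open>?D > 0\<close> pos by (simp add: field_simps)
  have "C * inverse Tsum \<le> inverse C * (real n / Tsum)" using lo2 hi2 by linarith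
  then have "C * C \<le> real n" using \<open>C > 0\<close> pos by (simp add: field_simps)
  then show "C\<^sup>2 \<le> real n" by (simp add: power2_eq_square)
qed

text \<open>The existential constants precede \<open>n\<close>, \<open>\<delta>\<close>,
  \<open>Tsum\<close>, \<open>h\<close> and \<open>p\<close>, since the constant of the theorem is
  built from them. The divergence \<open>0\<close> at the lattice width comes from
  \<open>no_hits\<close>.\<close>

lemma exists_perturbation_family:
  fixes \<beta> L\<beta> Cn Cv :: real
  assumes d: "CARD('d::finite) \<ge> 2" and \<beta>: "\<beta> \<ge> 1" and L: "\<forall>k\<le>holder_order \<beta>. L k > 0" "L\<beta> > 0"
    and Cn: "Cn > 0" and Cv: "Cv > 0"
  shows "\<exists>(i0::'d) (z0::real^'d) \<epsilon> a0 K C0. 0 < \<epsilon> \<and> \<epsilon> < 1 / 2 \<and> 0 < a0 \<and> 0 \<le> K \<and> 1 \<le> C0 \<and>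
    (\<forall>i. 0 \<le> z0 $ i \<and> z0 $ i < 1 / 2) \<and> (\<forall>i. i \<noteq> i0 \<longrightarrow> z0 $ i = 0) \<and>
    (\<forall>C n \<delta> Tsum P (D::design) h p. C0 \<le> C \<longrightarrow> regime CARD('d) \<beta> C n \<delta> Tsum \<longrightarrow> noise_law Cn P \<longrightarrow>
       design_ok Cv n Tsum D (snake_model \<beta> L L\<beta> \<delta> Tsum n :: 'd snake set) \<longrightarrow>
       \<delta> / real CARD('d) \<le> h \<longrightarrow> h \<le> 1 \<longrightarrow> (\<forall>i. i \<noteq> i0 \<longrightarrow> p $ i \<in> {0..1}) \<longrightarrow>
       (\<exists>F xs Ts. perturbation_family i0 h p z0 \<epsilon> (a0 * h powr \<beta>)
          (if h = \<delta> / real CARD('d) then 0 else K / C * max 1 (real n * h powr (2 * \<beta> + 2 + real CARD('d))))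
          P D (snake_model \<beta> L L\<beta> \<delta> Tsum n) F xs Ts))"
proof -
  define i0 :: 'd where "i0 = undefined"
  let ?d = "CARD('d)"
  \<comment> \<open>Since \<open>1 + slope \<ge> 1 / 2\<close>, the field can be as large as
    \<open>2 * c\<close>, which must not exceed \<open>L 0\<close>.\<close>
  define c where "c = L 0 / 2"
  have c: "c > 0" "2 * c \<le> L 0" using L by (auto simp: c_def)
  have "\<beta> > 0" using \<beta> by simp
  obtain N A M where Nf: "3 \<le> N" and Af: "0 < A" "A \<le> 1" and Mf: "\<And>z. \<bar>profile_deriv i0 N z\<bar> \<le> M" and AM: "A * M \<le> 1 / 2"
    and smooth: "\<And>h p Z. 0 < h \<Longrightarrow> h \<le> 1 \<Longrightarrow>
      axis_flow.field i0 c (wave_field.slope i0 N (A * h powr \<beta>) h p Z) \<in> smooth_class \<beta> L L\<beta>"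
    using wave_field_smooth[OF \<open>\<beta> > 0\<close> L c, of i0] by blast
  obtain z0 :: "real^'d" and \<epsilon> where z0: "\<epsilon> > 0" "\<forall>i. 0 \<le> z0 $ i \<and> z0 $ i < 1 / 2" "\<forall>i. i \<noteq> i0 \<longrightarrow> z0 $ i = 0" "\<epsilon> < 1 / 2"
    and core: "\<And>z. (\<forall>i. \<bar>z $ i - z0 $ i\<bar> \<le> \<epsilon>) \<Longrightarrow> cell z = (\<lambda>_. 0) \<and> 1 \<le> \<bar>profile_deriv i0 N z\<bar>"
    using profile_deriv_large[OF Nf, of i0] by blast
  define G where "G = (2 * real ?d) ^ (?d - 1)"
  define e where "e = 2 * \<beta> + real ?d + 1"
  define K where "K = 4 * Cn * G * ((2 * c / Cv) powr e + Cv / (2 * c))"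
  \<comment> \<open>There are at most \<open>S / \<delta> ^ (?d - 1) \<le> S * (Tsum / C)\<close>
    lines. \<open>S \<le> C\<close> bounds this by \<open>Tsum \<le> n\<close>, and
    \<open>3 * S / c \<le> C\<close> leaves each line a time of at least
    \<open>3 / c\<close>.\<close>
  define S where "S = (7 * real ?d) ^ (?d - 1)"
  define C0 where "C0 = max 1 (max S (3 * S / c))"
  have "G \<ge> 0" by (simp add: G_def)
  then have K: "K \<ge> 0" unfolding K_def using c Cn Cv by (intro mult_nonneg_nonneg add_nonneg_nonneg) auto
  have fam: "\<exists>F xs Ts. perturbation_family i0 h p z0 \<epsilon> (A * c / 2 * h powr \<beta>)
          (if h = \<delta> / real ?d then 0 else K / C * max 1 (real n * h powr (2 * \<beta> + 2 + real ?d)))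
          P D (snake_model \<beta> L L\<beta> \<delta> Tsum n) F xs Ts"
    if C: "C0 \<le> C" and reg: "regime ?d \<beta> C n \<delta> Tsum" and P: "noise_law Cn P"
      and D: "design_ok Cv n Tsum D (snake_model \<beta> L L\<beta> \<delta> Tsum n :: 'd snake set)"
      and hf: "\<delta> / real ?d \<le> h" "h \<le> 1" and pf: "\<forall>i. i \<noteq> i0 \<longrightarrow> p $ i \<in> {0..1}"
    for C n \<delta> Tsum P and D :: design and h p
  proof -
    have C1: "1 \<le> C" and CS: "S \<le> C" "3 * S / c \<le> C" using C by (auto simp: C0_def)
    note R = regimeD[OF reg C1 d \<open>\<beta> > 0\<close>]
    have pos: "n \<ge> 1" "\<delta> > 0" "Tsum > 0" using reg by (auto simp: regime_def)
    define w where "w = \<delta> / real ?d"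
    have dpos: "real ?d > 0" by simp
    have w: "0 < w" "w \<le> 1" "w \<le> h"
    proof -
      show "0 < w" using pos by (simp add: w_def)
      show "w \<le> h" using hf by (simp add: w_def)
      then show "w \<le> 1" using hf by linarith
    qed
    have hpos: "h > 0" using w by linarith
    define a where "a = A * h powr \<beta>"
    have hp: "h powr \<beta> \<le> 1" using hpos hf \<beta> by (intro powr_le1) auto
    have af: "0 \<le> a" "a \<le> A"
      using Af hp mult_left_mono[of "h powr \<beta>" 1 A] by (auto simp: a_def)
    have "M \<ge> 0" using Mf[of 0] by linarith
    then have aM': "a * M \<le> 1 / 2" using mult_right_mono[OF af(2), of M] AM by linarith
    interpret wave_field i0 N c a h M p
      by unfold_locales (use Nf c af hpos Mf aM' in auto)
    obtain ks where ks: "set ks = line_index i0 w" "distinct ks"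
      using finite_distinct_list[OF finite_line_index[of i0 w]] by blast
    define m where "m = length ks"
    have m_card: "real m \<le> (7 / w) ^ (?d - 1)"
      using card_line_index(1)[OF w(1,2), of i0] distinct_card[OF ks(2)] ks(1) by (simp add: m_def)
    also have "(7 / w) ^ (?d - 1) = S * (1 / \<delta> ^ (?d - 1))"
      by (simp add: w_def S_def power_mult_distrib power_divide)
    also have "\<dots> \<le> S * (Tsum / C)" using R(3) by (intro mult_left_mono) (auto simp: S_def)
    finally have mS: "real m \<le> S * (Tsum / C)" .
    have m_pos: "m > 0" using card_line_index(2)[OF w(1,2), of i0] ks(1) by (auto simp: m_def)
    have "S * (Tsum / C) = (S / C) * Tsum" by simp
    also have "\<dots> \<le> 1 * Tsum" using CS C1 pos by (intro mult_right_mono) (auto simp: divide_le_eq)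
    finally have mn: "m \<le> n" using mS R(2) by linarith
    have "S \<le> C * c / 3" using CS(2) c by (simp add: field_simps)
    then have "S * (Tsum / C) \<le> (C * c / 3) * (Tsum / C)" using C1 pos by (intro mult_right_mono) auto
    also have "\<dots> = c * Tsum / 3" using C1 by simp
    finally have mT: "3 * real m \<le> c * Tsum" using mS by linarith
    have ah: "a * h \<le> 1"
      using mult_mono[of a 1 h 1] af Af hf hpos by auto
    define xs where "xs = map (line_start i0 p w) ks"
    define Ts where "Ts = replicate m (Tsum / real m)"
    have mem: "(vfield Z, xs, Ts) \<in> snake_model \<beta> L L\<beta> \<delta> Tsum n" if "admissible i0 h p Z" for Z
      unfolding xs_def Ts_def w_def
    proof (rule snake_model_mem[OF that])
      show "vfield Z \<in> smooth_class \<beta> L L\<beta>" using smooth[OF hpos hf(2), of p Z] by (simp add: a_def)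
    qed (use pf ks R pos mn mT ah in \<open>auto simp: w_def m_def\<close>)
    \<comment> \<open>The design depends on the durations only, so membership for a single
      \<open>Z\<close> already shows that it is valid.\<close>
    have "admissible i0 h p {}" by (simp add: admissible_def)
    then have des: "valid_times n Ts (D Ts)" "cover_time Cv n Tsum Ts (D Ts)"
      using D mem[of "{}"] unfolding design_ok_def by blast+
    define \<kappa> where "\<kappa> = (if h = \<delta> / real ?d then 0 else K / C * max 1 (real n * h powr (2 * \<beta> + 2 + real ?d)))"
    have energy: "Cn * (\<Sum>(j, i)\<in>obs_index (D Ts).
        (norm (flow (vfield (insert k Z)) (xs ! j) (D Ts ! j ! i) - flow (vfield Z) (xs ! j) (D Ts ! j ! i)))\<^sup>2) \<le> \<kappa>"
      if adm: "admissible i0 h p (insert k Z)" for k Z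
    proof -
      let ?e = "(\<Sum>(j, i)\<in>obs_index (D Ts).
        (norm (flow (vfield (insert k Z)) (xs ! j) (D Ts ! j ! i) - flow (vfield Z) (xs ! j) (D Ts ! j ! i)))\<^sup>2)"
      let ?H = "real (card (hits w k))"
      let ?Y = "max 1 (Cv * (real n / Tsum) * (h / (2 * c))) * (2 * a * h)\<^sup>2"
      have "?e \<le> ?H * ?Y"
        unfolding xs_def
      proof (rule energy_bound[OF _ adm ks, where T = "Tsum / real m"])
        show "admissible i0 h p Z" using adm by (simp add: admissible_def)
        show "3 \<le> c * (Tsum / real m)" using mT m_pos by (simp add: field_simps)
        show "length (D Ts) = length ks" using des(1) by (simp add: valid_times_def Ts_def m_def)
        fix j s t assume j: "j < length ks" and st: "s \<in> {0..Tsum / real m}" "t \<in> {0..Tsum / real m}" "s < t"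
        have "j < length Ts" "Ts ! j = Tsum / real m" using j by (auto simp: Ts_def m_def)
        then have "real (card {i. i < length (D Ts ! j) \<and> D Ts ! j ! i \<in> {s..t}}) \<le> max 1 (Cv * (t - s) * (real n / Tsum))"
          using des(2) st unfolding cover_time_def by auto
        then show "real (card {i. i < length (D Ts ! j) \<and> D Ts ! j ! i \<in> {s..t}}) \<le> max 1 (Cv * (real n / Tsum) * (t - s))"
          by (simp only: mult_ac)
      qed
      then have 1: "Cn * ?e \<le> Cn * (?H * ?Y)"
        using Cn by (intro mult_left_mono) auto
      also have "\<dots> \<le> \<kappa>"
      proof (cases "h = \<delta> / real ?d")
        case True
        then have "hits w k = {}" using no_hits[OF d, of k] by (simp add: w_def)
        then show ?thesis using True by (simp add: \<kappa>_def)
      next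
        case False
        have "?H \<le> (2 * h / w) ^ (?d - 1)" by (rule card_hits[OF w(1,3)])
        also have "2 * h / w = (2 * real ?d) * h / \<delta>" by (simp add: w_def)
        also have "((2 * real ?d) * h / \<delta>) ^ (?d - 1) = G * h ^ (?d - 1) / \<delta> ^ (?d - 1)"
          by (simp only: power_divide power_mult_distrib G_def)
        finally have H: "?H \<le> G * h ^ (?d - 1) / \<delta> ^ (?d - 1)" .
        have "Cn * (?H * ?Y) \<le> K / C * max 1 (real n * h powr (2 * \<beta> + 2 + real ?d))"
          unfolding K_def G_def e_def a_def
          by (rule divergence_bound) (use d pos hpos Cn Cv c \<open>\<beta> > 0\<close> C1 Af R(5,6) H in \<open>auto simp: G_def\<close>)
        then show ?thesis using False by (simp add: \<kappa>_def)
      qed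
      finally show ?thesis .
    qed
    have core_rescale: "\<forall>i. \<bar>(rescale x - lattice_point k) $ i - z0 $ i\<bar> \<le> \<epsilon>" if "x \<in> bump_core h p z0 \<epsilon> k" for x k
      using that by (simp add: bump_core_def rescale_nth lattice_point_def)
    have "perturbation_family i0 h p z0 \<epsilon> (A * c / 2 * h powr \<beta>) \<kappa> P D (snake_model \<beta> L L\<beta> \<delta> Tsum n) vfield xs Ts"
      unfolding perturbation_family_def
    proof (intro conjI allI impI)
      show "(vfield Z, xs, Ts) \<in> snake_model \<beta> L L\<beta> \<delta> Tsum n" if "admissible i0 h p Z" for Z
        by (rule mem[OF that])
      show "hard_to_distinguish (1 - (\<kappa> + 1) / b) (exp b)
          (obs_law P D (vfield (insert k Z), xs, Ts)) (obs_law P D (vfield Z, xs, Ts))"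
        if "admissible i0 h p (insert k Z)" "b > 0" for Z k b
        using P that(2) energy[OF that(1)] by (rule obs_law_hard_to_distinguish)
      show "A * c / 2 * h powr \<beta> \<le> norm (vfield (insert k Z) x - vfield Z x)"
        if "k \<notin> Z" "x \<in> bump_core h p z0 \<epsilon> k" for Z k x
        using vfield_insert_diff(1)[OF that(1)] core[OF core_rescale[OF that(2)]]
        by (simp add: a_def mult_ac)
      show "vfield Z \<in> borel_measurable borel" for Z by (rule vfield_measurable)
      show "vfield Z x = vfield Z' x"
        if "k \<notin> Z" "k \<notin> Z'" "x \<in> bump_core h p z0 \<epsilon> k" for Z Z' k x
      proof -
        have "cell (rescale x) = k"
          using vfield_insert_diff(2)[OF that(1)] core[OF core_rescale[OF that(3)]] by blast
        then show ?thesis using that vfield_off_cells[of x Z] vfield_off_cells[of x Z'] by simp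
      qed
    qed
    then show ?thesis unfolding \<kappa>_def by blast
  qed
  have "0 < A * c / 2" "1 \<le> C0" using Af c by (auto simp: C0_def)
  with z0 K fam show ?thesis by blast
qed

section \<open>Risk bounds\<close>

lemma estimator_measurable:
  assumes "fh \<in> estimators D"
  shows "(\<lambda>(y, x). fh xs Ts y x) \<in> obs_law P D (f, xs, Ts) \<Otimes>\<^sub>M borel \<rightarrow>\<^sub>M borel"
    and "(\<lambda>y. fh xs Ts y x) \<in> obs_law P D (f, xs, Ts) \<rightarrow>\<^sub>M borel"
proof -
  have [measurable_cong]: "sets (obs_law P D (f, xs, Ts)) = sets (obs_space (D Ts))" by (rule sets_obs_law)
  have 1: "(\<lambda>(y, x). fh xs Ts y x) \<in> obs_space (D Ts) \<Otimes>\<^sub>M borel \<rightarrow>\<^sub>M borel"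
    using assms by (simp add: estimators_def)
  then show "(\<lambda>(y, x). fh xs Ts y x) \<in> obs_law P D (f, xs, Ts) \<Otimes>\<^sub>M borel \<rightarrow>\<^sub>M borel"
    by (simp cong: measurable_cong_sets add: sets_pair_measure_cong[OF sets_obs_law refl])
  have "(\<lambda>y. (y, x)) \<in> obs_law P D (f, xs, Ts) \<rightarrow>\<^sub>M obs_space (D Ts) \<Otimes>\<^sub>M borel" by measurable
  from measurable_compose[OF this 1] show "(\<lambda>y. fh xs Ts y x) \<in> obs_law P D (f, xs, Ts) \<rightarrow>\<^sub>M borel" by simp
qed

text \<open>For the two errors \<open>u\<close> and \<open>v\<close>, \<open>\<Delta>\<^sup>2 \<le>
  (u + v)\<^sup>2 \<le> 2 * (u\<^sup>2 + v\<^sup>2)\<close>: every estimate has a large loss against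
  \<open>f\<close> or against \<open>g\<close>.\<close>

lemma two_point_risk:
  assumes fh: "fh \<in> estimators D"
    and hard: "hard_to_distinguish q t (obs_law P D (f, xs, Ts)) (obs_law P D (g, xs, Ts))" "1 \<le> t"
    and \<Delta>: "0 \<le> \<Delta>" "\<Delta> \<le> norm (f x - g x)"
  shows "ennreal (q * (\<Delta>\<^sup>2 / 2) / t) \<le>
    (\<integral>\<^sup>+y. ennreal ((norm (fh xs Ts y x - f x))\<^sup>2) \<partial>obs_law P D (f, xs, Ts)) +
    (\<integral>\<^sup>+y. ennreal ((norm (fh xs Ts y x - g x))\<^sup>2) \<partial>obs_law P D (g, xs, Ts))"
proof (rule two_point_bound[OF hard])
  have [measurable]: "(\<lambda>y. fh xs Ts y x) \<in> obs_law P D (f, xs, Ts) \<rightarrow>\<^sub>M borel"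
    by (rule estimator_measurable(2)[OF fh])
  show "(\<lambda>y. ennreal ((norm (fh xs Ts y x - f x))\<^sup>2)) \<in> borel_measurable (obs_law P D (f, xs, Ts))"
    "(\<lambda>y. ennreal ((norm (fh xs Ts y x - g x))\<^sup>2)) \<in> borel_measurable (obs_law P D (f, xs, Ts))"
    by measurable
  fix y
  define u v where "u = norm (fh xs Ts y x - f x)" and "v = norm (fh xs Ts y x - g x)"
  have "norm (f x - g x) \<le> u + v"
    using norm_triangle_ineq4[of "fh xs Ts y x - g x" "fh xs Ts y x - f x"] by (simp add: u_def v_def)
  then have "\<Delta>\<^sup>2 \<le> (u + v)\<^sup>2" using \<Delta> by (intro power_mono) auto
  also have "\<dots> \<le> 2 * (u\<^sup>2 + v\<^sup>2)"
    using sum_squares_bound[of u v] by (simp add: power2_sum algebra_simps)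
  finally have "\<Delta>\<^sup>2 / 2 \<le> u\<^sup>2 + v\<^sup>2" by simp
  then show "ennreal (\<Delta>\<^sup>2 / 2) \<le> ennreal ((norm (fh xs Ts y x - f x))\<^sup>2) + ennreal ((norm (fh xs Ts y x - g x))\<^sup>2)"
    by (simp add: u_def v_def flip: ennreal_plus)
qed simp

text \<open>An arbitrary common bound \<open>R\<close> of the risks replaces the nested infimum and
  supremum in the arguments below.\<close>

lemma le_minimax_riskI:
  assumes "\<And>fh R. fh \<in> estimators D \<Longrightarrow>
      (\<And>f xs Ts. (f, xs, Ts) \<in> \<Theta> \<Longrightarrow> (\<integral>\<^sup>+y. loss (fh xs Ts y) f \<partial>obs_law P D (f, xs, Ts)) \<le> R) \<Longrightarrow> X \<le> R"
  shows "X \<le> minimax_risk P D \<Theta> loss"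
  unfolding minimax_risk_def
proof (rule INF_greatest)
  fix fh :: "'a estimator" assume fh: "fh \<in> estimators D"
  show "X \<le> (SUP (f, xs, Ts)\<in>\<Theta>. \<integral>\<^sup>+ y. loss (fh xs Ts y) f \<partial>obs_law P D (f, xs, Ts))"
    by (rule assms[OF fh]) (rule SUP_upper2, assumption, simp)
qed

lemma perturbation_familyD:
  assumes "perturbation_family i0 h p z0 \<epsilon> \<Delta> \<kappa> P D \<Theta> F xs Ts"
  shows "\<And>Z. admissible i0 h p Z \<Longrightarrow> (F Z, xs, Ts) \<in> \<Theta>"
    and "\<And>Z k b. admissible i0 h p (insert k Z) \<Longrightarrow> b > 0 \<Longrightarrow>
        hard_to_distinguish (1 - (\<kappa> + 1) / b) (exp b)
          (obs_law P D (F (insert k Z), xs, Ts)) (obs_law P D (F Z, xs, Ts))"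
    and "\<And>Z k x. k \<notin> Z \<Longrightarrow> x \<in> bump_core h p z0 \<epsilon> k \<Longrightarrow> \<Delta> \<le> norm (F (insert k Z) x - F Z x)"
    and "\<And>Z Z' k x. k \<notin> Z \<Longrightarrow> k \<notin> Z' \<Longrightarrow> x \<in> bump_core h p z0 \<epsilon> k \<Longrightarrow> F Z x = F Z' x"
    and "\<And>Z. F Z \<in> borel_measurable borel"
proof -
  note A = assms[unfolded perturbation_family_def]
  show "(F Z, xs, Ts) \<in> \<Theta>" if "admissible i0 h p Z" for Z
    by (rule A[THEN conjunct1, rule_format, OF that])
  show "hard_to_distinguish (1 - (\<kappa> + 1) / b) (exp b)
      (obs_law P D (F (insert k Z), xs, Ts)) (obs_law P D (F Z, xs, Ts))"
    if "admissible i0 h p (insert k Z)" "b > 0" for Z k b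
    by (rule A[THEN conjunct2, THEN conjunct1, rule_format, OF that])
  show "\<Delta> \<le> norm (F (insert k Z) x - F Z x)" if "k \<notin> Z" "x \<in> bump_core h p z0 \<epsilon> k" for Z k x
    by (rule A[THEN conjunct2, THEN conjunct2, THEN conjunct1, rule_format, OF that])
  show "F Z x = F Z' x" if "k \<notin> Z" "k \<notin> Z'" "x \<in> bump_core h p z0 \<epsilon> k" for Z Z' k x
    by (rule A[THEN conjunct2, THEN conjunct2, THEN conjunct2, THEN conjunct1, rule_format, OF that])
  show "F Z \<in> borel_measurable borel" for Z
    by (rule A[THEN conjunct2, THEN conjunct2, THEN conjunct2, THEN conjunct2, rule_format])
qed

text \<open>The choice \<open>b = 4\<close> makes \<open>(\<kappa> + 1) / b\<close> at most
  \<open>1 / 2\<close>.\<close>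

lemma hard_family:
  assumes fam: "perturbation_family i0 h p z0 \<epsilon> \<Delta> \<kappa> P D \<Theta> F xs Ts"
    and "\<kappa> \<le> 1" "admissible i0 h p (insert k Z)"
  shows "hard_to_distinguish (1 / 2) (exp 4) (obs_law P D (F (insert k Z), xs, Ts)) (obs_law P D (F Z, xs, Ts))"
proof -
  have "hard_to_distinguish (1 - (\<kappa> + 1) / 4) (exp 4) (obs_law P D (F (insert k Z), xs, Ts)) (obs_law P D (F Z, xs, Ts))"
    by (rule perturbation_familyD(2)[OF fam assms(3)]) simp
  then show ?thesis by (rule hard_to_distinguish_mono) (use assms(2) in simp)
qed

lemma ennreal_half_le:
  assumes "ennreal s \<le> R + R" "s \<ge> 0"
  shows "ennreal (s / 2) \<le> R"
proof (cases R)
  case (real r)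
  have "ennreal s \<le> ennreal (r + r)"
    using assms(1) real by (simp only: ennreal_plus)
  then have "s / 2 \<le> r" using real(1) by simp
  then show ?thesis by (simp add: real(2) ennreal_leI)
qed simp

text \<open>The origin \<open>x0 - h *\<^sub>R z0\<close> puts \<open>x0\<close> in the centre of
  the core of bump \<open>0\<close>, wherever it lies in the cube, and this bump is admissible
  because \<open>h\<close> and \<open>z0\<close> are small.\<close>

lemma pointwise_risk:
  assumes fam: "perturbation_family i0 h (x0 - h *\<^sub>R z0) z0 \<epsilon> \<Delta> \<kappa> P D \<Theta> F xs Ts"
    and "\<kappa> \<le> 1" "0 \<le> \<Delta>" "0 < h" "h \<le> 1" "x0 \<in> unit_cube" "0 \<le> z0 $ i0" "z0 $ i0 < 1 / 2" "\<epsilon> > 0"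
  shows "ennreal (\<Delta>\<^sup>2 / (8 * exp 4)) \<le> minimax_risk P D \<Theta> (\<lambda>g f. ennreal ((norm (g x0 - f x0))\<^sup>2))"
proof (rule le_minimax_riskI)
  fix fh R assume fh: "fh \<in> estimators D" and
    R: "\<And>f xs Ts. (f, xs, Ts) \<in> \<Theta> \<Longrightarrow> (\<integral>\<^sup>+y. ennreal ((norm (fh xs Ts y x0 - f x0))\<^sup>2) \<partial>obs_law P D (f, xs, Ts)) \<le> R"
  let ?p = "x0 - h *\<^sub>R z0"
  have "0 \<le> x0 $ i0" "x0 $ i0 \<le> 1" using assms(6) by (auto simp: unit_cube_def)
  moreover have "0 \<le> h * z0 $ i0" using assms(4,7) by simp
  moreover have "h * z0 $ i0 \<le> 1 * (1 / 2)"
    by (rule mult_mono) (use assms(4,5,7,8) in auto)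
  ultimately have adm: "admissible i0 h ?p {}" "admissible i0 h ?p (insert (\<lambda>_. 0) {})"
    using assms(4,5) by (auto simp: admissible_def)
  have mem: "(F {}, xs, Ts) \<in> \<Theta>" "(F (insert (\<lambda>_. 0) {}), xs, Ts) \<in> \<Theta>"
    by (rule perturbation_familyD(1)[OF fam adm(1)], rule perturbation_familyD(1)[OF fam adm(2)])
  have "x0 \<in> bump_core h ?p z0 \<epsilon> (\<lambda>_. 0)"
    using assms(4,9) by (simp add: bump_core_def)
  then have "\<Delta> \<le> norm (F (insert (\<lambda>_. 0) {}) x0 - F {} x0)"
    by (intro perturbation_familyD(3)[OF fam]) auto
  note two_point_risk[OF fh hard_family[OF fam assms(2) adm(2)] _ assms(3) this]
  then have "ennreal (1 / 2 * (\<Delta>\<^sup>2 / 2) / exp 4) \<le>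
    (\<integral>\<^sup>+y. ennreal ((norm (fh xs Ts y x0 - F (insert (\<lambda>_. 0) {}) x0))\<^sup>2) \<partial>obs_law P D (F (insert (\<lambda>_. 0) {}), xs, Ts)) +
    (\<integral>\<^sup>+y. ennreal ((norm (fh xs Ts y x0 - F {} x0))\<^sup>2) \<partial>obs_law P D (F {}, xs, Ts))"
    by simp
  also have "\<dots> \<le> R + R" by (intro add_mono R mem)
  finally have "ennreal (1 / 2 * (\<Delta>\<^sup>2 / 2) / exp 4 / 2) \<le> R" by (rule ennreal_half_le) simp
  then show "ennreal (\<Delta>\<^sup>2 / (8 * exp 4)) \<le> R" by simp
qed

section \<open>Bumps inside the unit cube\<close>

definition grid_cells :: "real \<Rightarrow> ('d::finite \<Rightarrow> int) set" where
  "grid_cells h = PiE UNIV (\<lambda>_. {1..\<lfloor>1 / h\<rfloor> - 1})"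

lemma finite_grid_cells: "finite (grid_cells h)"
  unfolding grid_cells_def by (rule finite_PiE) auto

text \<open>The range of \<open>grid_cells\<close> starts at \<open>1\<close> and stops one short of
  \<open>1 / h\<close>, so that bumps and cores, which reach less than one cell width from their
  lattice point, stay inside the cube.\<close>

lemma grid_cellsD:
  assumes "k \<in> grid_cells h" "h > 0"
  shows "1 \<le> k i" "h * (real_of_int (k i) + 1) \<le> 1"
proof -
  have k: "1 \<le> k i \<and> k i \<le> \<lfloor>1 / h\<rfloor> - 1"
    using assms(1) by (auto simp: grid_cells_def PiE_UNIV_domain Pi_iff)
  then show "1 \<le> k i" by simp
  have "real_of_int (k i) + 1 \<le> 1 / h" using k by linarith
  then show "h * (real_of_int (k i) + 1) \<le> 1" using assms(2) by (simp add: field_simps)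
qed

lemma card_grid_cells:
  assumes "0 < h" "h \<le> 1 / 4"
  shows "(1 / (2 * h)) ^ CARD('d) \<le> real (card (grid_cells h :: ('d::finite \<Rightarrow> int) set))"
proof -
  have "4 \<le> 1 / h" using assms by (simp add: field_simps)
  have "1 / (2 * h) = (1 / h) / 2" by simp
  also have "r / 2 \<le> real (nat (\<lfloor>r\<rfloor> - 1))" if "4 \<le> r" for r :: real
    using that by linarith
  note this[OF \<open>4 \<le> 1 / h\<close>]
  finally have "1 / (2 * h) \<le> real (nat (\<lfloor>1 / h\<rfloor> - 1))" .
  then have "(1 / (2 * h)) ^ CARD('d) \<le> real (nat (\<lfloor>1 / h\<rfloor> - 1)) ^ CARD('d)"
    using assms by (intro power_mono) auto
  also have "\<dots> = real (card (grid_cells h :: ('d \<Rightarrow> int) set))"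
    by (simp add: grid_cells_def card_PiE)
  finally show ?thesis .
qed

lemma admissible_grid_cells:
  assumes "Z \<subseteq> grid_cells h" "h > 0"
  shows "admissible i0 h 0 Z"
  unfolding admissible_def
proof (rule ballI)
  fix k assume "k \<in> Z"
  then have k: "1 \<le> k i0" "h * (real_of_int (k i0) + 1) \<le> 1"
    using assms grid_cellsD[of k h i0] by auto
  have "0 \<le> h * (real_of_int (k i0) - 1 / 4)" using k(1) assms(2) by (intro mult_nonneg_nonneg) auto
  moreover have "h * (real_of_int (k i0) + 1 / 4) \<le> h * (real_of_int (k i0) + 1)" using assms(2) by simp
  ultimately show "- 1 \<le> (0 :: real^'a) $ i0 + h * (real_of_int (k i0) - 1 / 4) \<and> (0 :: real^'a) $ i0 + h * (real_of_int (k i0) + 1 / 4) \<le> 2"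
    using k(2) by simp
qed

lemma bump_core_subset_cube:
  assumes "k \<in> grid_cells h" "h > 0" "\<And>i. 0 \<le> z0 $ i" "\<And>i. z0 $ i < 1 / 2" "\<epsilon> < 1 / 2"
  shows "bump_core h 0 z0 \<epsilon> k \<subseteq> unit_cube"
proof
  fix x assume x: "x \<in> bump_core h 0 z0 \<epsilon> k"
  have "0 \<le> x $ i \<and> x $ i \<le> 1" for i
  proof -
    have k: "1 \<le> real_of_int (k i)" "h * (real_of_int (k i) + 1) \<le> 1"
      using grid_cellsD[OF assms(1,2), of i] by auto
    have "\<bar>x $ i / h - of_int (k i) - z0 $ i\<bar> \<le> \<epsilon>" using x by (simp add: bump_core_def)
    then have "0 \<le> x $ i / h" "x $ i / h \<le> real_of_int (k i) + 1"
      using assms(3)[of i] assms(4)[of i] assms(5) k(1) by linarith+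
    then have "0 \<le> x $ i" "x $ i \<le> h * (real_of_int (k i) + 1)"
      using assms(2) by (auto simp: zero_le_divide_iff pos_divide_le_eq mult.commute)
    then show ?thesis using k(2) by simp
  qed
  then show "x \<in> unit_cube" by (simp add: unit_cube_def)
qed

lemma bump_core_disjoint:
  assumes "x \<in> bump_core h p z0 \<epsilon> k" "x \<in> bump_core h p z0 \<epsilon> k'" "\<epsilon> < 1 / 2"
  shows "k = k'"
proof
  fix i
  have "\<bar>(x $ i - p $ i) / h - of_int (k i) - z0 $ i\<bar> \<le> \<epsilon>" "\<bar>(x $ i - p $ i) / h - of_int (k' i) - z0 $ i\<bar> \<le> \<epsilon>"
    using assms(1,2) by (auto simp: bump_core_def)
  then have "\<bar>real_of_int (k i) - real_of_int (k' i)\<bar> < 1" using assms(3) by linarith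
  then show "k i = k' i" by linarith
qed

lemma emeasure_bump_core:
  fixes z0 :: "real^'d::finite"
  assumes "h > 0" "\<epsilon> > 0"
  shows "bump_core h 0 z0 \<epsilon> k \<in> sets borel"
    and "emeasure lborel (bump_core h 0 z0 \<epsilon> k) = ennreal ((2 * \<epsilon> * h) ^ CARD('d))"
proof -
  define l u :: "real^'d" where "l = (\<chi> i. h * (of_int (k i) + z0 $ i - \<epsilon>))" and "u = (\<chi> i. h * (of_int (k i) + z0 $ i + \<epsilon>))"
  have "\<bar>t / h - of_int (k i) - z0 $ i\<bar> \<le> \<epsilon> \<longleftrightarrow> l $ i \<le> t \<and> t \<le> u $ i" for t i
  proof -
    have "\<bar>t / h - of_int (k i) - z0 $ i\<bar> \<le> \<epsilon> \<longleftrightarrow> of_int (k i) + z0 $ i - \<epsilon> \<le> t / h \<and> t / h \<le> of_int (k i) + z0 $ i + \<epsilon>"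
      by linarith
    then show ?thesis using assms(1) by (simp add: l_def u_def pos_le_divide_eq pos_divide_le_eq mult.commute)
  qed
  then have eq: "bump_core h 0 z0 \<epsilon> k = cbox l u"
    by (auto simp: bump_core_def mem_box_cart)
  then show "bump_core h 0 z0 \<epsilon> k \<in> sets borel" by simp
  have diff: "(u - l) \<bullet> b = 2 * \<epsilon> * h" if b: "b \<in> Basis" for b
  proof -
    obtain i where "b = axis i 1" using b by (auto simp: Basis_vec_def)
    then show ?thesis by (simp add: inner_axis l_def u_def algebra_simps)
  qed
  have "l \<bullet> b \<le> u \<bullet> b" if "b \<in> Basis" for b
  proof -
    have "0 \<le> (u - l) \<bullet> b" unfolding diff[OF that] using assms by simp
    then show ?thesis by (simp add: inner_diff_left)
  qed
  then have "emeasure lborel (cbox l u) = ennreal (\<Prod>b\<in>Basis. (u - l) \<bullet> b)"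
    by (rule emeasure_lborel_cbox)
  also have "(\<Prod>b\<in>Basis. (u - l) \<bullet> b) = (\<Prod>b\<in>(Basis :: (real^'d) set). 2 * \<epsilon> * h)"
    by (intro prod.cong) (auto simp: diff)
  also have "\<dots> = (2 * \<epsilon> * h) ^ CARD('d)" by simp
  finally show "emeasure lborel (bump_core h 0 z0 \<epsilon> k) = ennreal ((2 * \<epsilon> * h) ^ CARD('d))" by (simp add: eq)
qed

text \<open>The test for bump \<open>k\<close> asks whether the estimate at one core point
  \<open>X k\<close> deviates by \<open>\<Delta> / 2\<close> from the unperturbed field. If the true
  bump goes undetected or another test fires, the estimate is off by \<open>\<Delta> / 2\<close> at
  some point. The hypothesis on \<open>\<kappa>\<close> says that there are at least as many cells
  as the likelihood factor \<open>exp b\<close>.\<close>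

lemma sup_risk:
  fixes z0 :: "real^'d::finite"
  assumes fam: "perturbation_family i0 h 0 z0 \<epsilon> \<Delta> \<kappa> P D \<Theta> F xs Ts"
    and h: "0 < h" "h \<le> 1 / 4" and z0: "\<And>i. 0 \<le> z0 $ i" "\<And>i. z0 $ i < 1 / 2" and \<epsilon>: "0 < \<epsilon>" "\<epsilon> < 1 / 2"
    and \<kappa>: "0 \<le> \<kappa>" "exp (2 * (\<kappa> + 1)) \<le> (1 / (2 * h)) ^ CARD('d)" and \<Delta>: "0 < \<Delta>"
  shows "ennreal (\<Delta>\<^sup>2 / 16) \<le> minimax_risk P D \<Theta> (\<lambda>g f. SUP x\<in>unit_cube. ennreal ((norm (g x - f x))\<^sup>2))"
proof (rule le_minimax_riskI)
  fix fh R assume fh: "fh \<in> estimators D" and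
    R: "\<And>f xs Ts. (f, xs, Ts) \<in> \<Theta> \<Longrightarrow>
      (\<integral>\<^sup>+y. (SUP x\<in>unit_cube. ennreal ((norm (fh xs Ts y x - f x))\<^sup>2)) \<partial>obs_law P D (f, xs, Ts)) \<le> R"
  define S where "S = (grid_cells h :: ('d \<Rightarrow> int) set)"
  have S: "finite S" by (simp add: S_def finite_grid_cells)
  have adm: "admissible i0 h 0 {}" "\<And>k. k \<in> S \<Longrightarrow> admissible i0 h 0 (insert k {})"
    using h by (auto simp: S_def intro!: admissible_grid_cells)
  \<comment> \<open>With this \<open>b\<close> the event in \<open>hard_to_distinguish\<close> has
    probability at least one half.\<close>
  define b where "b = 2 * (\<kappa> + 1)"
  have b: "b > 0" "1 - (\<kappa> + 1) / b = 1 / 2" using \<kappa>(1) by (simp_all add: b_def)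
  define X where "X k = h *\<^sub>R (z0 + lattice_point k)" for k
  have X_core: "X k \<in> bump_core h 0 z0 \<epsilon> k" for k
    using h \<epsilon> by (simp add: bump_core_def X_def lattice_point_def)
  have X_cube: "X k \<in> unit_cube" if "k \<in> S" for k
    using bump_core_subset_cube[of k h z0 \<epsilon>] that h z0 \<epsilon> X_core[of k] unfolding S_def by blast
  let ?F0 = "F {}" and ?Q = "obs_law P D (F {}, xs, Ts)"
  define l where "l f y = (SUP x\<in>unit_cube. ennreal ((norm (fh xs Ts y x - f x))\<^sup>2))" for f :: "real^'d \<Rightarrow> real^'d" and y
  \<comment> \<open>\<open>many_hypotheses_bound\<close> asks for bounds at every \<open>y\<close>,
    also outside the space; the value \<open>\<infinity>\<close> there does not affect the
    integrals.\<close>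
  define m where "m f y = (if y \<in> space ?Q then l f y else \<infinity>)" for f y
  define A where "A k = {y \<in> space ?Q. \<Delta> / 2 \<le> norm (fh xs Ts y (X k) - ?F0 (X k))}" for k
  have l_ge: "ennreal (\<Delta>\<^sup>2 / 4) \<le> l f y" if "k \<in> S" "\<Delta> / 2 \<le> norm (fh xs Ts y (X k) - f (X k))" for f k y
  proof -
    have "(\<Delta> / 2)\<^sup>2 \<le> (norm (fh xs Ts y (X k) - f (X k)))\<^sup>2"
      using that(2) \<Delta> by (intro power_mono) auto
    then have "ennreal (\<Delta>\<^sup>2 / 4) \<le> ennreal ((norm (fh xs Ts y (X k) - f (X k)))\<^sup>2)"
      by (intro ennreal_leI) (simp add: power_divide)
    also have "\<dots> \<le> l f y"
      unfolding l_def by (rule SUP_upper[OF X_cube[OF that(1)]])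
    finally show ?thesis .
  qed
  have "ennreal (\<Delta>\<^sup>2 / 4 / 4) \<le> R"
  proof (rule many_hypotheses_bound[where A = A and m = "m ?F0"
        and l = "\<lambda>k. m (F (insert k {}))" and S = S and Q = ?Q
        and P = "\<lambda>k. obs_law P D (F (insert k {}), xs, Ts)" and t = "exp b"])
    show card: "exp b \<le> real (card S)"
      using \<kappa>(2) card_grid_cells[OF h, where 'd = 'd] by (simp add: b_def S_def)
    then show "S \<noteq> {}" using exp_gt_zero[of b] by (auto simp del: exp_gt_zero)
    show "hard_to_distinguish (1 / 2) (exp b) (obs_law P D (F (insert k {}), xs, Ts)) ?Q" if "k \<in> S" for k
      using perturbation_familyD(2)[OF fam adm(2)[OF that] b(1)] b(2) by simp
    show "A k \<in> sets ?Q" for k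
    proof -
      have [measurable]: "(\<lambda>y. fh xs Ts y (X k)) \<in> ?Q \<rightarrow>\<^sub>M borel"
        by (rule estimator_measurable(2)[OF fh])
      show ?thesis unfolding A_def by measurable
    qed
    show "ennreal (\<Delta>\<^sup>2 / 4) \<le> m ?F0 y" if "k \<in> S" "y \<in> A k" for y k
      using l_ge[where f = ?F0 and k = k and y = y] that by (simp add: A_def m_def)
    show "(\<integral>\<^sup>+y. m ?F0 y \<partial>?Q) \<le> R"
    proof -
      have "(\<integral>\<^sup>+y. m ?F0 y \<partial>?Q) = (\<integral>\<^sup>+y. l ?F0 y \<partial>?Q)"
        by (intro nn_integral_cong) (simp add: m_def)
      also have "\<dots> \<le> R" unfolding l_def by (rule R[OF perturbation_familyD(1)[OF fam adm(1)]])
      finally show ?thesis .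
    qed
    show "ennreal (\<Delta>\<^sup>2 / 4) \<le> m (F (insert k {})) y"
      if "k \<in> S" "y \<notin> A k" for y k
    proof (cases "y \<in> space ?Q")
      case True
      have "\<Delta> \<le> norm (F (insert k {}) (X k) - ?F0 (X k))"
        by (rule perturbation_familyD(3)[OF fam _ X_core]) simp
      also have "\<dots> \<le> norm (fh xs Ts y (X k) - ?F0 (X k)) + norm (fh xs Ts y (X k) - F (insert k {}) (X k))"
        using norm_triangle_ineq4[of "fh xs Ts y (X k) - ?F0 (X k)" "fh xs Ts y (X k) - F (insert k {}) (X k)"] by simp
      finally have "\<Delta> / 2 \<le> norm (fh xs Ts y (X k) - F (insert k {}) (X k))"
        using that(2) True by (simp add: A_def)
      with l_ge[where f = "F (insert k {})" and k = k and y = y] that(1) show ?thesis using True by (simp add: m_def)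
    qed (simp add: m_def)
    show "ennreal (\<Delta>\<^sup>2 / 4) \<le> m (F (insert k {})) y"
      if "k \<in> S" "j \<in> S" "j \<noteq> k" "y \<in> A j" for y k j
    proof -
      \<comment> \<open>Bump \<open>k\<close> does not reach \<open>X j\<close>, so an error against
        the unperturbed field at this point is an error against hypothesis \<open>k\<close>.\<close>
      have "F (insert k {}) (X j) = ?F0 (X j)"
        by (rule perturbation_familyD(4)[OF fam _ _ X_core[of j]]) (use that in auto)
      then have "\<Delta> / 2 \<le> norm (fh xs Ts y (X j) - F (insert k {}) (X j))" "y \<in> space ?Q"
        using that(4) by (auto simp: A_def)
      with l_ge[where f = "F (insert k {})" and k = j and y = y] that(2) show ?thesis by (simp add: m_def)
    qed
    show "(\<integral>\<^sup>+y. m (F (insert k {})) y \<partial>obs_law P D (F (insert k {}), xs, Ts)) \<le> R"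
      if "k \<in> S" for k
    proof -
      have "space ?Q = space (obs_law P D (F (insert k {}), xs, Ts))"
        by (rule sets_eq_imp_space_eq) (simp add: sets_obs_law)
      then have "(\<integral>\<^sup>+y. m (F (insert k {})) y \<partial>obs_law P D (F (insert k {}), xs, Ts)) =
          (\<integral>\<^sup>+y. l (F (insert k {})) y \<partial>obs_law P D (F (insert k {}), xs, Ts))"
        by (intro nn_integral_cong) (simp add: m_def)
      also have "\<dots> \<le> R" unfolding l_def by (rule R[OF perturbation_familyD(1)[OF fam adm(2)[OF that]]])
      finally show ?thesis .
    qed
  qed (use S \<Delta> in auto)
  then show "ennreal (\<Delta>\<^sup>2 / 16) \<le> R" by simp
qed

lemma sum_Pow_insert:
  assumes "finite S" "k \<in> S"
  shows "(\<Sum>Z\<in>Pow S. f Z) = (\<Sum>Z\<in>Pow (S - {k}). f Z + f (insert k Z))"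
proof -
  have "Pow S = Pow (S - {k}) \<union> insert k ` Pow (S - {k})"
    using Pow_insert[of k "S - {k}"] assms(2) by (simp add: insert_absorb)
  moreover have "Pow (S - {k}) \<inter> insert k ` Pow (S - {k}) = {}" by auto
  ultimately have "(\<Sum>Z\<in>Pow S. f Z) = (\<Sum>Z\<in>Pow (S - {k}). f Z) + (\<Sum>Z\<in>insert k ` Pow (S - {k}). f Z)"
    using assms(1) by (simp add: sum.union_disjoint)
  also have "(\<Sum>Z\<in>insert k ` Pow (S - {k}). f Z) = (\<Sum>Z\<in>Pow (S - {k}). f (insert k Z))"
    by (rule sum.reindex_cong[OF _ refl refl]) (auto simp: inj_on_def)
  finally show ?thesis by (simp add: sum.distrib)
qed

text \<open>Assouad's argument: the risk is averaged over all sets \<open>Z\<close> of bumps, and at a point of the core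
  of the bump \<open>k\<close> the sets are paired up as \<open>Z\<close>, \<open>insert k Z\<close>.\<close>

lemma L2_risk:
  fixes z0 :: "real^'d::finite"
  assumes fam: "perturbation_family i0 h 0 z0 \<epsilon> \<Delta> \<kappa> P D \<Theta> F xs Ts"
    and h: "0 < h" "h \<le> 1 / 4" and z0: "\<And>i. 0 \<le> z0 $ i" "\<And>i. z0 $ i < 1 / 2" and \<epsilon>: "0 < \<epsilon>" "\<epsilon> < 1 / 2"
    and \<kappa>: "\<kappa> \<le> 1" and \<Delta>: "0 \<le> \<Delta>"
  shows "ennreal (\<epsilon> ^ CARD('d) * \<Delta>\<^sup>2 / (8 * exp 4)) \<le>
    minimax_risk P D \<Theta> (\<lambda>g f. \<integral>\<^sup>+x\<in>unit_cube. ennreal ((norm (g x - f x))\<^sup>2) \<partial>lborel)"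
proof (rule le_minimax_riskI)
  fix fh R assume fh: "fh \<in> estimators D" and
    R: "\<And>f xs Ts. (f, xs, Ts) \<in> \<Theta> \<Longrightarrow>
      (\<integral>\<^sup>+y. (\<integral>\<^sup>+x\<in>unit_cube. ennreal ((norm (fh xs Ts y x - f x))\<^sup>2) \<partial>lborel) \<partial>obs_law P D (f, xs, Ts)) \<le> R"
  define S where "S = (grid_cells h :: ('d \<Rightarrow> int) set)"
  have S: "finite S" by (simp add: S_def finite_grid_cells)
  have adm: "admissible i0 h 0 Z" if "Z \<subseteq> S" for Z
    using that h unfolding S_def by (intro admissible_grid_cells)
  define M where "M Z = obs_law P D (F Z, xs, Ts)" for Z
  define \<phi> where "\<phi> Z y x = ennreal ((norm (fh xs Ts y x - F Z x))\<^sup>2)" for Z y x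
  define \<rho> where "\<rho> Z x = (\<integral>\<^sup>+y. \<phi> Z y x \<partial>M Z)" for Z x
  define Q where "Q k = bump_core h 0 z0 \<epsilon> k" for k
  \<comment> \<open>The two-point bound for \<open>q = 1 / 2\<close> and \<open>t = exp 4\<close>;
    \<open>v\<close> below is the volume of one core.\<close>
  define s where "s = 1 / 2 * (\<Delta>\<^sup>2 / 2) / exp 4"
  define v where "v = (2 * \<epsilon> * h) ^ CARD('d)"
  have "0 \<le> s" "0 \<le> v" using \<epsilon> h by (auto simp: s_def v_def)
  note Q_meas[measurable] = emeasure_bump_core(1)[OF h(1) \<epsilon>(1), of z0, folded Q_def]
  note Q_vol = emeasure_bump_core(2)[OF h(1) \<epsilon>(1), of z0, folded Q_def v_def]
  \<comment> \<open>\<open>hard_to_distinguish\<close> contains that both laws are probability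
    measures; to apply it, some bump \<open>k\<close> must be at hand.\<close>
  have prob: "prob_space (M Z)" if k: "k \<in> S" and Z: "Z \<subseteq> S" for Z k
  proof -
    have "insert k Z \<subseteq> S" using k Z by blast
    from hard_family[OF fam \<kappa> adm[OF this]] show ?thesis by (simp add: hard_to_distinguish_def M_def)
  qed
  have \<phi>_meas: "(\<lambda>(y, x). \<phi> Z y x) \<in> borel_measurable (M Z \<Otimes>\<^sub>M lborel)" for Z
  proof -
    have [measurable]: "(\<lambda>z. fh xs Ts (fst z) (snd z)) \<in> M Z \<Otimes>\<^sub>M lborel \<rightarrow>\<^sub>M borel"
      using estimator_measurable(1)[OF fh, of xs Ts P "F Z"]
      by (simp add: M_def case_prod_beta cong: measurable_cong_sets sets_pair_measure_cong)
    have [measurable]: "F Z \<in> borel_measurable borel" by (rule perturbation_familyD(5)[OF fam])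
    show ?thesis unfolding \<phi>_def case_prod_beta by measurable
  qed
  \<comment> \<open>The cores are disjoint and lie in the cube, so the integral over the cube
    dominates the sum over the cores.\<close>
  have cube: "(\<Sum>k\<in>S. indicator (Q k) x) \<le> (indicator unit_cube x :: ennreal)" for x
  proof (cases "\<exists>k\<in>S. x \<in> Q k")
    case True
    then obtain k where k: "k \<in> S" "x \<in> Q k" by blast
    have "x \<in> unit_cube"
      using bump_core_subset_cube[of k h z0 \<epsilon>] k h z0 \<epsilon> unfolding S_def Q_def by blast
    have "(\<Sum>j\<in>S. indicator (Q j) x) = (\<Sum>j\<in>S. if j = k then 1 else 0 :: ennreal)"
    proof (rule sum.cong[OF refl])
      fix j
      show "indicator (Q j) x = (if j = k then 1 else 0 :: ennreal)"
      proof (cases "x \<in> Q j")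
        case True
        then have "j = k"
          using bump_core_disjoint[OF True[unfolded Q_def] k(2)[unfolded Q_def] \<epsilon>(2)] by simp
        then show ?thesis using True by simp
      next
        case False
        then have "j \<noteq> k" using k(2) by metis
        then show ?thesis using False by simp
      qed
    qed
    then show ?thesis using k S \<open>x \<in> unit_cube\<close> by simp
  next
    case False
    then have "(\<Sum>k\<in>S. indicator (Q k) x) = (\<Sum>k\<in>S. 0 :: ennreal)" by (intro sum.cong) auto
    then show ?thesis by simp
  qed
  have \<rho>_meas[measurable]: "\<rho> Z \<in> borel_measurable lborel" if "k \<in> S" "Z \<subseteq> S" for Z k
  proof -
    interpret prob_space "M Z" by (rule prob[OF that])
    have "(\<lambda>(x, y). \<phi> Z y x) \<in> borel_measurable (lborel \<Otimes>\<^sub>M M Z)"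
      using measurable_pair_swap[OF \<phi>_meas[of Z]] by (simp add: case_prod_beta)
    then show ?thesis unfolding \<rho>_def[abs_def] by (rule borel_measurable_nn_integral)
  qed
  \<comment> \<open>Exchanging the integrals turns the mean of the integrated loss into an integral
    of pointwise risks.\<close>
  have R_ge: "(\<Sum>k\<in>S. \<integral>\<^sup>+x. \<rho> Z x * indicator (Q k) x \<partial>lborel) \<le> R" if Z: "Z \<subseteq> S" and k0: "k0 \<in> S" for Z k0
  proof -
    interpret prob_space "M Z" by (rule prob[OF k0 Z])
    interpret pair_sigma_finite "M Z" lborel ..
    note [measurable] = \<phi>_meas[of Z] \<rho>_meas[OF k0 Z]
    have "(\<Sum>k\<in>S. \<integral>\<^sup>+x. \<rho> Z x * indicator (Q k) x \<partial>lborel) = (\<integral>\<^sup>+x. (\<Sum>k\<in>S. \<rho> Z x * indicator (Q k) x) \<partial>lborel)"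
      by (rule nn_integral_sum[symmetric]) measurable
    also have "\<dots> = (\<integral>\<^sup>+x. (\<integral>\<^sup>+y. \<phi> Z y x * (\<Sum>k\<in>S. indicator (Q k) x) \<partial>M Z) \<partial>lborel)"
    proof (rule nn_integral_cong)
      fix x
      have [measurable]: "(\<lambda>y. \<phi> Z y x) \<in> borel_measurable (M Z)"
      proof -
        have "(\<lambda>y. (y, x)) \<in> M Z \<rightarrow>\<^sub>M M Z \<Otimes>\<^sub>M lborel" by simp
        from measurable_compose[OF this \<phi>_meas[of Z]] show ?thesis by simp
      qed
      show "(\<Sum>k\<in>S. \<rho> Z x * indicator (Q k) x) = (\<integral>\<^sup>+y. \<phi> Z y x * (\<Sum>k\<in>S. indicator (Q k) x) \<partial>M Z)"
        unfolding \<rho>_def sum_distrib_left[symmetric] by (rule nn_integral_multc[symmetric]) measurable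
    qed
    also have "\<dots> = (\<integral>\<^sup>+y. (\<integral>\<^sup>+x. \<phi> Z y x * (\<Sum>k\<in>S. indicator (Q k) x) \<partial>lborel) \<partial>M Z)"
      by (rule Fubini') measurable
    also have "\<dots> \<le> (\<integral>\<^sup>+y. (\<integral>\<^sup>+x. \<phi> Z y x * indicator unit_cube x \<partial>lborel) \<partial>M Z)"
      by (intro nn_integral_mono mult_left_mono cube) simp
    also have "\<dots> \<le> R"
      unfolding \<phi>_def M_def by (rule R[OF perturbation_familyD(1)[OF fam adm[OF Z]]])
    finally show ?thesis .
  qed
  have pair: "ennreal s \<le> \<rho> Z x + \<rho> (insert k Z) x" if "k \<in> S" "Z \<subseteq> S - {k}" "x \<in> Q k" for Z x k
  proof -
    have "insert k Z \<subseteq> S" "k \<notin> Z" using that by auto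
    have "\<Delta> \<le> norm (F (insert k Z) x - F Z x)"
      by (rule perturbation_familyD(3)[OF fam \<open>k \<notin> Z\<close> that(3)[unfolded Q_def]])
    from two_point_risk[OF fh hard_family[OF fam \<kappa> adm[OF \<open>insert k Z \<subseteq> S\<close>]] _ \<Delta> this]
    show ?thesis by (simp add: s_def \<rho>_def \<phi>_def M_def add.commute)
  qed
  define n where "n = card S"
  have n: "1 \<le> n" and n_ge: "(1 / (2 * h)) ^ CARD('d) \<le> real n"
  proof -
    show ge: "(1 / (2 * h)) ^ CARD('d) \<le> real n"
      using card_grid_cells[OF h, where 'd = 'd] by (simp add: n_def S_def)
    have "0 < (1 / (2 * h)) ^ CARD('d)" using h by simp
    then show "1 \<le> n" using ge by linarith
  qed
  then obtain k0 where k0: "k0 \<in> S" unfolding n_def by (metis card.empty ex_in_conv not_one_le_zero)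
  have two_power: "ennreal (2 ^ j) = 2 ^ j" for j
    using ennreal_power[of 2 j] by simp
  have core: "ennreal (2 ^ (n - 1) * (s * v)) \<le> (\<Sum>Z\<in>Pow S. \<integral>\<^sup>+x. \<rho> Z x * indicator (Q k) x \<partial>lborel)" if k: "k \<in> S" for k
  proof -
    \<comment> \<open>Half of the \<open>2 ^ n\<close> subsets avoid \<open>k\<close>, and each of
      them gives one pair; hence the division by \<open>2\<close> at the end.\<close>
    have card: "card (Pow (S - {k})) = 2 ^ (n - 1)" using S k by (simp add: card_Pow n_def)
    have "ennreal (2 ^ (n - 1) * (s * v)) = (\<Sum>Z\<in>Pow (S - {k}). ennreal (s * v))"
      using \<open>0 \<le> s\<close> \<open>0 \<le> v\<close> unfolding sum_constant card by (simp add: ennreal_mult two_power)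
    also have "\<dots> = (\<Sum>Z\<in>Pow (S - {k}). \<integral>\<^sup>+x. ennreal s * indicator (Q k) x \<partial>lborel)"
      using \<open>0 \<le> s\<close> \<open>0 \<le> v\<close> by (simp add: nn_integral_cmult_indicator Q_vol ennreal_mult)
    also have "\<dots> \<le> (\<Sum>Z\<in>Pow (S - {k}). (\<integral>\<^sup>+x. \<rho> Z x * indicator (Q k) x \<partial>lborel) + (\<integral>\<^sup>+x. \<rho> (insert k Z) x * indicator (Q k) x \<partial>lborel))"
    proof (rule sum_mono)
      fix Z assume Z: "Z \<in> Pow (S - {k})"
      then have "Z \<subseteq> S" "insert k Z \<subseteq> S" using k by auto
      note [measurable] = this[THEN \<rho>_meas[OF k]]
      have "(\<integral>\<^sup>+x. ennreal s * indicator (Q k) x \<partial>lborel) \<le> (\<integral>\<^sup>+x. \<rho> Z x * indicator (Q k) x + \<rho> (insert k Z) x * indicator (Q k) x \<partial>lborel)"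
        using pair[OF k] Z by (intro nn_integral_mono) (auto simp: indicator_def)
      also have "\<dots> = (\<integral>\<^sup>+x. \<rho> Z x * indicator (Q k) x \<partial>lborel) + (\<integral>\<^sup>+x. \<rho> (insert k Z) x * indicator (Q k) x \<partial>lborel)"
        by (rule nn_integral_add) measurable
      finally show "(\<integral>\<^sup>+x. ennreal s * indicator (Q k) x \<partial>lborel) \<le>
          (\<integral>\<^sup>+x. \<rho> Z x * indicator (Q k) x \<partial>lborel) + (\<integral>\<^sup>+x. \<rho> (insert k Z) x * indicator (Q k) x \<partial>lborel)" .
    qed
    also have "\<dots> = (\<Sum>Z\<in>Pow S. \<integral>\<^sup>+x. \<rho> Z x * indicator (Q k) x \<partial>lborel)"
      by (rule sum_Pow_insert[OF S k, symmetric])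
    finally show ?thesis .
  qed
  have "ennreal (2 ^ (n - 1) * (real n * (s * v))) = (\<Sum>k\<in>S. ennreal (2 ^ (n - 1) * (s * v)))"
    using \<open>0 \<le> s\<close> \<open>0 \<le> v\<close> unfolding sum_constant n_def[symmetric]
    by (simp add: ennreal_mult two_power ennreal_of_nat_eq_real_of_nat mult_ac)
  also have "\<dots> \<le> (\<Sum>k\<in>S. \<Sum>Z\<in>Pow S. \<integral>\<^sup>+x. \<rho> Z x * indicator (Q k) x \<partial>lborel)"
    by (intro sum_mono core)
  also have "\<dots> = (\<Sum>Z\<in>Pow S. \<Sum>k\<in>S. \<integral>\<^sup>+x. \<rho> Z x * indicator (Q k) x \<partial>lborel)"
    by (rule sum.swap)
  also have "\<dots> \<le> (\<Sum>Z\<in>Pow S. R)"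
    using R_ge k0 by (intro sum_mono) auto
  also have "\<dots> = 2 ^ n * R" using S by (simp add: card_Pow n_def)
  finally have le: "ennreal (2 ^ (n - 1) * (real n * (s * v))) \<le> 2 ^ n * R" .
  have "ennreal (real n * (s * v) / 2) \<le> R"
  proof (cases R)
    case (real r)
    have "ennreal (2 ^ (n - 1) * (real n * (s * v))) \<le> ennreal (2 ^ n * r)"
      using le real by (simp add: ennreal_mult two_power)
    then have "2 ^ (n - 1) * (real n * (s * v)) \<le> 2 ^ n * r" using real by simp
    moreover have "(2::real) ^ n = 2 ^ (n - 1) * 2" using n by (cases n) auto
    ultimately have "real n * (s * v) \<le> 2 * r" by simp
    then show ?thesis by (simp add: real(2) ennreal_leI)
  qed simp
  moreover have "\<epsilon> ^ CARD('d) * \<Delta>\<^sup>2 / (8 * exp 4) \<le> real n * (s * v) / 2"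
  proof -
    \<comment> \<open>Many small cores fill a fixed share of the cube: their number times their
      volume is bounded below independently of \<open>h\<close>.\<close>
    have "\<epsilon> ^ CARD('d) = (1 / (2 * h)) ^ CARD('d) * v"
      using h by (simp add: v_def flip: power_mult_distrib)
    also have "\<dots> \<le> real n * v" using n_ge \<open>0 \<le> v\<close> by (rule mult_right_mono)
    finally have "\<epsilon> ^ CARD('d) * s \<le> real n * v * s" using \<open>0 \<le> s\<close> by (rule mult_right_mono)
    then show ?thesis by (simp add: s_def field_simps)
  qed
  ultimately show "ennreal (\<epsilon> ^ CARD('d) * \<Delta>\<^sup>2 / (8 * exp 4)) \<le> R"
    using ennreal_leI order_trans by blast
qed

section \<open>Choice of the bandwidth\<close>

lemma ln_le_half: "0 < x \<Longrightarrow> ln x \<le> x / 2" for x :: real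
proof -
  assume "0 < x"
  then have "ln (x / 2) \<le> x / 2 - 1" by (intro ln_le_minus_one) simp
  then have "ln x - ln 2 \<le> x / 2 - 1" using \<open>0 < x\<close> by (simp add: ln_div)
  then show ?thesis using ln_2_less_1 by linarith
qed

text \<open>The divergence \<open>K / C * ln n\<close> has to stay below a fraction of the logarithm
  of the number of cells, which is at least of order \<open>ln n / E\<close>. This is why
  \<open>C\<close> has to dominate \<open>8 * E * K\<close>; the lower bound on \<open>ln n\<close>
  absorbs the constant terms.\<close>

lemma sup_bandwidth:
  fixes n E K C :: real and d :: nat
  defines "H \<equiv> (ln n / n) powr (1 / E)"
  assumes "d \<ge> 1" "E > 0" "K \<ge> 0" "C > 0" "8 * E * K \<le> C" "n > 1" "4 * E * (2 + real d) \<le> ln n" "1 \<le> ln n"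
  shows "0 < H" "H \<le> 1 / 8" "exp (2 * (K / C * ln n + 1)) \<le> (1 / (2 * H)) ^ d" "n * H powr E = ln n"
proof -
  define l where "l = ln n"
  have l: "l > 0" using assms by (simp add: l_def)
  show H: "0 < H" using assms by (simp add: H_def)
  have "ln H = (ln l - l) / E" using assms l by (simp add: H_def l_def ln_powr ln_div)
  \<comment> \<open>Half of \<open>ln n\<close> absorbs \<open>ln (ln n)\<close>.\<close>
  also have "\<dots> \<le> (l / 2 - l) / E" using ln_le_half[OF l] assms by (intro divide_right_mono) auto
  finally have "ln H \<le> - l / (2 * E)" by (simp add: field_simps)
  define r where "r = l / (2 * E)"
  have lnH: "ln H \<le> - r" using \<open>ln H \<le> - l / (2 * E)\<close> by (simp add: r_def)
  have big: "2 * (2 + real d) \<le> r" using assms by (simp add: r_def l_def field_simps)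
  have ln2: "ln 2 < (1::real)" by (rule ln_2_less_1)
  have "ln 8 = 3 * ln (2::real)" using ln_realpow[of 2 3] by simp
  then have "ln 8 \<le> (4::real)" using ln2 by linarith
  also have "\<dots> \<le> 2 * (2 + real d)" by simp
  also note big
  finally have "ln 8 \<le> r" .
  then have "ln H \<le> ln (1 / 8)" using lnH by (simp add: ln_div)
  then show "H \<le> 1 / 8" using H by simp
  have "K / C * l \<le> l / (8 * E)"
  proof -
    have "K / C \<le> 1 / (8 * E)" using assms by (simp add: field_simps)
    then show ?thesis using l mult_right_mono[of "K / C" "1 / (8 * E)" l] by simp
  qed
  then have "2 * (K / C * l + 1) \<le> r / 2 + 2" by (simp add: r_def)
  also have "\<dots> \<le> r - real d" using big by simp
  also have "\<dots> \<le> real d * r - real d * ln 2"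
  proof -
    have "0 \<le> r" using l assms by (simp add: r_def)
    then have "1 * r \<le> real d * r" using assms by (intro mult_right_mono) auto
    moreover have "real d * ln 2 \<le> real d * 1" using ln2 by (intro mult_left_mono) auto
    ultimately show ?thesis by linarith
  qed
  also have "\<dots> = real d * (r - ln 2)" by (simp add: algebra_simps)
  also have "\<dots> \<le> real d * (- ln H - ln 2)" using lnH by (intro mult_left_mono) auto
  also have "- ln H - ln 2 = ln (1 / (2 * H))" using H by (simp add: ln_div ln_mult)
  also have "real d * ln (1 / (2 * H)) = ln ((1 / (2 * H)) ^ d)" using H by (simp add: ln_realpow)
  finally have "2 * (K / C * ln n + 1) \<le> ln ((1 / (2 * H)) ^ d)" by (simp add: l_def)
  moreover have "0 < (1 / (2 * H)) ^ d" using H by simp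
  ultimately show "exp (2 * (K / C * ln n + 1)) \<le> (1 / (2 * H)) ^ d" by (metis exp_le_cancel_iff exp_ln)
  have "H powr E = ln n / n" using assms by (simp add: H_def powr_powr)
  then show "n * H powr E = ln n" using assms by simp
qed

lemma scaled_risk_ge:
  assumes "ennreal r \<le> X" "s \<le> C * r" "0 < C"
  shows "ennreal s \<le> ennreal C * X"
proof -
  have "ennreal s \<le> ennreal (C * r)" using assms by (intro ennreal_leI)
  also have "\<dots> = ennreal C * ennreal r" using assms by (simp add: ennreal_mult')
  also have "\<dots> \<le> ennreal C * X" using assms by (intro mult_left_mono) auto
  finally show ?thesis .
qed

theorem corollary4p13:
  fixes \<beta> L\<beta> Cnoise Ccvrtm :: real and L :: "nat \<Rightarrow> real"
  assumes "CARD('d::finite) \<ge> 2" and "\<beta> \<ge> 1"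
    and "\<forall>k\<le>holder_order \<beta>. L k > 0" and "L\<beta> > 0" and "Cnoise > 0" and "Ccvrtm > 0"
  shows "\<exists>C>0. \<forall>(n::nat) (\<delta>::real) (Tsum::real) (P::(real^'d) measure) (D::design).
    n \<ge> 1 \<longrightarrow> \<delta> > 0 \<longrightarrow> Tsum > 0 \<longrightarrow> noise_law Cnoise P \<longrightarrow>
    (\<forall>(f, xs, Ts)\<in>(snake_model \<beta> L L\<beta> \<delta> Tsum n :: 'd snake set).
       valid_times n Ts (D Ts) \<and> cover_time Ccvrtm n Tsum Ts (D Ts)) \<longrightarrow>
    C * max ((Tsum / real n) powr (2 * \<beta> + real CARD('d) + 1)) (inverse Tsum)
      \<le> \<delta> ^ (CARD('d) - 1) \<longrightarrow>
    \<delta> ^ (CARD('d) - 1) \<le> inverse C * min 1 (real n / Tsum) \<longrightarrow>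
    (\<forall>x0\<in>unit_cube.
       ennreal C * minimax_risk P D (snake_model \<beta> L L\<beta> \<delta> Tsum n)
           (\<lambda>g f. ennreal ((norm (g x0 - f x0))\<^sup>2))
         \<ge> ennreal (real n powr - (2 * \<beta> / (2 * (\<beta> + 1) + real CARD('d))))) \<and>
    ennreal C * minimax_risk P D (snake_model \<beta> L L\<beta> \<delta> Tsum n)
        (\<lambda>g f. SUP x\<in>unit_cube. ennreal ((norm (g x - f x))\<^sup>2))
      \<ge> ennreal ((real n / ln (real n)) powr - (2 * \<beta> / (2 * (\<beta> + 1) + real CARD('d)))) \<and>
    ennreal C * minimax_risk P D (snake_model \<beta> L L\<beta> \<delta> Tsum n)
        (\<lambda>g f. \<integral>\<^sup>+x\<in>unit_cube. ennreal ((norm (g x - f x))\<^sup>2) \<partial>lborel)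
      \<ge> ennreal (real n powr - (2 * \<beta> / (2 * (\<beta> + 1) + real CARD('d))))"
proof -
  let ?d = "CARD('d)"
  define E where "E = 2 * (\<beta> + 1) + real ?d"
  have E: "E > 0" "2 * \<beta> + 2 + real ?d = E" using assms(2) by (auto simp: E_def)
  obtain i0 :: 'd and z0 :: "real^'d" and \<epsilon> a0 K C0 where
    const: "0 < \<epsilon>" "\<epsilon> < 1 / 2" "0 < a0" "0 \<le> K" "1 \<le> C0" and
    z0: "\<forall>i. 0 \<le> z0 $ i \<and> z0 $ i < 1 / 2" "\<forall>i. i \<noteq> i0 \<longrightarrow> z0 $ i = 0" and
    family: "\<forall>C n \<delta> Tsum P (D::design) h p. C0 \<le> C \<longrightarrow> regime ?d \<beta> C n \<delta> Tsum \<longrightarrow> noise_law Cnoise P \<longrightarrow>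
       design_ok Ccvrtm n Tsum D (snake_model \<beta> L L\<beta> \<delta> Tsum n :: 'd snake set) \<longrightarrow>
       \<delta> / real ?d \<le> h \<longrightarrow> h \<le> 1 \<longrightarrow> (\<forall>i. i \<noteq> i0 \<longrightarrow> p $ i \<in> {0..1}) \<longrightarrow>
       (\<exists>F xs Ts. perturbation_family i0 h p z0 \<epsilon> (a0 * h powr \<beta>)
          (if h = \<delta> / real ?d then 0 else K / C * max 1 (real n * h powr (2 * \<beta> + 2 + real ?d)))
          P D (snake_model \<beta> L L\<beta> \<delta> Tsum n) F xs Ts)"
    using exists_perturbation_family[OF assms] by (elim exE conjE) blast
  \<comment> \<open>\<open>C0\<close> is for the family, \<open>K\<close> for divergences of at most
    \<open>1\<close>, \<open>8 * E * K\<close> and the exponential for \<open>sup_bandwidth\<close>,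
    \<open>3\<close> for \<open>ln n \<ge> 1\<close>, and \<open>8 ^ (?d - 1)\<close> for
    \<open>\<delta> \<le> 1 / 8\<close>. The last three compensate the constants of the three risk
    bounds. Entries that concern \<open>n\<close> act through \<open>C \<le> real n\<close>.\<close>
  define S where "S = {C0, K, 8 * E * K, 3, 8 ^ (?d - 1), exp (4 * E * (2 + real ?d)),
    8 * exp 4 / a0\<^sup>2, 16 / a0\<^sup>2, 8 * exp 4 / (\<epsilon> ^ ?d * a0\<^sup>2)}"
  define C where "C = Max S"
  have C_ge: "x \<le> C" if "x \<in> S" for x unfolding C_def using that by (intro Max_ge) (auto simp: S_def)
  have C: "C0 \<le> C" "K \<le> C" "8 * E * K \<le> C" "3 \<le> C" "8 ^ (?d - 1) \<le> C" "exp (4 * E * (2 + real ?d)) \<le> C"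
    "8 * exp 4 / a0\<^sup>2 \<le> C" "16 / a0\<^sup>2 \<le> C" "8 * exp 4 / (\<epsilon> ^ ?d * a0\<^sup>2) \<le> C"
    by (rule C_ge, simp add: S_def)+
  have "C > 0" using C(4) by simp
  show ?thesis
  proof (rule exI[of _ C], intro conjI allI impI, rule \<open>C > 0\<close>)
    fix n :: nat and \<delta> Tsum :: real and P :: "(real^'d) measure" and D :: design
    assume "n \<ge> 1" "\<delta> > 0" "Tsum > 0" and P: "noise_law Cnoise P" and
      design: "\<forall>(f, xs, Ts)\<in>(snake_model \<beta> L L\<beta> \<delta> Tsum n :: 'd snake set).
         valid_times n Ts (D Ts) \<and> cover_time Ccvrtm n Tsum Ts (D Ts)" and
      lo: "C * max ((Tsum / real n) powr (2 * \<beta> + real ?d + 1)) (inverse Tsum) \<le> \<delta> ^ (?d - 1)" and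
      hi: "\<delta> ^ (?d - 1) \<le> inverse C * min 1 (real n / Tsum)"
    let ?\<Theta> = "snake_model \<beta> L L\<beta> \<delta> Tsum n :: 'd snake set"
    define w where "w = \<delta> / real ?d"
    have reg: "regime ?d \<beta> C n \<delta> Tsum"
      using \<open>n \<ge> 1\<close> \<open>\<delta> > 0\<close> \<open>Tsum > 0\<close> lo hi by (simp add: regime_def)
    have ok: "design_ok Ccvrtm n Tsum D ?\<Theta>" using design by (simp add: design_ok_def)
    have "1 \<le> C" "\<beta> > 0" using C(4) assms(2) by auto
    note R = regimeD[OF reg \<open>1 \<le> C\<close> assms(1) \<open>\<beta> > 0\<close>]
    have w: "0 < w" "w \<le> 1 / 8"
    proof -
      show "0 < w" using \<open>\<delta> > 0\<close> by (simp add: w_def)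
      have "\<delta> ^ (?d - 1) \<le> inverse (8 ^ (?d - 1))"
        using R(7) C(5) le_imp_inverse_le[of "8 ^ (?d - 1)" C] by simp
      also have "\<dots> = (1 / 8) ^ (?d - 1)" by (simp add: power_divide inverse_eq_divide)
      finally have "\<delta> \<le> 1 / 8"
        using assms(1) \<open>\<delta> > 0\<close> by (subst (asm) power_mono_iff) auto
      moreover have "w \<le> \<delta>" using \<open>\<delta> > 0\<close> by (simp add: w_def divide_le_eq)
      ultimately show "w \<le> 1 / 8" by linarith
    qed
    have "C * 1 \<le> C\<^sup>2" using C(4) by (simp add: power2_eq_square)
    then have nC: "C \<le> real n" using R(4) by linarith
    have n3: "real n \<ge> 3" using nC C(4) by linarith
    have "exp (4 * E * (2 + real ?d)) \<le> real n" using nC C(6) by linarith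
    then have ln_n: "4 * E * (2 + real ?d) \<le> ln (real n)" using n3 by (simp add: ln_ge_iff)
    have ln_n1: "1 \<le> ln (real n)" using n3 exp_le by (subst ln_ge_iff) linarith+
    \<comment> \<open>\<open>max H w\<close> treats both regimes at once; the disjunction records
      which width was taken and the divergence that goes with it.\<close>
    have get_family: "\<exists>F xs Ts \<kappa>. perturbation_family i0 h p z0 \<epsilon> (a0 * h powr \<beta>) \<kappa> P D ?\<Theta> F xs Ts \<and>
        0 \<le> \<kappa> \<and> (h = w \<and> \<kappa> = 0 \<or> h = H \<and> \<kappa> = K / C * max 1 (real n * H powr E))"
      if hyp: "h = max H w" "H \<le> 1" "\<forall>i. i \<noteq> i0 \<longrightarrow> p $ i \<in> {0..1}" for H h p
    proof -
      have "\<delta> / real ?d \<le> h" "h \<le> 1" using hyp w by (auto simp: w_def)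
      then obtain F xs Ts where fam: "perturbation_family i0 h p z0 \<epsilon> (a0 * h powr \<beta>)
          (if h = w then 0 else K / C * max 1 (real n * h powr E)) P D ?\<Theta> F xs Ts"
        using family C(1) reg P ok hyp(3) unfolding w_def E(2) by blast
      show ?thesis
      proof (cases "h = w")
        case True
        then show ?thesis using fam by auto
      next
        case False
        then have "h = H" using hyp(1) by (auto simp: max_def split: if_splits)
        moreover have "0 \<le> K / C * max 1 (real n * H powr E)"
          using const(4) \<open>C > 0\<close> by (intro mult_nonneg_nonneg) auto
        ultimately show ?thesis using fam False by auto
      qed
    qed
    \<comment> \<open>Replacing \<open>H\<close> by a larger width only increases the separation, so
      the rate of \<open>H\<close> is kept.\<close>
    have powr_sq: "(a0 * h powr \<beta>)\<^sup>2 \<ge> a0\<^sup>2 * H powr (2 * \<beta>)" if "0 < H" "H \<le> h" for h H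
    proof -
      have "H powr (2 * \<beta>) \<le> h powr (2 * \<beta>)" using that \<open>\<beta> > 0\<close> by (intro powr_mono2) auto
      moreover have "(h powr \<beta>)\<^sup>2 = h powr (2 * \<beta>)" by (simp add: power2_eq_square flip: powr_add)
      ultimately show ?thesis by (simp add: power_mult_distrib mult_left_mono)
    qed
    define H where "H = real n powr (- 1 / E)"
    have H: "0 < H" "H \<le> 1 / 8" "real n * H powr E = 1" "H powr (2 * \<beta>) = real n powr - (2 * \<beta> / E)"
    proof -
      show "0 < H" using n3 by (simp add: H_def)
      have "ln 8 = 3 * ln (2::real)" using ln_realpow[of 2 3] by simp
      then have "ln 8 \<le> (3::real)" using ln_2_less_1 by simp
      moreover have "3 \<le> ln (real n) / E"
      proof -
        have "E * 3 \<le> E * (4 * (2 + real ?d))" using E(1) by (intro mult_left_mono) auto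
        also have "\<dots> = 4 * E * (2 + real ?d)" by simp
        also note ln_n
        finally show ?thesis using E(1) by (simp add: pos_le_divide_eq mult.commute)
      qed
      ultimately have "ln H \<le> ln (1 / 8)" using n3 by (simp add: H_def ln_powr ln_div)
      then show "H \<le> 1 / 8" using \<open>0 < H\<close> by simp
      have "H powr E = real n powr (- 1 / E * E)" by (simp only: H_def powr_powr)
      also have "- 1 / E * E = - 1" using E(1) by simp
      finally have "H powr E = inverse (real n)" using n3 by (simp add: powr_minus)
      then show "real n * H powr E = 1" using n3 by simp
      have "H powr (2 * \<beta>) = real n powr (- 1 / E * (2 * \<beta>))" by (simp only: H_def powr_powr)
      also have "- 1 / E * (2 * \<beta>) = - (2 * \<beta> / E)" by simp
      finally show "H powr (2 * \<beta>) = real n powr - (2 * \<beta> / E)" .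
    qed
    define h where "h = max H w"
    have h: "0 < h" "h \<le> 1 / 4" "h \<le> 1" "H \<le> h" using H w by (auto simp: h_def)
    have a0h: "0 \<le> a0 * h powr \<beta>" using const(3) by simp
    have \<kappa>_le: "\<kappa> \<le> 1" if "h = w \<and> \<kappa> = 0 \<or> h = H \<and> \<kappa> = K / C * max 1 (real n * H powr E)" for \<kappa>
      using that H(3) C(2) \<open>C > 0\<close> by (auto simp: divide_le_eq)
    show "\<forall>x0\<in>unit_cube. ennreal (real n powr - (2 * \<beta> / (2 * (\<beta> + 1) + real ?d))) \<le>
       ennreal C * minimax_risk P D ?\<Theta> (\<lambda>g f. ennreal ((norm (g x0 - f x0))\<^sup>2))"
    proof
      fix x0 :: "real^'d" assume x0: "x0 \<in> unit_cube"
      have "\<forall>i. i \<noteq> i0 \<longrightarrow> (x0 - h *\<^sub>R z0) $ i \<in> {0..1}" using x0 z0(2) by (simp add: unit_cube_def)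
      then obtain F xs Ts \<kappa> where fam: "perturbation_family i0 h (x0 - h *\<^sub>R z0) z0 \<epsilon> (a0 * h powr \<beta>) \<kappa> P D ?\<Theta> F xs Ts"
        and \<kappa>: "h = w \<and> \<kappa> = 0 \<or> h = H \<and> \<kappa> = K / C * max 1 (real n * H powr E)"
        using get_family[OF h_def, of "x0 - h *\<^sub>R z0"] H(2) by auto
      have "ennreal ((a0 * h powr \<beta>)\<^sup>2 / (8 * exp 4)) \<le> minimax_risk P D ?\<Theta> (\<lambda>g f. ennreal ((norm (g x0 - f x0))\<^sup>2))"
        using z0(1) const by (intro pointwise_risk[OF fam \<kappa>_le[OF \<kappa>] a0h h(1,3) x0]) auto
      moreover have "real n powr - (2 * \<beta> / E) \<le> C * ((a0 * h powr \<beta>)\<^sup>2 / (8 * exp 4))"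
      proof -
        have "8 * exp 4 \<le> C * a0\<^sup>2" using C(7) const(3) by (simp add: pos_divide_le_eq)
        then have "H powr (2 * \<beta>) * (8 * exp 4) \<le> H powr (2 * \<beta>) * (C * a0\<^sup>2)" by (intro mult_left_mono) auto
        also have "\<dots> \<le> C * (a0 * h powr \<beta>)\<^sup>2"
          using mult_left_mono[OF powr_sq[OF H(1) h(4)], of C] \<open>C > 0\<close> by (simp add: mult_ac)
        finally show ?thesis by (simp add: H(4) pos_le_divide_eq)
      qed
      ultimately show "ennreal (real n powr - (2 * \<beta> / (2 * (\<beta> + 1) + real ?d))) \<le>
        ennreal C * minimax_risk P D ?\<Theta> (\<lambda>g f. ennreal ((norm (g x0 - f x0))\<^sup>2))"
        unfolding E_def[symmetric] using \<open>C > 0\<close> by (rule scaled_risk_ge)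
    qed
    show "ennreal (real n powr - (2 * \<beta> / (2 * (\<beta> + 1) + real ?d))) \<le>
       ennreal C * minimax_risk P D ?\<Theta> (\<lambda>g f. \<integral>\<^sup>+x\<in>unit_cube. ennreal ((norm (g x - f x))\<^sup>2) \<partial>lborel)"
    proof -
      obtain F xs Ts \<kappa> where fam: "perturbation_family i0 h 0 z0 \<epsilon> (a0 * h powr \<beta>) \<kappa> P D ?\<Theta> F xs Ts"
        and \<kappa>: "h = w \<and> \<kappa> = 0 \<or> h = H \<and> \<kappa> = K / C * max 1 (real n * H powr E)"
        using get_family[OF h_def, of 0] H(2) by auto
      have "ennreal (\<epsilon> ^ ?d * (a0 * h powr \<beta>)\<^sup>2 / (8 * exp 4)) \<le>
          minimax_risk P D ?\<Theta> (\<lambda>g f. \<integral>\<^sup>+x\<in>unit_cube. ennreal ((norm (g x - f x))\<^sup>2) \<partial>lborel)"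
        using z0(1) by (intro L2_risk[OF fam h(1,2) _ _ const(1,2) \<kappa>_le[OF \<kappa>] a0h]) auto
      moreover have "real n powr - (2 * \<beta> / E) \<le> C * (\<epsilon> ^ ?d * (a0 * h powr \<beta>)\<^sup>2 / (8 * exp 4))"
      proof -
        have "8 * exp 4 \<le> C * (\<epsilon> ^ ?d * a0\<^sup>2)" using C(9) const by (simp add: pos_divide_le_eq)
        then have "H powr (2 * \<beta>) * (8 * exp 4) \<le> H powr (2 * \<beta>) * (C * (\<epsilon> ^ ?d * a0\<^sup>2))" by (intro mult_left_mono) auto
        also have "\<dots> \<le> C * (\<epsilon> ^ ?d * (a0 * h powr \<beta>)\<^sup>2)"
          using mult_left_mono[OF powr_sq[OF H(1) h(4)], of "C * \<epsilon> ^ ?d"] \<open>C > 0\<close> const by (simp add: mult_ac)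
        finally show ?thesis by (simp add: H(4) pos_le_divide_eq)
      qed
      ultimately show ?thesis
        unfolding E_def[symmetric] using \<open>C > 0\<close> by (rule scaled_risk_ge)
    qed
    define Hs where "Hs = (ln (real n) / real n) powr (1 / E)"
    have Hs: "0 < Hs" "Hs \<le> 1 / 8" "exp (2 * (K / C * ln (real n) + 1)) \<le> (1 / (2 * Hs)) ^ ?d" "real n * Hs powr E = ln (real n)"
      unfolding Hs_def using assms(1) E(1) const(4) \<open>C > 0\<close> C(3) n3 ln_n ln_n1
      by (intro sup_bandwidth; simp)+
    define hs where "hs = max Hs w"
    have hs: "0 < hs" "hs \<le> 1 / 4" "hs \<le> 1" "Hs \<le> hs" using Hs w by (auto simp: hs_def)
    show "ennreal ((real n / ln (real n)) powr - (2 * \<beta> / (2 * (\<beta> + 1) + real ?d))) \<le>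
       ennreal C * minimax_risk P D ?\<Theta> (\<lambda>g f. SUP x\<in>unit_cube. ennreal ((norm (g x - f x))\<^sup>2))"
    proof -
      obtain F xs Ts \<kappa> where fam: "perturbation_family i0 hs 0 z0 \<epsilon> (a0 * hs powr \<beta>) \<kappa> P D ?\<Theta> F xs Ts"
        and \<kappa>: "0 \<le> \<kappa>" "hs = w \<and> \<kappa> = 0 \<or> hs = Hs \<and> \<kappa> = K / C * max 1 (real n * Hs powr E)"
        using get_family[OF hs_def, of 0] Hs(2) by auto
      have "exp (2 * (\<kappa> + 1)) \<le> (1 / (2 * hs)) ^ ?d"
      proof (cases "hs = Hs \<and> \<kappa> = K / C * max 1 (real n * Hs powr E)")
        case True
        have "max 1 (real n * Hs powr E) = ln (real n)" unfolding Hs(4) using ln_n1 by simp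
        then have "\<kappa> = K / C * ln (real n)" "hs = Hs" using True by simp_all
        then show ?thesis using Hs(3) by (simp only:)
      next
        case False
        then have "hs = w" "\<kappa> = 0" using \<kappa>(2) by auto
        \<comment> \<open>For bumps that no line meets, \<open>w \<le> 1 / 8\<close> alone provides
          enough cells.\<close>
        have "exp (2 * (\<kappa> + 1)) = exp 1 ^ 2" using exp_of_nat_mult[of 2 "1::real"] by (simp add: \<open>\<kappa> = 0\<close>)
        also have "\<dots> \<le> (3::real) ^ 2" using exp_le by (intro power_mono) auto
        also have "\<dots> \<le> 4 ^ 2" by simp
        also have "\<dots> \<le> (4::real) ^ ?d" using assms(1) by (intro power_increasing) auto
        also have "\<dots> \<le> (1 / (2 * hs)) ^ ?d"
          using w \<open>hs = w\<close> by (intro power_mono) (auto simp: pos_le_divide_eq)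
        finally show ?thesis .
      qed
      then have "ennreal ((a0 * hs powr \<beta>)\<^sup>2 / 16) \<le>
          minimax_risk P D ?\<Theta> (\<lambda>g f. SUP x\<in>unit_cube. ennreal ((norm (g x - f x))\<^sup>2))"
        using z0(1) const(3) hs(1) by (intro sup_risk[OF fam hs(1,2) _ _ const(1,2) \<kappa>(1)]) auto
      moreover have "(real n / ln (real n)) powr - (2 * \<beta> / E) \<le> C * ((a0 * hs powr \<beta>)\<^sup>2 / 16)"
      proof -
        have eq: "Hs powr (2 * \<beta>) = (real n / ln (real n)) powr - (2 * \<beta> / E)"
        proof -
          have "Hs powr (2 * \<beta>) = (ln (real n) / real n) powr (2 * \<beta> / E)" by (simp add: Hs_def powr_powr)
          also have "ln (real n) / real n = inverse (real n / ln (real n))" by simp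
          also have "(inverse (real n / ln (real n))) powr (2 * \<beta> / E) = (real n / ln (real n)) powr - (2 * \<beta> / E)"
            using ln_n1 by (simp only: powr_minus inverse_powr) 
          finally show ?thesis .
        qed
        have "16 \<le> C * a0\<^sup>2" using C(8) const(3) by (simp add: pos_divide_le_eq)
        then have "Hs powr (2 * \<beta>) * 16 \<le> Hs powr (2 * \<beta>) * (C * a0\<^sup>2)" by (intro mult_left_mono) auto
        also have "\<dots> \<le> C * (a0 * hs powr \<beta>)\<^sup>2"
          using mult_left_mono[OF powr_sq[OF Hs(1) hs(4)], of C] \<open>C > 0\<close> by (simp add: mult_ac)
        finally show ?thesis by (simp add: eq pos_le_divide_eq)
      qed
      ultimately show ?thesis
        unfolding E_def[symmetric] using \<open>C > 0\<close> by (rule scaled_risk_ge)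
    qed
  qed
qed

end
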